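(* Let $\gamma\in[0,1]$ and $T\in\mathbb N$. Assume that for every $t\in\mathbb N$: (i) $(x,a)\mapsto P(t,x,a,\cdot)$ is weakly continuous, i.e. $\int f\,dP(t,x^n,a^n,\cdot)\to\int f\,dP(t,x^0,a^0,\cdot)$ for all $f\in C_b(\mathbb X)$ whenever $x^n\to x^0$ in $\mathbb X$ and $a^n\to a^0$ in $\mathbb A$; (ii) $\bigcup_{x\in\mathbb X}\mathcal A_t(x)$ is compact and $\mathcal A_t$ is upper hemi-continuous (for every $x$ and every open $U_{\mathbb A}\supseteq\mathcal A_t(x)$ there is an open $U_{\mathbb X}\ni x$ with $\mathcal A_t(z)\subseteq U_{\mathbb A}$ for all $z\in U_{\mathbb X}$); (iii) for every compact $K\subset\mathbb R$, every $(\mu^n)_{n\in\mathbb N}\subset\mathcal P(K)$ converging weakly to $\mu^0\in\mathcal P(K)$ and every $x^n\to x^0$ in $\mathbb X$, $\liminf_{n\to\infty}\sigma_{t,x^n}(\mu^n)\ge\sigma_{t,x^0}(\mu^0)$; (iv) $C_t$ is lower semi-continuous and $\|C_t\|_\infty\le b$, where $b>0$ does not depend on $t$. Then for every $(\mathfrak X,\mathfrak A)\in\Psi$ (whose actions may be history-dependent), $$\inf_{(\mathfrak X^{\mathfrak p},\mathfrak A^{\mathfrak p})\in\Psi}\varsigma^{\mathfrak X^{\mathfrak p}}_{0,T}(\mathfrak C^{\mathfrak p})\le\varsigma^{\mathfrak X}_{0,T}(\mathfrak C),$$ where the infimum is over all Markovian policies $\mathfrak p\in\Pi$.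
   Context: Spaces. $\mathbb N=\{1,2,\dots\}$, $\mathbb N_0=\{0\}\cup\mathbb N$. $\mathbb X$ (states) and $\mathbb A$ (actions) are complete separable metric spaces with Borel $\sigma$-algebras. $\Lambda$ is the set of Borel probability measures on $\mathbb A$ with the weak topology and its Borel $\sigma$-algebra. For closed $F\subseteq\mathbb R$, $\mathcal P(F)$ is the set of Borel probability measures on $F$ with the weak topology; $\mathcal P_b(\mathbb R)$, $\mathcal P_b(\mathbb R^2)$ are the Borel probability measures with bounded support. $\gamma$ is a fixed discount factor. Probability setting. $(\Omega,\mathscr H,\mathbb P)$ is a complete atomless probability space with filtrations $(\mathscr F_t)_{t\in\mathbb N}$, $(\mathscr G_t)_{t\in\mathbb N}$, $\mathscr F_t\subseteq\mathscr G_t\subseteq\mathscr H$, $\mathscr F_1$ containing all $\mathbb P$-null sets; $\mathscr F_0=\mathscr G_0=\{\emptyset,\Omega\}$ and $\mathscr U_t:=\mathscr G_{t-1}\vee\mathscr F_t$. $L^\infty(\Omega,\mathscr H,\mathbb P)$ carries the essential supremum norm. For bounded real $Y$, $P^{Y|\mathscr U}$ denotes a regular conditional distribution of $Y$ given $\mathscr U$, in a version supported in $[-\|Y\|_\infty,\|Y\|_\infty]$ for every $\omega$; $\mathcal L(Y)$ is the law of $Y$. Risk measures. A law-invariant convex risk measure (at the level of distributions) is a map $\sigma:\mathcal P_b(\mathbb R)\to(-\infty,\infty]$, not identically $+\infty$, with: (1) $\sigma(\mu*\delta_c)=\sigma(\mu)+c$ for $c\in\mathbb R$; (2) $\mu((-\infty,r])\ge\mu'((-\infty,r])$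 for all $r$ implies $\sigma(\mu)\le\sigma(\mu')$; (3) for $\zeta\in\mathcal P_b(\mathbb R^2)$ with first and second marginals $\zeta_0,\zeta_1$, and $\theta\in[0,1]$, if $\zeta_\theta$ is the image of $\zeta$ under $(r_0,r_1)\mapsto(1-\theta)r_0+\theta r_1$, then $\sigma(\zeta_\theta)\le(1-\theta)\sigma(\zeta_0)+\theta\sigma(\zeta_1)$. Fix such $\sigma_0$ and $(\sigma_{t,x})_{(t,x)\in\mathbb N\times\mathbb X}$; it is assumed that for every $t$ and compact $K\subset\mathbb R$, $(x,\mu)\mapsto\sigma_{t,x}(\mu)$ is Borel measurable on $\mathbb X\times\mathcal P(K)$, and that $|\sigma_{t,x}(\delta_0)|\le b_t$ for all $x$, for some $b_t\ge0$. Dynamic risk measure. For an $\mathbb X$-valued $(\mathscr F_t)$-adapted process $\mathfrak X=(X_t)_{t\in\mathbb N}$ and $\mathfrak Z=(Z_t)_{t\in\mathbb N_0}\subset L^\infty(\Omega,\mathscr H,\mathbb P)$: $\varsigma^{\mathfrak X}_{T,x,T}(\mathfrak Z):=\sigma_{T,x}(P^{Z_T|\mathscr U_T})$; for $0<t<T$, $\varsigma^{\mathfrak X}_{t,x,T}(\mathfrak Z):=\sigma_{t,x}(P^{W_t^T|\mathscr U_t})$ with $W_t^T:=Z_t+\gamma\,\varsigma^{\mathfrak X}_{t+1,X_{t+1},T}(\mathfrak Z)$; and $\varsigma^{\mathfrak X}_{0,T}(\mathfrak Z):=\sigma_0(\mathcal L(Z_0+\gamma\,\varsigma^{\mathfrak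 X}_{1,X_1,T}(\mathfrak Z)))$. Actions and policies. For $t\in\mathbb N$, $\mathcal A_t:\mathbb X\to2^{\mathbb A}$ is nonempty closed-valued and weakly measurable ($\{x:\mathcal A_t(x)\cap U\ne\emptyset\}\in\mathcal B(\mathbb X)$ for open $U$). $\varpi_t(x):=\{\lambda\in\Lambda:\lambda(\mathcal A_t(x))=1\}$; $\Pi_t$ is the set of measurable $\pi_t:\mathbb X\to\Lambda$ with $\pi_t(x)\in\varpi_t(x)$ for all $x$; $\Pi$ is the set of Markovian policies $\mathfrak p=(\pi_t)_{t\in\mathbb N}$, $\pi_t\in\Pi_t$. Controlled processes. $P$ is a transition kernel: $P(t,x,a,\cdot)$ is a Borel probability on $\mathbb X$, and $(x,a)\mapsto P(t,x,a,B)$ is measurable for $B\in\mathcal B(\mathbb X)$. $\xi_1$ is a Borel probability on $\mathbb X$. $\Psi$ is a set of pairs $(\mathfrak X,\mathfrak A)$, $\mathfrak X=(X_t)_{t\in\mathbb N}$ $\mathbb X$-valued and $(\mathscr F_t)$-adapted, $\mathfrak A=(A_t)_{t\in\mathbb N}$ $\mathbb A$-valued and $(\mathscr G_t)$-adapted, such that $X_1\sim\xi_1$, $\mathbb P(X_{t+1}\in B|\mathscr G_t)=P(t,X_t,A_t,B)$ a.s., and $\mathbb P(A_t\in\mathcal A_t(X_t),\ t\in\mathbb N)=1$. It is assumed that for each $\mathfrak p=(\pi_t)\in\Pi$ there is a pair in $\Psi$, written $(\mathfrak X^{\mathfrak p},\mathfrak A^{\mathfrak p})$, with $\mathbb P(A_t\in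 B|\mathscr U_t)=\mathbb P(A_t\in B|\sigma(X_t))=[\pi_t(X_t)](B)$ a.s. for all $t$, $B\in\mathcal B(\mathbb A)$. Costs. $C_t:\mathbb X\times\mathbb A\times\mathbb X\to\mathbb R$ is Borel measurable for $t\in\mathbb N$, $C_0\equiv0$; $\mathfrak C:=(C_t(X_t,A_t,X_{t+1}))_{t\in\mathbb N_0}$ (zero entry at $t=0$), and $\mathfrak C^{\mathfrak p}$ is the same for $(\mathfrak X^{\mathfrak p},\mathfrak A^{\mathfrak p})$. *)

theory Defs
  imports "HOL-Probability.Probability"
begin

section \<open>Spaces of Borel probability measures\<close>

definition borel_probs :: "'a::topological_space measure set" where
  "borel_probs = {\<mu>. prob_space \<mu> \<and> sets \<mu> = sets borel}"

definition weak_topology :: "'a::topological_space measure topology" where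
  "weak_topology = topology_generated_by
     {{\<mu> \<in> borel_probs. (\<integral>x. f x \<partial>\<mu>) \<in> V} | (f :: 'a \<Rightarrow> real) V.
        continuous_on UNIV f \<and> bounded (range f) \<and> open V}"

text \<open>Borel probability measures on a closed set \<open>S\<close> are represented by those Borel probability
  measures on the whole space that give mass one to \<open>S\<close>; the weak topology is the subspace
  topology.\<close>

definition probs_on :: "'a::topological_space set \<Rightarrow> 'a measure set" where
  "probs_on S = {\<mu> \<in> borel_probs. measure \<mu> S = 1}"

definition bounded_probs :: "'a::metric_space measure set" where
  "bounded_probs = {\<mu>. \<exists>S. closed S \<and> bounded S \<and> \<mu> \<in> probs_on S}"

definition borel_of :: "'a topology \<Rightarrow> 'a measure" where
  "borel_of X = sigma (topspace X) {U. openin X U}"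

section \<open>Probabilistic notions\<close>

definition atomless :: "'w measure \<Rightarrow> bool" where
  "atomless M \<longleftrightarrow>
     (\<forall>A\<in>sets M. emeasure M A > 0 \<longrightarrow>
        (\<exists>B\<in>sets M. B \<subseteq> A \<and> 0 < emeasure M B \<and> emeasure M B < emeasure M A))"

definition Linf_norm :: "'w measure \<Rightarrow> ('w \<Rightarrow> real) \<Rightarrow> real" where
  "Linf_norm M Y = real_of_ereal (esssup M (\<lambda>\<omega>. ereal \<bar>Y \<omega>\<bar>))"

definition cond_prob_in :: "'w measure \<Rightarrow> 'w measure \<Rightarrow> ('w \<Rightarrow> 'b) \<Rightarrow> 'b set \<Rightarrow> 'w \<Rightarrow> real" where
  "cond_prob_in M U Y B = real_cond_exp M U (indicator {\<omega> \<in> space M. Y \<omega> \<in> B})"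

definition is_reg_cond_distr ::
  "'w measure \<Rightarrow> 'w measure \<Rightarrow> ('w \<Rightarrow> real) \<Rightarrow> ('w \<Rightarrow> real measure) \<Rightarrow> bool" where
  "is_reg_cond_distr M U Y \<kappa> \<longleftrightarrow>
     \<kappa> \<in> U \<rightarrow>\<^sub>M prob_algebra borel \<and>
     (\<forall>B\<in>sets borel. AE \<omega> in M. cond_prob_in M U Y B \<omega> = measure (\<kappa> \<omega>) B)"

text \<open>The version is required to be supported in \<open>[-\<parallel>Y\<parallel>, \<parallel>Y\<parallel>]\<close> for every \<open>\<omega>\<close>, not just almost
  every one. Such a version exists for every essentially bounded random variable \<open>Y\<close>; for other
  \<open>Y\<close> the value is meaningless.\<close>

definition reg_cond_distr ::
  "'w measure \<Rightarrow> 'w measure \<Rightarrow> ('w \<Rightarrow> real) \<Rightarrow> 'w \<Rightarrow> real measure" where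
  "reg_cond_distr M U Y =
     (SOME \<kappa>. is_reg_cond_distr M U Y \<kappa> \<and>
        (\<forall>\<omega>\<in>space M. \<kappa> \<omega> \<in> probs_on {- Linf_norm M Y .. Linf_norm M Y}))"

text \<open>\<open>U\<^sub>t = G\<^sub>t\<^sub>-\<^sub>1 \<or> F\<^sub>t\<close>; only used for \<open>t \<ge> 1\<close>.\<close>

definition joint_filt ::
  "'w measure \<Rightarrow> (nat \<Rightarrow> 'w measure) \<Rightarrow> (nat \<Rightarrow> 'w measure) \<Rightarrow> nat \<Rightarrow> 'w measure" where
  "joint_filt M F G t = sigma (space M) (sets (G (t - 1)) \<union> sets (F t))"

section \<open>Law-invariant convex risk measures\<close>

definition convex_risk_measure :: "(real measure \<Rightarrow> ereal) \<Rightarrow> bool" where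
  "convex_risk_measure \<sigma> \<longleftrightarrow>
     (\<forall>\<mu>\<in>bounded_probs. \<sigma> \<mu> \<noteq> -\<infinity>) \<and>
     (\<exists>\<mu>\<in>bounded_probs. \<sigma> \<mu> \<noteq> \<infinity>) \<and>
     (\<forall>\<mu>\<in>bounded_probs. \<forall>c. \<sigma> (\<mu> \<star> return borel c) = \<sigma> \<mu> + ereal c) \<and>
     (\<forall>\<mu>\<in>bounded_probs. \<forall>\<mu>'\<in>bounded_probs.
        (\<forall>r. measure \<mu> {..r} \<ge> measure \<mu>' {..r}) \<longrightarrow> \<sigma> \<mu> \<le> \<sigma> \<mu>') \<and>
     (\<forall>\<zeta>\<in>(bounded_probs :: (real \<times> real) measure set). \<forall>\<theta>\<in>{0..1}.
        \<sigma> (distr \<zeta> borel (\<lambda>(r\<^sub>0, r\<^sub>1). (1 - \<theta>) * r\<^sub>0 + \<theta> * r\<^sub>1))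
          \<le> ereal (1 - \<theta>) * \<sigma> (distr \<zeta> borel fst) + ereal \<theta> * \<sigma> (distr \<zeta> borel snd))"

section \<open>The dynamic risk measure\<close>

text \<open>\<open>dyn_risk M F G \<sigma> \<gamma> T X Z t x\<close> is the random variable \<open>\<varsigma>\<^sup>X\<^sub>t\<^sub>,\<^sub>x\<^sub>,\<^sub>T(Z)\<close>, for \<open>1 \<le> t \<le> T\<close>.
  By translation invariance, monotonicity and \<open>\<bar>\<sigma>\<^sub>t\<^sub>,\<^sub>x(\<delta>\<^sub>0)\<bar> \<le> b\<^sub>t\<close> the values of \<open>\<sigma>\<^sub>t\<^sub>,\<^sub>x\<close> are finite
  on measures of bounded support, so the conversion by \<open>real_of_ereal\<close> loses nothing.\<close>

function dyn_risk ::
  "'w measure \<Rightarrow> (nat \<Rightarrow> 'w measure) \<Rightarrow> (nat \<Rightarrow> 'w measure) \<Rightarrow>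
   (nat \<Rightarrow> 'x \<Rightarrow> real measure \<Rightarrow> ereal) \<Rightarrow> real \<Rightarrow> nat \<Rightarrow>
   (nat \<Rightarrow> 'w \<Rightarrow> 'x) \<Rightarrow> (nat \<Rightarrow> 'w \<Rightarrow> real) \<Rightarrow> nat \<Rightarrow> 'x \<Rightarrow> 'w \<Rightarrow> ereal" where
  "dyn_risk M F G \<sigma> \<gamma> T X Z t =
     (if t < T
      then (\<lambda>x \<omega>. \<sigma> t x (reg_cond_distr M (joint_filt M F G t)
             (\<lambda>\<omega>'. Z t \<omega>' + \<gamma> * real_of_ereal
                (dyn_risk M F G \<sigma> \<gamma> T X Z (t + 1) (X (t + 1) \<omega>') \<omega>')) \<omega>))
      else (\<lambda>x \<omega>. \<sigma> T x (reg_cond_distr M (joint_filt M F G T) (Z T) \<omega>)))"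
  by pat_completeness auto
termination
  by (relation "Wellfounded.measure (\<lambda>(M, F, G, \<sigma>, \<gamma>, T, X, Z, t). T - t)") auto

declare dyn_risk.simps [simp del]

definition dyn_risk0 ::
  "'w measure \<Rightarrow> (nat \<Rightarrow> 'w measure) \<Rightarrow> (nat \<Rightarrow> 'w measure) \<Rightarrow>
   (real measure \<Rightarrow> ereal) \<Rightarrow> (nat \<Rightarrow> 'x \<Rightarrow> real measure \<Rightarrow> ereal) \<Rightarrow> real \<Rightarrow> nat \<Rightarrow>
   (nat \<Rightarrow> 'w \<Rightarrow> 'x) \<Rightarrow> (nat \<Rightarrow> 'w \<Rightarrow> real) \<Rightarrow> ereal" where
  "dyn_risk0 M F G \<sigma>\<^sub>0 \<sigma> \<gamma> T X Z =
     \<sigma>\<^sub>0 (distr M borel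
       (\<lambda>\<omega>. Z 0 \<omega> + \<gamma> * real_of_ereal (dyn_risk M F G \<sigma> \<gamma> T X Z 1 (X 1 \<omega>) \<omega>)))"

section \<open>Policies, controlled processes and costs\<close>

text \<open>Policies are functions on all of \<^typ>\<open>nat\<close> whose value at \<open>0\<close> is irrelevant; likewise for
  state and action processes, constraints, transition kernels and risk measures.\<close>

definition markov_policies ::
  "(nat \<Rightarrow> 'x::topological_space \<Rightarrow> 'a::topological_space set) \<Rightarrow> (nat \<Rightarrow> 'x \<Rightarrow> 'a measure) set" where
  "markov_policies \<A> =
     {\<pi>. \<forall>t\<ge>1. \<pi> t \<in> borel \<rightarrow>\<^sub>M borel_of weak_topology \<and> (\<forall>x. \<pi> t x \<in> probs_on (\<A> t x))}"

definition controlled_process ::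
  "'w measure \<Rightarrow> (nat \<Rightarrow> 'w measure) \<Rightarrow> (nat \<Rightarrow> 'w measure) \<Rightarrow>
   (nat \<Rightarrow> 'x::topological_space \<Rightarrow> 'a::topological_space set) \<Rightarrow>
   (nat \<Rightarrow> 'x \<Rightarrow> 'a \<Rightarrow> 'x measure) \<Rightarrow> 'x measure \<Rightarrow>
   (nat \<Rightarrow> 'w \<Rightarrow> 'x) \<Rightarrow> (nat \<Rightarrow> 'w \<Rightarrow> 'a) \<Rightarrow> bool" where
  "controlled_process M F G \<A> P \<xi> X A \<longleftrightarrow>
     (\<forall>t\<ge>1. X t \<in> F t \<rightarrow>\<^sub>M borel) \<and>
     (\<forall>t\<ge>1. A t \<in> G t \<rightarrow>\<^sub>M borel) \<and>
     distr M borel (X 1) = \<xi> \<and>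
     (\<forall>t\<ge>1. \<forall>B\<in>sets borel. AE \<omega> in M.
        cond_prob_in M (G t) (X (t + 1)) B \<omega> = measure (P t (X t \<omega>) (A t \<omega>)) B) \<and>
     (AE \<omega> in M. \<forall>t\<ge>1. A t \<omega> \<in> \<A> t (X t \<omega>))"

definition follows_policy ::
  "'w measure \<Rightarrow> (nat \<Rightarrow> 'w measure) \<Rightarrow> (nat \<Rightarrow> 'w measure) \<Rightarrow>
   (nat \<Rightarrow> 'x::topological_space \<Rightarrow> 'a::topological_space measure) \<Rightarrow>
   (nat \<Rightarrow> 'w \<Rightarrow> 'x) \<Rightarrow> (nat \<Rightarrow> 'w \<Rightarrow> 'a) \<Rightarrow> bool" where
  "follows_policy M F G \<pi> X A \<longleftrightarrow>
     (\<forall>t\<ge>1. \<forall>B\<in>sets borel. AE \<omega> in M.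
        cond_prob_in M (joint_filt M F G t) (A t) B \<omega>
          = cond_prob_in M (vimage_algebra (space M) (X t) borel) (A t) B \<omega> \<and>
        cond_prob_in M (vimage_algebra (space M) (X t) borel) (A t) B \<omega>
          = measure (\<pi> t (X t \<omega>)) B)"

definition cost_process ::
  "(nat \<Rightarrow> 'x \<times> 'a \<times> 'x \<Rightarrow> real) \<Rightarrow> (nat \<Rightarrow> 'w \<Rightarrow> 'x) \<Rightarrow> (nat \<Rightarrow> 'w \<Rightarrow> 'a) \<Rightarrow> nat \<Rightarrow> 'w \<Rightarrow> real" where
  "cost_process C X A t \<omega> = (if t = 0 then 0 else C t (X t \<omega>, A t \<omega>, X (t + 1) \<omega>))"

section \<open>Semicontinuity\<close>

definition lower_semicontinuous :: "('b::topological_space \<Rightarrow> real) \<Rightarrow> bool" where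
  "lower_semicontinuous f \<longleftrightarrow> (\<forall>z. \<forall>r<f z. \<forall>\<^sub>F w in nhds z. r < f w)"

definition upper_hemicontinuous ::
  "('b::topological_space \<Rightarrow> 'c::topological_space set) \<Rightarrow> bool" where
  "upper_hemicontinuous \<Phi> \<longleftrightarrow>
     (\<forall>x V. open V \<and> \<Phi> x \<subseteq> V \<longrightarrow> (\<exists>W. open W \<and> x \<in> W \<and> (\<forall>z\<in>W. \<Phi> z \<subseteq> V)))"

section \<open>Standing assumptions\<close>

text \<open>\<open>\<Psi>\<close> need not contain all controlled processes. \<open>(X\<^sub>p \<pi>, A\<^sub>p \<pi>)\<close> is the pair in \<open>\<Psi>\<close> attached to
  the Markovian policy \<open>\<pi>\<close>.\<close>

locale risk_averse_mdp =
  prob_space M + complete_measure M + F: filtration "space M" F + G: filtration "space M" G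
  for M :: "'w measure" and F G :: "nat \<Rightarrow> 'w measure" +
  fixes \<sigma>\<^sub>0 :: "real measure \<Rightarrow> ereal"
    and \<sigma> :: "nat \<Rightarrow> 'x::polish_space \<Rightarrow> real measure \<Rightarrow> ereal"
    and \<A> :: "nat \<Rightarrow> 'x \<Rightarrow> 'a::polish_space set"
    and P :: "nat \<Rightarrow> 'x \<Rightarrow> 'a \<Rightarrow> 'x measure"
    and \<xi> :: "'x measure"
    and \<Psi> :: "((nat \<Rightarrow> 'w \<Rightarrow> 'x) \<times> (nat \<Rightarrow> 'w \<Rightarrow> 'a)) set"
    and X\<^sub>p :: "(nat \<Rightarrow> 'x \<Rightarrow> 'a measure) \<Rightarrow> nat \<Rightarrow> 'w \<Rightarrow> 'x"
    and A\<^sub>p :: "(nat \<Rightarrow> 'x \<Rightarrow> 'a measure) \<Rightarrow> nat \<Rightarrow> 'w \<Rightarrow> 'a"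
    and C :: "nat \<Rightarrow> 'x \<times> 'a \<times> 'x \<Rightarrow> real"
  assumes atomless: "atomless M"
    and F_sub_G: "\<And>t. sets (F t) \<subseteq> sets (G t)"
    and G_sub_M: "\<And>t. sets (G t) \<subseteq> sets M"
    and null_sets_F: "null_sets M \<subseteq> sets (F 1)"
    and F_0: "sets (F 0) = {{}, space M}"
    and G_0: "sets (G 0) = {{}, space M}"
    and risk_0: "convex_risk_measure \<sigma>\<^sub>0"
    and risk: "\<And>t x. t \<ge> 1 \<Longrightarrow> convex_risk_measure (\<sigma> t x)"
    and risk_measurable: "\<And>t K. t \<ge> 1 \<Longrightarrow> compact K \<Longrightarrow>
          (\<lambda>(x, \<mu>). \<sigma> t x \<mu>)
            \<in> borel_of (prod_topology euclidean (subtopology weak_topology (probs_on K))) \<rightarrow>\<^sub>M borel"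
    and risk_bounded: "\<And>t. t \<ge> 1 \<Longrightarrow>
          \<exists>\<beta>\<ge>0. \<forall>x. \<bar>\<sigma> t x (return borel 0)\<bar> \<le> ereal \<beta>"
    and actions_nonempty: "\<And>t x. t \<ge> 1 \<Longrightarrow> \<A> t x \<noteq> {}"
    and actions_closed: "\<And>t x. t \<ge> 1 \<Longrightarrow> closed (\<A> t x)"
    and actions_measurable: "\<And>t V. t \<ge> 1 \<Longrightarrow> open V \<Longrightarrow> {x. \<A> t x \<inter> V \<noteq> {}} \<in> sets borel"
    and kernel_prob: "\<And>t x a. t \<ge> 1 \<Longrightarrow> P t x a \<in> borel_probs"
    and kernel_measurable: "\<And>t B. t \<ge> 1 \<Longrightarrow> B \<in> sets borel \<Longrightarrow>
          (\<lambda>(x, a). measure (P t x a) B) \<in> borel_measurable borel"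
    and initial_prob: "\<xi> \<in> borel_probs"
    and \<Psi>_controlled: "\<And>X A. (X, A) \<in> \<Psi> \<Longrightarrow> controlled_process M F G \<A> P \<xi> X A"
    and policy_pair: "\<And>\<pi>. \<pi> \<in> markov_policies \<A> \<Longrightarrow>
          (X\<^sub>p \<pi>, A\<^sub>p \<pi>) \<in> \<Psi> \<and> follows_policy M F G \<pi> (X\<^sub>p \<pi>) (A\<^sub>p \<pi>)"
    and cost_measurable: "\<And>t. t \<ge> 1 \<Longrightarrow> C t \<in> borel_measurable borel"

end

theory Submission
  imports Defs
begin

text \<open>
  The proof is dynamic programming: a backward recursion produces value functions
  \<open>v\<^sub>t\<close> of the state alone and a Markovian policy that attains them, while every controlled
  process, history-dependent or not, almost surely has cost-to-go at least \<open>v\<^sub>t\<close> of its current state.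

  Put \<open>v = 0\<close> after the horizon. At time \<open>t\<close>, in state \<open>x\<close>, a law \<open>\<mu>\<close> of actions produces the law
  of \<open>C\<^sub>t(x, a, y) + \<gamma> v\<^sub>t\<^sub>+\<^sub>1(y)\<close>, where \<open>a\<close> follows \<open>\<mu>\<close> and \<open>y\<close> follows \<open>P(t, x, a, \<cdot>)\<close>, and
  \<open>v\<^sub>t(x)\<close> is the least risk \<open>\<sigma>\<^sub>t\<^sub>,\<^sub>x\<close> of such a law over the admissible \<open>\<mu>\<close> (\<open>bellman_step\<close>).

  Conditionally on \<open>U\<^sub>t\<close>, the action of an arbitrary controlled process has some admissible law and the
  next state follows the transition kernel (\<open>conditional_action_law\<close>, \<open>cond_kernel_cost_law\<close>).
  A larger random variable has stochastically larger conditional laws (\<open>cond_kernel_cdf_mono\<close>), and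
  risk measures are monotone. Hence a lower bound \<open>v\<^sub>t\<^sub>+\<^sub>1\<close> for the cost-to-go at time \<open>t + 1\<close> yields the
  lower bound \<open>v\<^sub>t\<close> at time \<open>t\<close>; for the policy that uses the minimisers, the same argument gives
  an upper bound (\<open>risk_comparison\<close>, \<open>value_exists\<close>). At time \<open>1\<close> the states of all processes have the law
  \<open>\<xi>\<close>, so monotonicity of \<open>\<sigma>\<^sub>0\<close> concludes (\<open>markov_policies_suffice\<close>).

  The analytic content is that the minimum exists, is lower semicontinuous in \<open>x\<close>, and has a Borel
  minimiser. Joint lower semicontinuity of the objective comes from increasing Lipschitz
  approximations of the cost; these have uniformly continuous compositions with test functions, so
  weak continuity of the kernel is enough. Compactness comes from the compact action space: the
  probability measures on it form a weakly continuous image of a compact set of real numbers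
  (\<open>probs_on_compact_coding\<close>), which reduces the weak compactness to Helly's selection theorem on the
  line. In this parametrisation the smallest minimising real number is a Borel function of the state
  (\<open>measurable_minimizer\<close>). On the probabilistic side, regular conditional distributions with bounded
  support for every \<open>\<omega>\<close> are constructed from conditional distribution functions
  (\<open>real_cond_kernel_exists\<close>).
\<close>

section \<open>Compact metric spaces as continuous images of compact sets of reals\<close>

text \<open>With digits \<open>0\<close> and \<open>1\<close> in base \<open>3\<close>, the first digit in which two expansions differ
  contributes at least twice as much as all later digits together.\<close>

lemma ternary_sum_separates:
  fixes b c :: "nat \<Rightarrow> real"
  assumes b: "\<And>n. b n \<in> {0, 1}" and c: "\<And>n. c n \<in> {0, 1}"
    and close: "\<bar>(\<Sum>n. b n / 3 ^ n) - (\<Sum>n. c n / 3 ^ n)\<bar> < 1 / (2 * 3 ^ N)"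
    and "k \<le> N"
  shows "b k = c k"
proof (rule ccontr)
  assume "b k \<noteq> c k"
  define j where "j = (LEAST j. b j \<noteq> c j)"
  have j: "b j \<noteq> c j" using \<open>b k \<noteq> c k\<close> unfolding j_def by (rule LeastI)
  have jk: "j \<le> k" using \<open>b k \<noteq> c k\<close> unfolding j_def by (rule Least_le)
  have eq: "b i = c i" if "i < j" for i using not_less_Least that unfolding j_def by blast
  have geo: "summable (\<lambda>n. 1 / (3::real) ^ n)"
    using summable_geometric[of "1/3::real"] by (simp add: power_divide)
  have sd: "summable (\<lambda>n. d n / (3::real) ^ n)" if "\<And>n. \<bar>d n\<bar> \<le> 1" for d
    by (rule summable_comparison_test'[OF geo, of 0]) (use that in \<open>simp add: divide_right_mono\<close>)
  have b1: "\<bar>b n\<bar> \<le> 1" and c1: "\<bar>c n\<bar> \<le> 1" for n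
    using b[of n] c[of n] by auto
  define d where "d n = b n - c n" for n
  have d1: "\<bar>d n\<bar> \<le> 1" for n using b[of n] c[of n] unfolding d_def by auto
  have "(\<Sum>n. b n / 3 ^ n) - (\<Sum>n. c n / 3 ^ n) = (\<Sum>n. d n / 3 ^ n)"
    unfolding d_def by (subst suminf_diff[OF sd[OF b1] sd[OF c1]]) (simp add: diff_divide_distrib)
  also have "\<dots> = (\<Sum>n. d (n + Suc j) / 3 ^ (n + Suc j)) + (\<Sum>n<Suc j. d n / 3 ^ n)"
    by (rule suminf_split_initial_segment[OF sd[OF d1]])
  also have "(\<Sum>n<Suc j. d n / 3 ^ n) = d j / 3 ^ j"
    using eq by (simp add: d_def)
  finally have *: "(\<Sum>n. b n / 3 ^ n) - (\<Sum>n. c n / 3 ^ n)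
      = (\<Sum>n. d (n + Suc j) / 3 ^ (n + Suc j)) + d j / 3 ^ j" .
  have geo': "(\<lambda>n. (1 / 3 ^ Suc j) * (1/3::real) ^ n) sums ((1 / 3 ^ Suc j) * (1 / (1 - 1/3)))"
    by (intro sums_mult geometric_sums) simp
  have tail: "\<bar>\<Sum>n. d (n + Suc j) / 3 ^ (n + Suc j)\<bar> \<le> 1 / (2 * 3 ^ j)"
  proof -
    have bd: "norm (d (n + Suc j) / 3 ^ (n + Suc j)) \<le> (1 / 3 ^ Suc j) * (1/3) ^ n" for n
      using d1[of "n + Suc j"] by (simp add: power_divide power_add field_simps)
    have "\<bar>\<Sum>n. d (n + Suc j) / 3 ^ (n + Suc j)\<bar> \<le> (\<Sum>n. (1 / 3 ^ Suc j) * (1/3) ^ n)"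
      using norm_suminf_le[OF bd sums_summable[OF geo']] by simp
    also have "\<dots> = 1 / (2 * 3 ^ j)" using sums_unique[OF geo'] by simp
    finally show ?thesis .
  qed
  have "\<bar>d j\<bar> = 1" using j b[of j] c[of j] unfolding d_def by auto
  then have "\<bar>d j / 3 ^ j\<bar> = 1 / 3 ^ j" by simp
  then have "\<bar>(\<Sum>n. b n / 3 ^ n) - (\<Sum>n. c n / 3 ^ n)\<bar> \<ge> 1 / 3 ^ j - 1 / (2 * 3 ^ j)"
    using tail unfolding * by linarith
  also have "1 / 3 ^ j - 1 / (2 * 3 ^ j) = 1 / (2 * (3::real) ^ j)" by (simp add: field_simps)
  finally have "1 / (2 * (3::real) ^ j) < 1 / (2 * 3 ^ N)" using close by linarith
  moreover have "(3::real) ^ j \<le> 3 ^ N" using jk \<open>k \<le> N\<close> by (intro power_increasing) auto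
  ultimately show False by (simp add: field_simps)
qed

text \<open>The code \<open>s x\<close> lists in its ternary digits which sets of a countable base contain \<open>x\<close>.
  By compactness finitely many digits determine \<open>x\<close> up to a given error, so the decoding is
  uniformly continuous on \<open>s ` K\<close> and extends to the closure \<open>C\<close>. Thus \<open>C\<close> is a substitute for the
  Cantor set, and the coding \<open>s\<close> comes out Borel because the base sets are open. The result serves
  twice: it reduces measures on the action space to measures on the real line, and it turns a choice
  among measures into the choice of a smallest real number.\<close>

proposition compact_real_coding:
  fixes K :: "'a::polish_space set"
  assumes K: "compact K" "K \<noteq> {}"
  obtains C :: "real set" and q :: "real \<Rightarrow> 'a" and s :: "'a \<Rightarrow> real"
  where "compact C" "C \<noteq> {}" "continuous_on C q" "q \<in> borel_measurable borel" "range q = K"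
    "s \<in> borel_measurable borel" "\<And>x. x \<in> K \<Longrightarrow> s x \<in> C" "\<And>x. x \<in> K \<Longrightarrow> q (s x) = x"
    "\<And>x. \<bar>s x\<bar> \<le> 2"
proof -
  obtain \<B> :: "'a set set" where \<B>: "countable \<B>" "topological_basis \<B>"
    using ex_countable_basis by blast
  have ne: "\<B> \<noteq> {}" using topological_basis_open topological_basisE[OF \<B>(2), of UNIV]
    by (metis UNIV_I empty_iff open_UNIV)
  define U where "U = from_nat_into \<B>"
  have rU: "range U = \<B>" unfolding U_def using range_from_nat_into[OF ne \<B>(1)] .
  have oU: "open (U n)" for n using topological_basis_open[OF \<B>(2)] rU by blast
  define b where "b n x = (indicator (U n) x :: real)" for n x
  define s where "s x = (\<Sum>n. b n x / 3 ^ n)" for x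
  have b01: "b n x \<in> {0, 1}" for n x unfolding b_def by (auto simp: indicator_def)
  have [measurable]: "b n \<in> borel_measurable borel" for n
    unfolding b_def using oU[of n] by (intro borel_measurable_indicator) auto
  have s: "s \<in> borel_measurable borel" unfolding s_def by measurable
  have geo: "(\<lambda>n. 1 / (3::real) ^ n) sums (3/2)"
    using geometric_sums[of "1/3::real"] by (simp add: power_divide)
  have bd: "norm (b n x / 3 ^ n) \<le> 1 / 3 ^ n" for n x
    using b01[of n x] by (auto simp: divide_right_mono)
  have s2: "\<bar>s x\<bar> \<le> 2" for x
    using norm_suminf_le[of "\<lambda>n. b n x / 3 ^ n", OF bd sums_summable[OF geo]] sums_unique[OF geo]
    unfolding s_def by simp
  \<comment> \<open>a finite subcover by base sets of diameter below \<open>e\<close> bounds the number of digits needed\<close>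
  have digits: "\<exists>N. \<forall>x\<in>K. \<forall>y. (\<forall>k\<le>N. b k x = b k y) \<longrightarrow> dist x y < e" if "e > 0" for e
  proof -
    define I where "I = {n. \<forall>x\<in>U n. \<forall>y\<in>U n. dist x y < e}"
    have "K \<subseteq> (\<Union>n\<in>I. U n)"
    proof
      fix x assume "x \<in> K"
      obtain B where B: "B \<in> \<B>" "x \<in> B" "B \<subseteq> ball x (e/2)"
        using topological_basisE[OF \<B>(2), of "ball x (e/2)" x] \<open>e > 0\<close>
        by (metis centre_in_ball half_gt_zero open_ball)
      obtain n where n: "B = U n" using rU B(1) by auto
      have "dist y z < e" if "y \<in> U n" "z \<in> U n" for y z
        using that B(3) n dist_triangle_half_r[of x y e z] by (auto simp: subset_iff)
      then show "x \<in> (\<Union>n\<in>I. U n)" using B(2) n unfolding I_def by blast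
    qed
    then obtain I' where I': "I' \<subseteq> I" "finite I'" "K \<subseteq> (\<Union>n\<in>I'. U n)"
      using compactE_image[OF K(1), of I U] oU by metis
    show ?thesis
    proof (intro exI[of _ "Max I'"] ballI allI impI)
      fix x y assume "x \<in> K" and eq: "\<forall>k\<le>Max I'. b k x = b k y"
      then obtain n where n: "n \<in> I'" "x \<in> U n" using I'(3) by auto
      then have "b n x = b n y" using eq I'(2) by simp
      then have "y \<in> U n" using n(2) unfolding b_def by (auto simp: indicator_def split: if_splits)
      then show "dist x y < e" using n I'(1) unfolding I_def by blast
    qed
  qed
  have sep: "\<exists>d>0. \<forall>x\<in>K. \<forall>y\<in>K. \<bar>s x - s y\<bar> < d \<longrightarrow> dist x y < e" if "e > 0" for e
  proof -
    obtain N where N: "\<And>x y. x \<in> K \<Longrightarrow> (\<forall>k\<le>N. b k x = b k y) \<Longrightarrow> dist x y < e"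
      using digits[OF \<open>e > 0\<close>] by blast
    show ?thesis
    proof (intro exI[of _ "1 / (2 * 3 ^ N)"] conjI ballI impI)
      fix x y assume "x \<in> K" "y \<in> K" "\<bar>s x - s y\<bar> < 1 / (2 * 3 ^ N)"
      then show "dist x y < e"
        using ternary_sum_separates[of "\<lambda>n. b n x" "\<lambda>n. b n y" N] b01 N unfolding s_def by blast
    qed simp
  qed
  have inj: "inj_on s K"
  proof (rule inj_onI, rule ccontr)
    fix x y assume "x \<in> K" "y \<in> K" "s x = s y" "x \<noteq> y"
    moreover obtain d where "d > 0" "\<forall>x'\<in>K. \<forall>y'\<in>K. \<bar>s x' - s y'\<bar> < d \<longrightarrow> dist x' y' < dist x y"
      using sep[of "dist x y"] \<open>x \<noteq> y\<close> by auto
    ultimately have "dist x y < dist x y" by (metis abs_zero diff_self)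
    then show False by simp
  qed
  define r where "r = the_inv_into K s"
  have r: "r (s x) = x" if "x \<in> K" for x using the_inv_into_f_f[OF inj that] unfolding r_def .
  have "uniformly_continuous_on (s ` K) r"
    unfolding uniformly_continuous_on_def
  proof (intro allI impI)
    fix e :: real assume "0 < e"
    then obtain d where d: "d > 0" "\<forall>x\<in>K. \<forall>y\<in>K. \<bar>s x - s y\<bar> < d \<longrightarrow> dist x y < e"
      using sep by blast
    then show "\<exists>d>0. \<forall>x\<in>s ` K. \<forall>x'\<in>s ` K. dist x' x < d \<longrightarrow> dist (r x') (r x) < e"
      by (intro exI[of _ d]) (auto simp: r dist_real_def)
  qed
  then obtain q where q: "uniformly_continuous_on (closure (s ` K)) q"
      "\<And>x. x \<in> s ` K \<Longrightarrow> r x = q x"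
    by (rule uniformly_continuous_on_extension_on_closure) blast
  define C where "C = closure (s ` K)"
  have C: "compact C" "C \<noteq> {}"
    using s2 K(2) by (auto simp: C_def compact_closure bounded_iff intro!: exI[of _ 2])
  have sC: "s x \<in> C" if "x \<in> K" for x using that closure_subset[of "s ` K"] by (auto simp: C_def)
  have cq: "continuous_on C q" unfolding C_def using q(1) by (rule uniformly_continuous_imp_continuous)
  have qs: "q (s x) = x" if "x \<in> K" for x using q(2)[of "s x"] r[OF that] that by simp
  have "q ` C \<subseteq> closure (q ` s ` K)"
    unfolding C_def by (rule continuous_image_closure_subset[OF cq[unfolded C_def] order_refl])
  moreover have "q ` s ` K = K" using qs by force
  ultimately have qC: "q c \<in> K" if "c \<in> C" for c using that compact_imp_closed[OF K(1)] by auto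
  obtain k where k: "k \<in> K" using K(2) by blast
  \<comment> \<open>any value in \<open>K\<close> off \<open>C\<close> keeps the decoding total and Borel\<close>
  define q' where "q' c = (if c \<in> C then q c else k)" for c
  show ?thesis
  proof (rule that[of C q' s])
    show "continuous_on C q'" using cq by (rule continuous_on_eq) (simp add: q'_def)
    show "q' \<in> borel_measurable borel"
      unfolding q'_def using compact_imp_closed[OF C(1)] cq
      by (intro borel_measurable_continuous_on_if) auto
    show "range q' = K"
    proof
      show "range q' \<subseteq> K" using qC k unfolding q'_def by auto
      show "K \<subseteq> range q'"
      proof
        fix x assume "x \<in> K"
        then have "q' (s x) = x" using sC qs by (simp add: q'_def)
        then show "x \<in> range q'" by (metis rangeI)
      qed
    qed
    show "q' (s x) = x" if "x \<in> K" for x using sC[OF that] qs[OF that] by (simp add: q'_def)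
  qed (use C s s2 sC in auto)
qed

section \<open>Weak convergence of Borel probability measures\<close>

definition weakly_tendsto :: "(nat \<Rightarrow> 'a::topological_space measure) \<Rightarrow> 'a measure \<Rightarrow> bool" where
  "weakly_tendsto \<mu>s \<mu> \<longleftrightarrow>
     (\<forall>f :: 'a \<Rightarrow> real. continuous_on UNIV f \<longrightarrow> bounded (range f) \<longrightarrow>
        (\<lambda>n. \<integral>x. f x \<partial>\<mu>s n) \<longlonglongrightarrow> (\<integral>x. f x \<partial>\<mu>))"

lemma borel_probsD:
  assumes "\<mu> \<in> borel_probs"
  shows "prob_space \<mu>" "sets \<mu> = sets borel" "space \<mu> = UNIV" "\<mu> \<in> space (prob_algebra borel)"
  using assms sets_eq_imp_space_eq[of \<mu> borel]
  by (auto simp: borel_probs_def space_prob_algebra)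

lemma borel_probs_eq_space: "borel_probs = space (prob_algebra borel)"
  by (auto simp: borel_probs_def space_prob_algebra)

lemma borel_probs_measurable:
  assumes "\<mu> \<in> borel_probs"
  shows "measurable \<mu> N = measurable borel N"
  using borel_probsD(2)[OF assms] by (intro measurable_cong_sets) auto

lemma probs_on_borel_probs: "\<mu> \<in> probs_on S \<Longrightarrow> \<mu> \<in> borel_probs"
  by (simp add: probs_on_def)

lemma probs_on_AE:
  assumes "S \<in> sets borel"
  shows "\<mu> \<in> probs_on S \<longleftrightarrow> \<mu> \<in> borel_probs \<and> (AE x in \<mu>. x \<in> S)"
proof (cases "\<mu> \<in> borel_probs")
  case True
  interpret prob_space \<mu> using borel_probsD[OF True] by simp
  have "S \<in> sets \<mu>" using borel_probsD(2)[OF True] assms by simp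
  then show ?thesis using prob_eq_1[of S] True by (simp add: probs_on_def)
qed (simp add: probs_on_def)

lemma probs_on_mono:
  assumes "\<mu> \<in> probs_on S" "S \<subseteq> T" "S \<in> sets borel" "T \<in> sets borel"
  shows "\<mu> \<in> probs_on T"
  using assms by (auto simp: probs_on_AE elim: eventually_mono)

lemma return_probs_on:
  assumes "x \<in> S" "S \<in> sets borel"
  shows "return borel x \<in> probs_on S"
  using assms by (simp add: probs_on_def borel_probs_def prob_space_return measure_return)

lemma distr_probs_on:
  assumes "\<mu> \<in> borel_probs" "f \<in> borel \<rightarrow>\<^sub>M borel" "AE x in \<mu>. f x \<in> S" "S \<in> sets borel"
  shows "distr \<mu> borel f \<in> probs_on S"
proof -
  interpret prob_space \<mu> using borel_probsD[OF assms(1)] by simp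
  have f: "f \<in> \<mu> \<rightarrow>\<^sub>M borel" using assms(2) borel_probs_measurable[OF assms(1)] by blast
  show ?thesis
    using assms(3,4) prob_space_distr[OF f] f
    by (simp add: probs_on_AE borel_probs_def AE_distr_iff)
qed

lemma bounded_borel_integrable:
  fixes f :: "'a::topological_space \<Rightarrow> real"
  assumes "\<mu> \<in> borel_probs" "f \<in> borel_measurable borel" "bounded (range f)"
  shows "integrable \<mu> f"
proof -
  interpret prob_space \<mu> using borel_probsD[OF assms(1)] by simp
  obtain B where "\<And>x. \<bar>f x\<bar> \<le> B" using assms(3) by (auto simp: bounded_iff)
  then show ?thesis
    using assms(2) borel_probs_measurable[OF assms(1)]
    by (intro integrable_const_bound[of _ B]) auto
qed

lemma tendsto_if_subsubsequences:
  fixes a :: "nat \<Rightarrow> real"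
  assumes "\<And>r :: nat \<Rightarrow> nat. strict_mono r \<Longrightarrow> \<exists>u :: nat \<Rightarrow> nat. strict_mono u \<and> (\<lambda>n. a (r (u n))) \<longlonglongrightarrow> l"
  shows "a \<longlonglongrightarrow> l"
proof (rule ccontr)
  assume "\<not> a \<longlonglongrightarrow> l"
  then obtain e where e: "e > 0" "\<not> (\<forall>\<^sub>F n in sequentially. dist (a n) l < e)"
    unfolding tendsto_iff by blast
  define S where "S = {n. \<not> dist (a n) l < e}"
  have "\<exists>n\<ge>N. n \<in> S" for N using e(2) unfolding eventually_sequentially S_def by blast
  then have inf: "infinite S" unfolding infinite_nat_iff_unbounded_le by blast
  obtain u where u: "strict_mono u" "(\<lambda>n. a (enumerate S (u n))) \<longlonglongrightarrow> l"
    using assms[OF strict_mono_enumerate[OF inf]] by blast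
  then have "\<forall>\<^sub>F n in sequentially. dist (a (enumerate S (u n))) l < e"
    using e(1) tendstoD by blast
  then obtain n where "dist (a (enumerate S (u n))) l < e"
    unfolding eventually_sequentially by blast
  moreover have "enumerate S (u n) \<in> S" using enumerate_in_set[OF inf] .
  ultimately show False unfolding S_def by blast
qed

lemma real_distribution_borel_probs: "real_distribution \<mu> \<longleftrightarrow> \<mu> \<in> borel_probs"
  by (auto simp: borel_probs_def real_distribution_def real_distribution_axioms_def)

text \<open>Monotonicity and right continuity of distribution functions; an almost sure statement about
  all levels \<open>x\<close> thereby reduces to countably many.\<close>

lemma cdf_le_if_le_on_rationals:
  fixes \<mu> \<nu> :: "real measure"
  assumes "\<mu> \<in> borel_probs" "\<nu> \<in> borel_probs"
    and le: "\<And>r::rat. measure \<mu> {..of_rat r} \<le> measure \<nu> {..of_rat r}"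
  shows "measure \<mu> {..x} \<le> measure \<nu> {..x}"
proof -
  interpret \<mu>: real_distribution \<mu> using assms(1) real_distribution_borel_probs by blast
  interpret \<nu>: real_distribution \<nu> using assms(2) real_distribution_borel_probs by blast
  have "cdf \<mu> x \<le> cdf \<nu> x"
  proof (rule tendsto_lowerbound)
    show "(cdf \<nu> \<longlongrightarrow> cdf \<nu> x) (at_right x)"
      using \<nu>.cdf_is_right_cont[of x] by (simp add: continuous_within)
    show "\<forall>\<^sub>F y in at_right x. cdf \<mu> x \<le> cdf \<nu> y"
      unfolding eventually_at_right_field
    proof (intro exI[of _ "x + 1"] conjI allI impI)
      fix y assume "x < y" "y < x + 1"
      then obtain r where r: "x < of_rat r" "of_rat r < y" using of_rat_dense by blast
      have "cdf \<mu> x \<le> cdf \<mu> (of_rat r)" using r by (intro \<mu>.cdf_nondecreasing) simp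
      also have "\<dots> \<le> cdf \<nu> (of_rat r)" using le by (simp add: cdf_def)
      also have "\<dots> \<le> cdf \<nu> y" using r by (intro \<nu>.cdf_nondecreasing) simp
      finally show "cdf \<mu> x \<le> cdf \<nu> y" .
    qed simp
  qed simp
  then show ?thesis by (simp add: cdf_def)
qed

section \<open>Weak compactness on a compact set of reals\<close>

text \<open>Continuous functions equal to \<open>1\<close> up to the rational \<open>fst k\<close> that decrease to the
  indicator of \<open>{..fst k}\<close> as \<open>snd k\<close> grows. There are countably many of them, so the vector
  of their integrals is a point of a metrizable space.\<close>

definition ramp :: "rat \<times> nat \<Rightarrow> real \<Rightarrow> real" where
  "ramp k x = max 0 (min 1 (1 - real (snd k) * (x - of_rat (fst k))))"

definition ramp_integrals :: "real measure \<Rightarrow> rat \<times> nat \<Rightarrow> real" where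
  "ramp_integrals \<mu> k = (\<integral>x. ramp k x \<partial>\<mu>)"

lemma ramp_continuous: "continuous_on UNIV (ramp k)"
  unfolding ramp_def by (intro continuous_intros)

lemma ramp_bounded: "bounded (range (ramp k))"
  unfolding bounded_iff ramp_def by (intro exI[of _ 1]) auto

lemma ramp_measurable [measurable]: "ramp k \<in> borel_measurable borel"
  using ramp_continuous by (rule borel_measurable_continuous_onI)

lemma ramp_integrals_tendsto:
  assumes "\<mu> \<in> borel_probs"
  shows "(\<lambda>n. ramp_integrals \<mu> (r, n)) \<longlonglongrightarrow> measure \<mu> {..of_rat r}"
proof -
  interpret real_distribution \<mu> using assms real_distribution_borel_probs by blast
  have "(\<lambda>n. ramp (r, n) x) \<longlonglongrightarrow> indicator {..of_rat r} x" for x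
  proof (cases "x \<le> of_rat r")
    case True
    then have "real n * (x - of_rat r) \<le> 0" for n by (simp add: mult_nonneg_nonpos)
    then have "ramp (r, n) x = 1" for n unfolding ramp_def by (simp add: max_def min_def)
    then show ?thesis using True by simp
  next
    case False
    then obtain N where N: "1 < real N * (x - of_rat r)"
      using reals_Archimedean3[of "x - of_rat r"] by force
    have "ramp (r, n) x = 0" if "n \<ge> N" for n
    proof -
      have "real N * (x - of_rat r) \<le> real n * (x - of_rat r)"
        using that False by (intro mult_right_mono) auto
      then show ?thesis using N unfolding ramp_def by simp
    qed
    then show ?thesis using False by (intro tendsto_eventually eventually_sequentiallyI[of N]) simp
  qed
  then have "(\<lambda>n. \<integral>x. ramp (r, n) x \<partial>\<mu>) \<longlonglongrightarrow> (\<integral>x. indicator {..of_rat r} x \<partial>\<mu>)"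
    by (intro integral_dominated_convergence[where w="\<lambda>_. 1"]) (auto simp: ramp_def)
  then show ?thesis unfolding ramp_integrals_def by simp
qed

lemma ramp_integrals_inject:
  assumes "\<mu> \<in> borel_probs" "\<nu> \<in> borel_probs" "ramp_integrals \<mu> = ramp_integrals \<nu>"
  shows "\<mu> = \<nu>"
proof (rule cdf_unique)
  have eq: "measure \<mu> {..of_rat r} = measure \<nu> {..of_rat r}" for r
    using LIMSEQ_unique[OF ramp_integrals_tendsto[OF assms(1)]]
      ramp_integrals_tendsto[OF assms(2)] assms(3) by metis
  show "cdf \<mu> = cdf \<nu>"
    unfolding cdf_def fun_eq_iff
    using cdf_le_if_le_on_rationals[OF assms(1,2)] cdf_le_if_le_on_rationals[OF assms(2,1)] eq
    by (metis order_antisym order_refl)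
qed (use assms real_distribution_borel_probs in auto)

text \<open>Test the limit against \<open>min 1 (infdist x K)\<close>. The supports of \<open>\<mu>s n\<close> only need to
  approach \<open>K\<close>, which is what upper hemicontinuity of the action sets provides.\<close>

lemma weakly_tendsto_closed_support:
  fixes K :: "'a::metric_space set"
  assumes lim: "weakly_tendsto \<mu>s \<mu>" and \<mu>n: "\<And>n. \<mu>s n \<in> borel_probs" and \<mu>: "\<mu> \<in> borel_probs"
    and K: "closed K" "K \<noteq> {}"
    and near: "\<And>e. e > 0 \<Longrightarrow> \<forall>\<^sub>F n in sequentially. AE x in \<mu>s n. infdist x K \<le> e"
  shows "\<mu> \<in> probs_on K"
proof -
  interpret prob_space \<mu> using borel_probsD[OF \<mu>] by simp
  define f where "f x = min 1 (infdist x K)" for x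
  have cf: "continuous_on UNIV f" unfolding f_def by (intro continuous_intros)
  have bf: "bounded (range f)"
    unfolding f_def bounded_iff by (intro exI[of _ 1]) (auto simp: infdist_nonneg)
  have [measurable]: "f \<in> borel_measurable borel" using cf by (rule borel_measurable_continuous_onI)
  have "(\<integral>x. f x \<partial>\<mu>) \<le> e" if "e > 0" for e
  proof (rule tendsto_upperbound)
    show "(\<lambda>n. \<integral>x. f x \<partial>\<mu>s n) \<longlonglongrightarrow> (\<integral>x. f x \<partial>\<mu>)"
      using lim cf bf unfolding weakly_tendsto_def by blast
    show "\<forall>\<^sub>F n in sequentially. (\<integral>x. f x \<partial>\<mu>s n) \<le> e"
      using near[OF that]
    proof eventually_elim
      case (elim n)
      interpret n: prob_space "\<mu>s n" using borel_probsD[OF \<mu>n] by simp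
      have "(\<integral>x. f x \<partial>\<mu>s n) \<le> (\<integral>x. e \<partial>\<mu>s n)"
      proof (rule integral_mono_AE)
        show "integrable (\<mu>s n) f"
          by (rule bounded_borel_integrable[OF \<mu>n \<open>f \<in> borel_measurable borel\<close> bf])
        show "AE x in \<mu>s n. f x \<le> e" using elim by eventually_elim (simp add: f_def)
      qed simp
      then show ?case by (simp add: n.prob_space)
    qed
  qed simp
  then have "(\<integral>x. f x \<partial>\<mu>) \<le> 0" by (auto intro: field_le_epsilon)
  moreover have nn: "0 \<le> f x" for x unfolding f_def by (simp add: infdist_nonneg)
  ultimately have "(\<integral>x. f x \<partial>\<mu>) = 0" by (simp add: antisym)
  then have "AE x in \<mu>. f x = 0"
    using integral_nonneg_eq_0_iff_AE[OF bounded_borel_integrable[OF \<mu> _ bf]] nn by simp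
  then have "AE x in \<mu>. x \<in> K"
    by eventually_elim (use K in_closed_iff_infdist_zero in \<open>auto simp: f_def min_def split: if_splits\<close>)
  then show ?thesis using \<mu> K by (simp add: probs_on_AE)
qed

text \<open>Helly's theorem in the form of tightness; the limit does not charge the complement of the
  closed set \<open>C\<close>.\<close>

lemma real_probs_on_compact_subsequence:
  fixes C :: "real set"
  assumes C: "compact C" "C \<noteq> {}" and \<mu>n: "\<And>n. \<mu>s n \<in> probs_on C"
  obtains r :: "nat \<Rightarrow> nat" and \<mu>
  where "strict_mono r" "\<mu> \<in> probs_on C" "weakly_tendsto (\<lambda>n. \<mu>s (r n)) \<mu>"
proof -
  have \<mu>n': "\<mu>s n \<in> borel_probs" for n using probs_on_borel_probs[OF \<mu>n] .
  have clC: "closed C" using C(1) by (rule compact_imp_closed)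
  obtain m where m: "m > 0" "\<And>x. x \<in> C \<Longrightarrow> \<bar>x\<bar> \<le> m"
    using compact_imp_bounded[OF C(1)] unfolding bounded_pos by auto
  have "measure (\<mu>s n) {-m-1<..m} = 1" for n
  proof -
    interpret n: prob_space "\<mu>s n" using borel_probsD[OF \<mu>n'] by simp
    have "AE x in \<mu>s n. x \<in> {-m-1<..m}"
      using \<mu>n[of n] clC unfolding probs_on_AE[OF borel_closed[OF clC]]
      by (auto elim!: eventually_mono dest: m(2))
    then show ?thesis using n.prob_eq_1 borel_probsD(2)[OF \<mu>n'] by simp
  qed
  then have "tight \<mu>s"
    unfolding tight_def
  proof (intro conjI allI impI)
    fix e :: real assume "e > 0"
    then show "\<exists>a b. a < b \<and> (\<forall>n. measure (\<mu>s n) {a<..b} > 1 - e)"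
      using m(1) \<open>\<And>n. measure (\<mu>s n) {-m-1<..m} = 1\<close>
      by (intro exI[of _ "-m-1"] exI[of _ m]) simp
  qed (use \<mu>n' real_distribution_borel_probs in blast)
  then obtain r M where r: "strict_mono r" "real_distribution M" "weak_conv_m (\<mu>s \<circ> id \<circ> r) M"
    using tight_imp_convergent_subsubsequence[of \<mu>s id] strict_mono_id by (auto simp: id_def)
  have wt: "weakly_tendsto (\<lambda>n. \<mu>s (r n)) M"
    unfolding weakly_tendsto_def
  proof (intro allI impI)
    fix f :: "real \<Rightarrow> real" assume f: "continuous_on UNIV f" "bounded (range f)"
    obtain B where B: "\<And>x. norm (f x) \<le> B" using f(2) by (auto simp: bounded_iff)
    show "(\<lambda>n. \<integral>x. f x \<partial>\<mu>s (r n)) \<longlonglongrightarrow> (\<integral>x. f x \<partial>M)"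
      using weak_conv_imp_integral_bdd_continuous_conv[OF _ r(2,3), of f B] B f(1)
      by (auto simp: real_distribution_borel_probs \<mu>n' continuous_on_eq_continuous_at)
  qed
  have M: "M \<in> borel_probs" using r(2) real_distribution_borel_probs by blast
  have "M \<in> probs_on C"
  proof (rule weakly_tendsto_closed_support[OF wt \<mu>n' M clC C(2)])
    fix e :: real assume "e > 0"
    show "\<forall>\<^sub>F n in sequentially. AE x in \<mu>s (r n). infdist x C \<le> e"
    proof (rule always_eventually, rule allI)
      fix n
      have "AE x in \<mu>s (r n). x \<in> C" using \<mu>n probs_on_AE[OF borel_closed[OF clC]] by blast
      then show "AE x in \<mu>s (r n). infdist x C \<le> e" by eventually_elim (use \<open>e > 0\<close> in simp)
    qed
  qed
  then show ?thesis using that r(1) wt by blast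
qed

lemma tendsto_fun_iff:
  fixes f :: "nat \<Rightarrow> 'i \<Rightarrow> 'b::topological_space" and l :: "'i \<Rightarrow> 'b"
  shows "f \<longlonglongrightarrow> l \<longleftrightarrow> (\<forall>i. (\<lambda>n. f n i) \<longlonglongrightarrow> l i)"
  using limitin_componentwise[of "\<lambda>_. euclidean :: 'b topology" UNIV f l sequentially]
  by (simp add: euclidean_product_topology)

lemma ramp_integrals_continuous:
  assumes "weakly_tendsto \<mu>s \<mu>"
  shows "(\<lambda>n. ramp_integrals (\<mu>s n)) \<longlonglongrightarrow> ramp_integrals \<mu>"
  using assms ramp_continuous ramp_bounded
  unfolding tendsto_fun_iff ramp_integrals_def weakly_tendsto_def by blast

text \<open>Together with the next facts this makes \<open>ramp_integrals\<close> a homeomorphism from the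
  probability measures on \<open>C\<close> onto a compact subset of a product of real lines.\<close>

lemma ramp_integrals_compact:
  assumes C: "compact C" "C \<noteq> {}"
  shows "compact (ramp_integrals ` probs_on C)"
  unfolding compact_eq_seq_compact_metric seq_compact_def
proof (intro allI impI)
  fix z :: "nat \<Rightarrow> rat \<times> nat \<Rightarrow> real" assume "\<forall>n. z n \<in> ramp_integrals ` probs_on C"
  then obtain \<mu>s where \<mu>n: "\<And>n. \<mu>s n \<in> probs_on C" "\<And>n. z n = ramp_integrals (\<mu>s n)"
    unfolding image_iff by metis
  obtain r \<mu> where r: "strict_mono r" "\<mu> \<in> probs_on C" "weakly_tendsto (\<lambda>n. \<mu>s (r n)) \<mu>"
    by (rule real_probs_on_compact_subsequence[OF C \<mu>n(1)])
  show "\<exists>l\<in>ramp_integrals ` probs_on C. \<exists>r. strict_mono r \<and> (z \<circ> r) \<longlonglongrightarrow> l"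
    using r(1,2) ramp_integrals_continuous[OF r(3)] \<mu>n(2)
    by (intro bexI[of _ "ramp_integrals \<mu>"] exI[of _ r]) (simp_all add: comp_def)
qed

definition from_ramps :: "real set \<Rightarrow> (rat \<times> nat \<Rightarrow> real) \<Rightarrow> real measure" where
  "from_ramps C = the_inv_into (probs_on C) ramp_integrals"

lemma from_ramps_ramp_integrals:
  assumes "\<mu> \<in> probs_on C"
  shows "from_ramps C (ramp_integrals \<mu>) = \<mu>"
proof -
  have "inj_on ramp_integrals (probs_on C)"
    using ramp_integrals_inject probs_on_borel_probs by (blast intro: inj_onI)
  then show ?thesis unfolding from_ramps_def by (rule the_inv_into_f_f[OF _ assms])
qed

lemma from_ramps:
  assumes "z \<in> ramp_integrals ` probs_on C"
  shows "from_ramps C z \<in> probs_on C" "ramp_integrals (from_ramps C z) = z"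
  using assms from_ramps_ramp_integrals by auto

text \<open>The inverse of a continuous bijection on a compact space is continuous: every subsequence of
  the measures has a weakly convergent subsequence, and the integrals of the ramps identify its
  limit.\<close>

lemma from_ramps_continuous:
  assumes C: "compact C" "C \<noteq> {}"
    and E: "\<And>n. zs n \<in> ramp_integrals ` probs_on C" "z \<in> ramp_integrals ` probs_on C"
    and lim: "zs \<longlonglongrightarrow> z"
  shows "weakly_tendsto (\<lambda>n. from_ramps C (zs n)) (from_ramps C z)"
  unfolding weakly_tendsto_def
proof (intro allI impI)
  fix f :: "real \<Rightarrow> real" assume f: "continuous_on UNIV f" "bounded (range f)"
  show "(\<lambda>n. \<integral>x. f x \<partial>from_ramps C (zs n)) \<longlonglongrightarrow> (\<integral>x. f x \<partial>from_ramps C z)"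
  proof (rule tendsto_if_subsubsequences)
    fix r :: "nat \<Rightarrow> nat" assume r: "strict_mono r"
    obtain u \<nu> where u: "strict_mono u" "\<nu> \<in> probs_on C" "weakly_tendsto (\<lambda>n. from_ramps C (zs (r (u n)))) \<nu>"
      by (rule real_probs_on_compact_subsequence[OF C, of "\<lambda>n. from_ramps C (zs (r n))", OF from_ramps(1)[OF E(1)]])
    have "(\<lambda>n. zs (r (u n))) \<longlonglongrightarrow> z"
      using LIMSEQ_subseq_LIMSEQ[OF lim strict_mono_o[OF r u(1)]] by (simp add: comp_def)
    then have "ramp_integrals \<nu> = z"
      using LIMSEQ_unique[OF ramp_integrals_continuous[OF u(3)]] by (simp add: from_ramps(2)[OF E(1)])
    then have "\<nu> = from_ramps C z" using from_ramps_ramp_integrals[OF u(2)] by simp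
    then show "\<exists>u. strict_mono u \<and> (\<lambda>n. \<integral>x. f x \<partial>from_ramps C (zs (r (u n)))) \<longlonglongrightarrow> (\<integral>x. f x \<partial>from_ramps C z)"
      using u f unfolding weakly_tendsto_def by blast
  qed
qed

section \<open>The weak topology and its Borel sets\<close>

lemma topspace_weak_topology: "topspace weak_topology = borel_probs"
proof -
  have "(borel_probs :: 'a measure set) = {\<mu> \<in> borel_probs. (\<integral>x. 0 \<partial>\<mu>) \<in> (UNIV :: real set)}" by simp
  moreover have "continuous_on UNIV (\<lambda>x::'a. 0::real)" "bounded (range (\<lambda>x::'a. 0::real))" by auto
  ultimately have "(borel_probs :: 'a measure set)
    \<in> {{\<mu> \<in> borel_probs. (\<integral>x. f x \<partial>\<mu>) \<in> V} | (f :: 'a \<Rightarrow> real) V.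
        continuous_on UNIV f \<and> bounded (range f) \<and> open V}" by blast
  then show ?thesis unfolding weak_topology_def topology_generated_by_topspace by auto
qed

lemma limitin_weak_topology:
  assumes lim: "weakly_tendsto \<mu>s \<mu>" and \<mu>n: "\<And>n. \<mu>s n \<in> borel_probs" and \<mu>: "\<mu> \<in> borel_probs"
  shows "limitin weak_topology \<mu>s \<mu> sequentially"
  unfolding limitin_def
proof (intro conjI allI impI)
  fix U assume "openin weak_topology U \<and> \<mu> \<in> U"
  then show "\<forall>\<^sub>F n in sequentially. \<mu>s n \<in> U"
    unfolding weak_topology_def openin_topology_generated_by_iff
  proof (elim conjE)
    assume "generate_topology_on {{\<mu> \<in> borel_probs. (\<integral>x. f x \<partial>\<mu>) \<in> V} | (f :: 'a \<Rightarrow> real) V.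
        continuous_on UNIV f \<and> bounded (range f) \<and> open V} U" and "\<mu> \<in> U"
    then show ?thesis
    proof (induction rule: generate_topology_on.induct)
      case (Int a b) then show ?case by (auto simp: eventually_conj_iff)
    next
      case (UN K)
      then obtain k where k: "k \<in> K" "\<mu> \<in> k" by blast
      from UN.IH[OF k] show ?case by (rule eventually_mono) (use k in blast)
    next
      case (Basis s)
      then obtain f V where s: "s = {\<mu> \<in> borel_probs. (\<integral>x. f x \<partial>\<mu>) \<in> V}"
        and f: "continuous_on UNIV (f :: 'a \<Rightarrow> real)" "bounded (range f)" "open V" by blast
      have "(\<lambda>n. \<integral>x. f x \<partial>\<mu>s n) \<longlonglongrightarrow> (\<integral>x. f x \<partial>\<mu>)"
        using lim f unfolding weakly_tendsto_def by blast
      then show ?case using topological_tendstoD[OF _ f(3)] Basis.prems \<mu>n unfolding s by auto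
    qed simp
  qed
qed (simp add: topspace_weak_topology \<mu>)

lemma continuous_map_weak_topology:
  fixes \<Lambda> :: "'z::metric_space \<Rightarrow> 'a::topological_space measure"
  assumes \<Lambda>: "\<And>z. z \<in> S \<Longrightarrow> \<Lambda> z \<in> borel_probs"
    and cont: "\<And>zs z. (\<And>n. zs n \<in> S) \<Longrightarrow> z \<in> S \<Longrightarrow> zs \<longlonglongrightarrow> z \<Longrightarrow> weakly_tendsto (\<lambda>n. \<Lambda> (zs n)) (\<Lambda> z)"
  shows "continuous_map (top_of_set S) weak_topology \<Lambda>"
  unfolding weak_topology_def
proof (rule continuous_on_generated_topo)
  fix W assume "W \<in> {{\<mu> \<in> borel_probs. (\<integral>x. f x \<partial>\<mu>) \<in> V} | (f :: 'a \<Rightarrow> real) V.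
        continuous_on UNIV f \<and> bounded (range f) \<and> open V}"
  then obtain f V where W: "W = {\<mu> \<in> borel_probs. (\<integral>x. f x \<partial>\<mu>) \<in> V}"
    and f: "continuous_on UNIV (f :: 'a \<Rightarrow> real)" "bounded (range f)" "open V" by blast
  have "continuous_on S (\<lambda>z. \<integral>x. f x \<partial>\<Lambda> z)"
    unfolding continuous_on_sequentially
    using cont f unfolding weakly_tendsto_def comp_def by blast
  from continuous_openin_preimage_gen[OF this f(3)]
  show "openin (top_of_set S) (\<Lambda> -` W \<inter> topspace (top_of_set S))"
    using \<Lambda> by (auto simp: W Int_def vimage_def intro: back_subst[where P="openin _"])
next
  show "\<Lambda> ` topspace (top_of_set S) \<subseteq> \<Union> {{\<mu> \<in> borel_probs. (\<integral>x. f x \<partial>\<mu>) \<in> V} | (f :: 'a \<Rightarrow> real) V.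
        continuous_on UNIV f \<and> bounded (range f) \<and> open V}"
    unfolding topspace_weak_topology[unfolded weak_topology_def topology_generated_by_topspace]
    using \<Lambda> by auto
qed

lemma measurable_borel_of:
  assumes "f \<in> space M \<rightarrow> topspace X"
    and "\<And>U. openin X U \<Longrightarrow> f -` U \<inter> space M \<in> sets M"
  shows "f \<in> M \<rightarrow>\<^sub>M borel_of X"
  unfolding borel_of_def
  using assms by (intro measurable_measure_of) (auto dest: openin_subset)

lemma continuous_map_borel_preimage:
  assumes "continuous_map (top_of_set S) X f" "S \<in> sets borel" "openin X U"
  shows "{x \<in> S. f x \<in> U} \<in> sets borel"
proof -
  have "openin (top_of_set S) {x \<in> S. f x \<in> U}"
    using openin_continuous_map_preimage[OF assms(1,3)] by simp
  then obtain W where "open W" "{x \<in> S. f x \<in> U} = S \<inter> W" unfolding openin_open by blast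
  then show ?thesis using assms(2) by simp
qed

text \<open>The joint measurability of the risk measures refers to the Borel sets of a product topology.
  Passing to the coordinates \<open>ramp_integrals (\<kappa> \<omega>)\<close> replaces the space of measures by a compact subset
  of a second countable metric space, where Borel sets of a product are generated by rectangles, so
  measurability of the two components suffices.\<close>

lemma measurable_compose_weak_borel:
  fixes X :: "'w \<Rightarrow> 'x::{second_countable_topology, metric_space}"
  assumes C: "compact (C :: real set)" "C \<noteq> {}"
    and f: "f \<in> borel_of (prod_topology euclidean (subtopology weak_topology (probs_on C))) \<rightarrow>\<^sub>M N"
    and X: "X \<in> U \<rightarrow>\<^sub>M borel" and \<kappa>: "\<kappa> \<in> U \<rightarrow>\<^sub>M prob_algebra borel"
    and \<kappa>C: "\<And>\<omega>. \<omega> \<in> space U \<Longrightarrow> \<kappa> \<omega> \<in> probs_on C"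
  shows "(\<lambda>\<omega>. f (X \<omega>, \<kappa> \<omega>)) \<in> U \<rightarrow>\<^sub>M N"
proof -
  define E where "E = ramp_integrals ` probs_on C"
  have cE: "compact E" unfolding E_def by (rule ramp_integrals_compact[OF C])
  define D where "D = from_ramps C"
  have DE: "D z \<in> probs_on C" if "z \<in> E" for z using from_ramps(1) that unfolding D_def E_def .
  have "continuous_map (top_of_set E) weak_topology D"
    unfolding D_def
  proof (rule continuous_map_weak_topology)
    show "from_ramps C z \<in> borel_probs" if "z \<in> E" for z using DE[OF that] probs_on_borel_probs unfolding D_def by blast
  qed (unfold E_def, rule from_ramps_continuous[OF C])
  then have cD: "continuous_map (top_of_set E) (subtopology weak_topology (probs_on C)) D"
    using DE by (auto simp: continuous_map_in_subtopology)
  have cXD: "continuous_map (top_of_set (UNIV \<times> E :: ('x \<times> _) set))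
      (prod_topology euclidean (subtopology weak_topology (probs_on C))) (\<lambda>p. (fst p, D (snd p)))"
  proof (rule continuous_map_pairedI)
    show "continuous_map (top_of_set (UNIV \<times> E :: ('x \<times> _) set)) euclidean fst"
      by (simp add: continuous_on_fst)
    have "continuous_map (top_of_set (UNIV \<times> E :: ('x \<times> _) set)) (top_of_set E) snd"
      by (auto simp: continuous_map_in_subtopology continuous_on_snd)
    from continuous_map_compose[OF this cD]
    show "continuous_map (top_of_set (UNIV \<times> E :: ('x \<times> _) set))
        (subtopology weak_topology (probs_on C)) (\<lambda>p. D (snd p))" by (simp add: comp_def)
  qed
  have "closed (UNIV \<times> E :: ('x \<times> _) set)"
    by (rule closed_Times[OF closed_UNIV compact_imp_closed[OF cE]])
  then have bE: "(UNIV \<times> E :: ('x \<times> _) set) \<in> sets borel" by (rule borel_closed)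
  have "(\<lambda>\<omega>. ramp_integrals (\<kappa> \<omega>)) \<in> U \<rightarrow>\<^sub>M borel"
    unfolding ramp_integrals_def
    using measurable_prob_algebraD[OF \<kappa>]
    by (intro measurable_coordinatewise_then_product
      measurable_compose[OF _ integral_measurable_subprob_algebra]) auto
  with X have Xz: "(\<lambda>\<omega>. (X \<omega>, ramp_integrals (\<kappa> \<omega>))) \<in> U \<rightarrow>\<^sub>M borel" by measurable
  have "(\<lambda>\<omega>. (X \<omega>, \<kappa> \<omega>)) \<in> U \<rightarrow>\<^sub>M
      borel_of (prod_topology euclidean (subtopology weak_topology (probs_on C)))"
  proof (rule measurable_borel_of)
    show "(\<lambda>\<omega>. (X \<omega>, \<kappa> \<omega>)) \<in> space U \<rightarrow> topspace (prod_topology euclidean (subtopology weak_topology (probs_on C)))"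
      using \<kappa>C probs_on_borel_probs by (auto simp: topspace_weak_topology)
    fix O' :: "('x \<times> real measure) set"
    assume O': "openin (prod_topology euclidean (subtopology weak_topology (probs_on C))) O'"
    have "ramp_integrals (\<kappa> \<omega>) \<in> E" "D (ramp_integrals (\<kappa> \<omega>)) = \<kappa> \<omega>" if "\<omega> \<in> space U" for \<omega>
      using \<kappa>C[OF that] from_ramps_ramp_integrals unfolding E_def D_def by auto
    then have "(\<lambda>\<omega>. (X \<omega>, \<kappa> \<omega>)) -` O' \<inter> space U
        = (\<lambda>\<omega>. (X \<omega>, ramp_integrals (\<kappa> \<omega>))) -` {p \<in> UNIV \<times> E. (fst p, D (snd p)) \<in> O'} \<inter> space U"
      by auto
    then show "(\<lambda>\<omega>. (X \<omega>, \<kappa> \<omega>)) -` O' \<inter> space U \<in> sets U"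
      using measurable_sets[OF Xz continuous_map_borel_preimage[OF cXD bE O']] by simp
  qed
  then show ?thesis using f by (rule measurable_compose)
qed

section \<open>Probability measures on a compact metric space\<close>

text \<open>Every probability measure on \<open>K\<close> is the image under the decoding \<open>q\<close> of a probability
  measure on a compact set \<open>C\<close> of reals, namely of its own image under \<open>s\<close>. The latter measures
  correspond to a compact set of vectors, and \<open>compact_real_coding\<close> applied to these vectors gives
  the parametrisation by real numbers, which contains Prokhorov's theorem for compact metric
  spaces.\<close>

proposition probs_on_compact_coding:
  fixes K :: "'a::polish_space set"
  assumes K: "compact K" "K \<noteq> {}"
  obtains C :: "real set" and \<Lambda> :: "real \<Rightarrow> 'a measure"
  where "compact C" "\<Lambda> ` C = probs_on K"
    "\<And>cs c. (\<And>n. cs n \<in> C) \<Longrightarrow> c \<in> C \<Longrightarrow> cs \<longlonglongrightarrow> c \<Longrightarrow> weakly_tendsto (\<lambda>n. \<Lambda> (cs n)) (\<Lambda> c)"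
proof -
  obtain C :: "real set" and q :: "real \<Rightarrow> 'a" and s :: "'a \<Rightarrow> real"
    where C: "compact C" "C \<noteq> {}" and q: "continuous_on C q" "q \<in> borel_measurable borel" "range q = K"
    and s: "s \<in> borel_measurable borel" "\<And>x. x \<in> K \<Longrightarrow> s x \<in> C" "\<And>x. x \<in> K \<Longrightarrow> q (s x) = x"
    by (rule compact_real_coding[OF K]) blast
  have clC: "C \<in> sets borel" using compact_imp_closed[OF C(1)] by auto
  have clK: "K \<in> sets borel" using compact_imp_closed[OF K(1)] by auto
  define E where "E = ramp_integrals ` probs_on C"
  obtain c0 where c0: "c0 \<in> C" using C(2) by blast
  have "E \<noteq> {}" using return_probs_on[OF c0 clC] unfolding E_def by blast
  moreover have "compact E" unfolding E_def by (rule ramp_integrals_compact[OF C])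
  ultimately obtain C2 :: "real set" and q2 :: "real \<Rightarrow> rat \<times> nat \<Rightarrow> real" and s2
    where C2: "compact C2" "continuous_on C2 q2" "range q2 = E"
    and s2: "\<And>z. z \<in> E \<Longrightarrow> s2 z \<in> C2" "\<And>z. z \<in> E \<Longrightarrow> q2 (s2 z) = z"
    using compact_real_coding[of E] by metis
  have q2E: "q2 c \<in> ramp_integrals ` probs_on C" for c using C2(3) unfolding E_def by blast
  define \<Lambda> where "\<Lambda> c = distr (from_ramps C (q2 c)) borel q" for c
  have "\<Lambda> ` C2 = probs_on K"
  proof
    show "\<Lambda> ` C2 \<subseteq> probs_on K"
      unfolding \<Lambda>_def using q(2,3) clK probs_on_borel_probs[OF from_ramps(1)[OF q2E]]
      by (auto intro!: distr_probs_on)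
    show "probs_on K \<subseteq> \<Lambda> ` C2"
    proof
      fix \<nu> assume \<nu>: "\<nu> \<in> probs_on K"
      then have AE: "AE x in \<nu>. x \<in> K" and \<nu>b: "\<nu> \<in> borel_probs" using probs_on_AE[OF clK] by auto
      note [simp] = borel_probs_measurable[OF \<nu>b]
      define \<mu> where "\<mu> = distr \<nu> borel s"
      have \<mu>: "\<mu> \<in> probs_on C"
        unfolding \<mu>_def using AE s(2) by (intro distr_probs_on \<nu>b s(1) clC) (auto elim: eventually_mono)
      have "distr \<mu> borel q = distr \<nu> borel (q \<circ> s)"
        unfolding \<mu>_def using q(2) s(1) by (subst distr_distr) auto
      also have "\<dots> = distr \<nu> borel (\<lambda>x. x)"
        using AE q(2) s(1,3) measurable_ident_sets[OF borel_probsD(2)[OF \<nu>b]]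
        by (intro distr_cong_AE refl) (auto elim!: eventually_mono)
      also have "\<dots> = \<nu>" using borel_probsD(2)[OF \<nu>b] by (simp add: distr_id2)
      finally have *: "distr \<mu> borel q = \<nu>" .
      have "ramp_integrals \<mu> \<in> E" using \<mu> unfolding E_def by blast
      then have "\<nu> = \<Lambda> (s2 (ramp_integrals \<mu>))" "s2 (ramp_integrals \<mu>) \<in> C2"
        unfolding \<Lambda>_def using s2 from_ramps_ramp_integrals[OF \<mu>] * by simp_all
      then show "\<nu> \<in> \<Lambda> ` C2" by blast
    qed
  qed
  moreover have "weakly_tendsto (\<lambda>n. \<Lambda> (cs n)) (\<Lambda> c)"
    if c: "\<And>n. cs n \<in> C2" "c \<in> C2" "cs \<longlonglongrightarrow> c" for cs c
    unfolding weakly_tendsto_def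
  proof (intro allI impI)
    fix f :: "'a \<Rightarrow> real" assume f: "continuous_on UNIV f" "bounded (range f)"
    have "(\<lambda>n. q2 (cs n)) \<longlonglongrightarrow> q2 c"
      using C2(2) c unfolding continuous_on_sequentially comp_def by blast
    then have wt: "weakly_tendsto (\<lambda>n. from_ramps C (q2 (cs n))) (from_ramps C (q2 c))"
      by (rule from_ramps_continuous[OF C q2E q2E])
    obtain B where B: "\<And>x. \<bar>f x\<bar> \<le> B" using f(2) by (auto simp: bounded_iff)
    have "continuous_on C (f \<circ> q)" using q(1) f(1) by (intro continuous_on_compose) (auto intro: continuous_on_subset)
    then obtain h where h: "continuous_on UNIV h" "\<And>x. x \<in> C \<Longrightarrow> h x = (f \<circ> q) x" "\<And>x. norm (h x) \<le> B"
      using Tietze[of C "f \<circ> q" UNIV B] compact_imp_closed[OF C(1)] B abs_ge_zero[THEN order_trans, OF B]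
      by auto
    have [measurable]: "f \<in> borel_measurable borel" "h \<in> borel_measurable borel" "q \<in> borel_measurable borel"
      using f h q(2) by (auto intro: borel_measurable_continuous_onI)
    have fq: "(\<lambda>x. f (q x)) \<in> borel_measurable borel" by measurable
    have eq: "(\<integral>x. f x \<partial>\<Lambda> c) = (\<integral>x. h x \<partial>from_ramps C (q2 c))" for c
    proof -
      define \<mu> where "\<mu> = from_ramps C (q2 c)"
      have \<mu>: "\<mu> \<in> borel_probs" "AE x in \<mu>. x \<in> C"
        using from_ramps(1)[OF q2E] probs_on_AE[OF clC] unfolding \<mu>_def by auto
      note [simp] = borel_probs_measurable[OF \<mu>(1)]
      have "(\<integral>x. f x \<partial>distr \<mu> borel q) = (\<integral>x. f (q x) \<partial>\<mu>)"
        using q(2) by (intro integral_distr) auto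
      also have "\<dots> = (\<integral>x. h x \<partial>\<mu>)"
      proof (rule integral_cong_AE)
        show "AE x in \<mu>. f (q x) = h x" using \<mu>(2) by eventually_elim (simp add: h(2))
      qed (use fq in simp_all)
      finally show ?thesis unfolding \<Lambda>_def \<mu>_def .
    qed
    have "bounded (range h)" using h(3) by (auto simp: bounded_iff)
    then have "(\<lambda>n. \<integral>x. h x \<partial>from_ramps C (q2 (cs n))) \<longlonglongrightarrow> (\<integral>x. h x \<partial>from_ramps C (q2 c))"
      using wt h(1) unfolding weakly_tendsto_def by blast
    then show "(\<lambda>n. \<integral>x. f x \<partial>\<Lambda> (cs n)) \<longlonglongrightarrow> (\<integral>x. f x \<partial>\<Lambda> c)" unfolding eq .
  qed
  ultimately show ?thesis using that C2(1) by blast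
qed

text \<open>The mass of an open set is the increasing limit of integrals of continuous functions, and
  open sets generate the Borel sets.\<close>

lemma weakly_continuous_code_measurable:
  fixes \<Lambda> :: "real \<Rightarrow> 'a::metric_space measure"
  assumes s: "s \<in> U \<rightarrow>\<^sub>M borel" "\<And>\<omega>. \<omega> \<in> space U \<Longrightarrow> s \<omega> \<in> C" and C: "closed C"
    and \<Lambda>: "\<And>c. c \<in> C \<Longrightarrow> \<Lambda> c \<in> borel_probs"
    and cont: "\<And>cs c. (\<And>n. cs n \<in> C) \<Longrightarrow> c \<in> C \<Longrightarrow> cs \<longlonglongrightarrow> c \<Longrightarrow> weakly_tendsto (\<lambda>n. \<Lambda> (cs n)) (\<Lambda> c)"
  shows "(\<lambda>\<omega>. \<Lambda> (s \<omega>)) \<in> U \<rightarrow>\<^sub>M prob_algebra borel"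
proof (rule measurable_prob_algebra_generated[where G="{S. open S}" and \<Omega>=UNIV])
  show "sets borel = sigma_sets UNIV {S::'a set. open S}" by (simp add: borel_def)
  show "Int_stable {S::'a set. open S}" by (auto simp: Int_stable_def)
  fix S :: "'a set" assume "S \<in> {S. open S}"
  then have S: "open S" by simp
  show "(\<lambda>\<omega>. emeasure (\<Lambda> (s \<omega>)) S) \<in> borel_measurable U"
  proof (cases "S = UNIV")
    case True
    have "emeasure (\<Lambda> (s \<omega>)) S = 1" if "\<omega> \<in> space U" for \<omega>
      using borel_probsD[OF \<Lambda>[OF s(2)[OF that]]] True prob_space.emeasure_space_1 by metis
    then show ?thesis using measurable_cong[of U "\<lambda>\<omega>. emeasure (\<Lambda> (s \<omega>)) S" "\<lambda>_. 1"] by simp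
  next
    case False
    \<comment> \<open>these increase to the indicator of \<open>S\<close>; \<open>infdist\<close> to an empty set would be \<open>0\<close>\<close>
    define f where "f k x = min 1 (real k * infdist x (- S))" for k :: nat and x
    have fc: "continuous_on UNIV (f k)" for k unfolding f_def by (intro continuous_intros)
    have f01: "0 \<le> f k x" "f k x \<le> 1" for k x unfolding f_def by (auto simp: infdist_nonneg)
    have fb: "bounded (range (f k))" for k
      unfolding bounded_iff using f01 by (intro exI[of _ 1]) auto
    have fm [measurable]: "f k \<in> borel_measurable borel" for k using borel_measurable_continuous_onI[OF fc] .
    have flim: "(\<lambda>k. f k x) \<longlonglongrightarrow> indicator S x" for x
    proof (cases "x \<in> S")
      case True
      have "infdist x (- S) > 0"
        using in_closed_iff_infdist_zero[of "- S" x] S False True infdist_nonneg[of x "- S"] by (auto simp: less_le)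
      then obtain N where N: "1 < real N * infdist x (- S)" using reals_Archimedean3 by blast
      have "f k x = 1" if "k \<ge> N" for k
      proof -
        have "real N * infdist x (- S) \<le> real k * infdist x (- S)" using that by (intro mult_right_mono) (auto simp: infdist_nonneg)
        then show ?thesis using N unfolding f_def by simp
      qed
      then show ?thesis using True by (intro tendsto_eventually eventually_sequentiallyI[of N]) simp
    next
      case False then show ?thesis unfolding f_def by simp
    qed
    define I where "I k c = (if c \<in> C then (\<integral>x. f k x \<partial>\<Lambda> c) else 0)" for k c
    have "continuous_on C (\<lambda>c. \<integral>x. f k x \<partial>\<Lambda> c)" for k
      unfolding continuous_on_sequentially
    proof (intro allI ballI impI)
      fix cs c assume "c \<in> C" and *: "(\<forall>n. cs n \<in> C) \<and> cs \<longlonglongrightarrow> c"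
      then have "weakly_tendsto (\<lambda>n. \<Lambda> (cs n)) (\<Lambda> c)" by (intro cont) auto
      then show "((\<lambda>c. \<integral>x. f k x \<partial>\<Lambda> c) \<circ> cs) \<longlonglongrightarrow> (\<integral>x. f k x \<partial>\<Lambda> c)"
        using fc fb unfolding weakly_tendsto_def comp_def by blast
    qed
    then have I: "I k \<in> borel_measurable borel" for k
      unfolding I_def using C by (intro borel_measurable_continuous_on_if) auto
    have "(\<lambda>\<omega>. measure (\<Lambda> (s \<omega>)) S) \<in> borel_measurable U"
    proof (rule borel_measurable_LIMSEQ_real)
      fix \<omega> assume \<omega>: "\<omega> \<in> space U"
      have b: "\<Lambda> (s \<omega>) \<in> borel_probs" using \<Lambda>[OF s(2)[OF \<omega>]] .
      interpret prob_space "\<Lambda> (s \<omega>)" using borel_probsD[OF b] by simp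
      note [simp] = borel_probs_measurable[OF b] borel_probsD(2,3)[OF b]
      have "(\<lambda>k. \<integral>x. f k x \<partial>\<Lambda> (s \<omega>)) \<longlonglongrightarrow> (\<integral>x. indicator S x \<partial>\<Lambda> (s \<omega>))"
        using f01 flim S by (intro integral_dominated_convergence[where w="\<lambda>_. 1"]) auto
      then show "(\<lambda>k. I k (s \<omega>)) \<longlonglongrightarrow> measure (\<Lambda> (s \<omega>)) S"
        using s(2)[OF \<omega>] S unfolding I_def by simp
    qed (use measurable_compose[OF s(1) I] in simp)
    then have "(\<lambda>\<omega>. ennreal (measure (\<Lambda> (s \<omega>)) S)) \<in> borel_measurable U" by measurable
    moreover have "emeasure (\<Lambda> (s \<omega>)) S = ennreal (measure (\<Lambda> (s \<omega>)) S)" if "\<omega> \<in> space U" for \<omega>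
      using borel_probsD(1)[OF \<Lambda>[OF s(2)[OF that]]]
      by (metis finite_measure.emeasure_eq_measure prob_space.finite_measure)
    ultimately show ?thesis using measurable_cong[of U "\<lambda>\<omega>. emeasure (\<Lambda> (s \<omega>)) S"] by simp
  qed
qed (use borel_probsD[OF \<Lambda>[OF s(2)]] in auto)

section \<open>Lower semicontinuity and measurable minimisers\<close>

lemma lower_semicontinuousI_sequentially:
  fixes f :: "'b::metric_space \<Rightarrow> real"
  assumes "\<And>r zs z. zs \<longlonglongrightarrow> z \<Longrightarrow> (\<And>n. f (zs n) \<le> r) \<Longrightarrow> f z \<le> r"
  shows "lower_semicontinuous f"
  unfolding lower_semicontinuous_def
proof (intro allI impI)
  fix z r assume "r < f z"
  have "closed {z. f z \<le> r}"
    unfolding closed_sequential_limits using assms by blast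
  then have "open (- {z. f z \<le> r})" by (rule open_Compl)
  then have "\<forall>\<^sub>F w in nhds z. w \<in> - {z. f z \<le> r}"
    using \<open>r < f z\<close> by (intro eventually_nhds_in_open) auto
  then show "\<forall>\<^sub>F w in nhds z. r < f w" by (rule eventually_mono) auto
qed

lemma lower_semicontinuous_borel:
  fixes f :: "'b::topological_space \<Rightarrow> real"
  assumes "lower_semicontinuous f"
  shows "f \<in> borel_measurable borel"
proof (rule borel_measurableI_greater)
  fix r
  have "open {z. r < f z}"
  proof (subst open_subopen, intro ballI)
    fix z assume "z \<in> {z. r < f z}"
    then have "\<forall>\<^sub>F w in nhds z. r < f w" using assms unfolding lower_semicontinuous_def by blast
    then show "\<exists>T. open T \<and> z \<in> T \<and> T \<subseteq> {z. r < f z}" unfolding eventually_nhds by blast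
  qed
  then show "{x \<in> space borel. r < f x} \<in> sets borel" by simp
qed

lemma lower_semicontinuous_compose:
  fixes f :: "'b::topological_space \<Rightarrow> real" and g :: "'c::topological_space \<Rightarrow> 'b"
  assumes "lower_semicontinuous f" "continuous_on UNIV g"
  shows "lower_semicontinuous (\<lambda>x. f (g x))"
  unfolding lower_semicontinuous_def
proof (intro allI impI)
  fix z r assume "r < f (g z)"
  then have ev: "\<forall>\<^sub>F w in nhds (g z). r < f w" using assms(1) unfolding lower_semicontinuous_def by blast
  have "filterlim g (nhds (g z)) (nhds z)"
    using assms(2) by (simp add: continuous_on_def tendsto_at_iff_tendsto_nhds)
  then show "\<forall>\<^sub>F w in nhds z. r < f (g w)" using eventually_compose_filterlim[OF ev] by blast
qed

lemma lower_semicontinuous_add_cmult: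
  fixes f g :: "'b::topological_space \<Rightarrow> real"
  assumes f: "lower_semicontinuous f" and g: "lower_semicontinuous g" and "0 \<le> \<gamma>"
  shows "lower_semicontinuous (\<lambda>x. f x + \<gamma> * g x)"
  unfolding lower_semicontinuous_def
proof (intro allI impI)
  fix z r assume r: "r < f z + \<gamma> * g z"
  define d where "d = (f z + \<gamma> * g z - r) / 2"
  have d: "d > 0" using r unfolding d_def by simp
  \<comment> \<open>dividing by \<open>\<gamma> + 1\<close> covers \<open>\<gamma> = 0\<close> as well\<close>
  define e where "e = d / (\<gamma> + 1)"
  have e: "e > 0" "\<gamma> * e \<le> d" using d \<open>0 \<le> \<gamma>\<close> unfolding e_def by (auto simp: field_simps)
  have "\<forall>\<^sub>F w in nhds z. f z - d < f w" using f d unfolding lower_semicontinuous_def by simp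
  moreover have "\<forall>\<^sub>F w in nhds z. g z - e < g w" using g e unfolding lower_semicontinuous_def by simp
  ultimately show "\<forall>\<^sub>F w in nhds z. r < f w + \<gamma> * g w"
  proof eventually_elim
    case (elim w)
    have "\<gamma> * (g z - e) \<le> \<gamma> * g w" using elim \<open>0 \<le> \<gamma>\<close> by (intro mult_left_mono) auto
    then have "\<gamma> * g z - d \<le> \<gamma> * g w" using e by (simp add: algebra_simps)
    moreover have "r = f z + \<gamma> * g z - 2 * d" unfolding d_def by (simp add: field_simps)
    ultimately show ?case using elim by linarith
  qed
qed

text \<open>The approximations are \<open>h k z = (INF w. g w + k * dist z w)\<close>. Points \<open>w\<close> far from \<open>z\<close>
  are eventually too expensive since \<open>g\<close> is bounded below, and near \<open>z\<close> the values of \<open>g\<close> are almost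
  at least \<open>g z\<close>.\<close>

lemma lower_semicontinuous_lipschitz_approximation:
  fixes g :: "'b::metric_space \<Rightarrow> real"
  assumes lsc: "lower_semicontinuous g" and bd: "\<And>z. \<bar>g z\<bar> \<le> m"
  obtains h :: "nat \<Rightarrow> 'b \<Rightarrow> real"
  where "\<And>k. (real k)-lipschitz_on UNIV (h k)" "\<And>k z. h k z \<le> g z" "\<And>k z. \<bar>h k z\<bar> \<le> m"
    "\<And>z. (\<lambda>k. h k z) \<longlonglongrightarrow> g z"
proof -
  define h where "h k z = (INF w. g w + real k * dist z w)" for k :: nat and z
  have lb: "-m \<le> g w + real k * dist z w" for k w z
    using bd[of w] by (smt (verit) mult_nonneg_nonneg of_nat_0_le_iff zero_le_dist)
  have bb: "bdd_below (range (\<lambda>w. g w + real k * dist z w))" for k z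
    using lb by (intro bdd_belowI[of _ "-m"]) auto
  have hle: "h k z \<le> g w + real k * dist z w" for k z w
    unfolding h_def using bb by (intro cINF_lower) auto
  have hg: "h k z \<le> g z" for k z using hle[of k z z] by simp
  have hm: "-m \<le> h k z" for k z unfolding h_def using lb by (intro cINF_greatest) auto
  have one: "h k z \<le> h k z' + real k * dist z z'" for k z z'
  proof -
    have "h k z - real k * dist z z' \<le> g w + real k * dist z' w" for w
    proof -
      have "real k * dist z w \<le> real k * (dist z z' + dist z' w)"
        by (intro mult_left_mono dist_triangle) auto
      then show ?thesis using hle[of k z w] by (simp add: algebra_simps)
    qed
    then have "h k z - real k * dist z z' \<le> h k z'"
      unfolding h_def[of k z'] by (intro cINF_greatest) auto
    then show ?thesis by simp
  qed
  have lip: "(real k)-lipschitz_on UNIV (h k)" for k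
  proof (rule lipschitz_onI)
    fix x y show "dist (h k x) (h k y) \<le> real k * dist x y"
      using one[of k x y] one[of k y x] by (simp add: dist_real_def abs_le_iff dist_commute)
  qed simp
  have conv: "(\<lambda>k. h k z) \<longlonglongrightarrow> g z" for z
  proof (rule order_tendstoI)
    fix a assume "a < g z"
    then obtain r where r: "a < r" "r < g z" using dense by blast
    then have "\<forall>\<^sub>F w in nhds z. r < g w" using lsc unfolding lower_semicontinuous_def by blast
    then obtain d where d: "d > 0" "\<And>w. dist w z < d \<Longrightarrow> r < g w"
      unfolding eventually_nhds_metric by blast
    obtain N :: nat where N: "real N * d > r + m" using reals_Archimedean3[OF d(1)] by blast
    \<comment> \<open>beyond distance \<open>d\<close> the penalty exceeds \<open>r + m\<close>, which outweighs \<open>g w \<ge> - m\<close>\<close>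
    have "a < h k z" if "k \<ge> N" for k
    proof -
      have "r \<le> g w + real k * dist z w" for w
      proof (cases "dist w z < d")
        case True
        then show ?thesis using d(2)[of w] by (smt (verit) mult_nonneg_nonneg of_nat_0_le_iff zero_le_dist)
      next
        case False
        then have "real N * d \<le> real k * dist z w"
          using that d(1) by (intro mult_mono) (auto simp: dist_commute)
        then show ?thesis using N bd[of w] by linarith
      qed
      then have "r \<le> h k z" unfolding h_def by (intro cINF_greatest) auto
      then show ?thesis using r by simp
    qed
    then show "\<forall>\<^sub>F k in sequentially. a < h k z" unfolding eventually_sequentially by blast
  next
    fix a assume "g z < a"
    then show "\<forall>\<^sub>F k in sequentially. h k z < a"
      using hg by (intro always_eventually) (auto intro: le_less_trans)
  qed
  have "\<bar>h k z\<bar> \<le> m" for k z using hm[of k z] hg[of k z] bd[of z] by (simp add: abs_le_iff)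
  then show ?thesis using that lip hg conv by blast
qed

text \<open>Compactness of the feasible sets makes the minimum \<open>v\<close> attained and lower semicontinuous. For
  every closed \<open>D\<close> the same argument applies to the feasible points in \<open>D\<close>, which shows that the
  set of those \<open>x\<close> that have a minimiser in \<open>D\<close> is Borel. With \<open>D = {..r}\<close> this says that the
  smallest minimiser depends on \<open>x\<close> in a Borel way.\<close>

proposition measurable_minimizer:
  fixes J :: "'x::metric_space \<Rightarrow> real \<Rightarrow> real" and \<Gamma> :: "'x \<Rightarrow> real set"
  assumes C: "compact C" and \<Gamma>C: "\<And>x. \<Gamma> x \<subseteq> C" and ne: "\<And>x. \<Gamma> x \<noteq> {}"
    and bd: "\<And>x c. c \<in> \<Gamma> x \<Longrightarrow> \<bar>J x c\<bar> \<le> m"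
    and cl: "\<And>xs x cs c. xs \<longlonglongrightarrow> x \<Longrightarrow> cs \<longlonglongrightarrow> c \<Longrightarrow> (\<And>n. cs n \<in> \<Gamma> (xs n)) \<Longrightarrow> c \<in> \<Gamma> x"
    and lsc: "\<And>xs x cs c r. xs \<longlonglongrightarrow> x \<Longrightarrow> cs \<longlonglongrightarrow> c \<Longrightarrow> (\<And>n. cs n \<in> \<Gamma> (xs n)) \<Longrightarrow>
        (\<And>n. J (xs n) (cs n) \<le> r) \<Longrightarrow> J x c \<le> r"
  obtains v s where "lower_semicontinuous v" "\<And>x. \<bar>v x\<bar> \<le> m" "s \<in> borel_measurable borel"
    "\<And>x. s x \<in> \<Gamma> x" "\<And>x. J x (s x) = v x" "\<And>x c. c \<in> \<Gamma> x \<Longrightarrow> v x \<le> J x c"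
proof -
  \<comment> \<open>by compactness of \<open>C\<close>, sublevel sets projected to the states are closed\<close>
  have step: "\<exists>c\<in>\<Gamma> x \<inter> D. J x c \<le> r"
    if D: "closed D" and x: "xs \<longlonglongrightarrow> x" and c: "\<And>n. cs n \<in> \<Gamma> (xs n) \<inter> D" "\<And>n. J (xs n) (cs n) \<le> r"
    for D r xs x cs
  proof -
    have "\<forall>n. cs n \<in> C" using c(1) \<Gamma>C by blast
    then obtain c u where u: "strict_mono (u :: nat \<Rightarrow> nat)" "(cs \<circ> u) \<longlonglongrightarrow> c"
      using C[unfolded compact_eq_seq_compact_metric seq_compact_def] by blast
    have xu: "(\<lambda>n. xs (u n)) \<longlonglongrightarrow> x" using LIMSEQ_subseq_LIMSEQ[OF x u(1)] by (simp add: comp_def)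
    have cu: "(\<lambda>n. cs (u n)) \<longlonglongrightarrow> c" using u(2) by (simp add: comp_def)
    have "c \<in> \<Gamma> x" by (rule cl[OF xu cu]) (use c(1) in blast)
    moreover have "c \<in> D" by (rule closed_sequentially[OF D _ cu]) (use c(1) in blast)
    moreover have "J x c \<le> r" by (rule lsc[OF xu cu]) (use c in blast)+
    ultimately show ?thesis by blast
  qed
  have closed: "closed {x. \<exists>c\<in>\<Gamma> x \<inter> D. J x c \<le> r}" if "closed D" for D r
    unfolding closed_sequential_limits
  proof (intro allI impI)
    fix xs x assume *: "(\<forall>n. xs n \<in> {x. \<exists>c\<in>\<Gamma> x \<inter> D. J x c \<le> r}) \<and> xs \<longlonglongrightarrow> x"
    then have "\<forall>n. \<exists>c. c \<in> \<Gamma> (xs n) \<inter> D \<and> J (xs n) c \<le> r" by blast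
    then obtain cs where "\<forall>n. cs n \<in> \<Gamma> (xs n) \<inter> D \<and> J (xs n) (cs n) \<le> r" by metis
    then show "x \<in> {x. \<exists>c\<in>\<Gamma> x \<inter> D. J x c \<le> r}" using step[OF that, of xs x cs r] * by blast
  qed
  \<comment> \<open>approximate minimisers within \<open>D\<close> accumulate at an exact one\<close>
  have attained: "\<exists>c\<in>\<Gamma> x \<inter> D. J x c \<le> r"
    if D: "closed D" and inf: "\<And>e. e > 0 \<Longrightarrow> \<exists>c\<in>\<Gamma> x \<inter> D. J x c \<le> r + e" for D r x
  proof -
    have "\<exists>c. c \<in> \<Gamma> x \<inter> D \<and> J x c \<le> r + 1 / real (Suc n)" for n
      using inf[of "1 / real (Suc n)"] by auto
    then have "\<forall>n. \<exists>c. c \<in> \<Gamma> x \<inter> D \<and> J x c \<le> r + 1 / real (Suc n)" by blast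
    from choice[OF this] obtain cs where c: "\<And>n. cs n \<in> \<Gamma> x \<inter> D" "\<And>n. J x (cs n) \<le> r + 1 / real (Suc n)" by blast
    have "\<forall>n. cs n \<in> C" using c(1) \<Gamma>C by (metis IntD1 subsetD)
    then obtain c u where u: "strict_mono (u :: nat \<Rightarrow> nat)" "(cs \<circ> u) \<longlonglongrightarrow> c"
      using C[unfolded compact_eq_seq_compact_metric seq_compact_def] by blast
    then have cu: "(\<lambda>n. cs (u n)) \<longlonglongrightarrow> c" by (simp add: comp_def)
    have c': "c \<in> \<Gamma> x" by (rule cl[OF tendsto_const cu]) (use c(1) in blast)
    have D': "c \<in> D" by (rule closed_sequentially[OF D _ cu]) (use c(1) in blast)
    have "J x c \<le> r + e" if "e > 0" for e
    proof -
      obtain N where N: "1 / real (Suc N) < e" using nat_approx_posE[OF \<open>e > 0\<close>] by blast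
      have "J x (cs (u (n + N))) \<le> r + e" for n
      proof -
        have "N \<le> u (n + N)" using seq_suble[OF u(1), of "n + N"] by simp
        then have "1 / real (Suc (u (n + N))) \<le> 1 / real (Suc N)" by (simp add: frac_le)
        then show ?thesis using c(2)[of "u (n + N)"] N by linarith
      qed
      then show ?thesis
        by (intro lsc[OF tendsto_const LIMSEQ_ignore_initial_segment[OF cu, of N]]) (use c(1) in blast)+
    qed
    then have "J x c \<le> r" by (rule field_le_epsilon)
    then show ?thesis using c' D' by blast
  qed
  define v where "v x = Inf (J x ` \<Gamma> x)" for x
  have bb: "bdd_below (J x ` \<Gamma> x)" for x
    using bd by (intro bdd_belowI[of _ "-m"]) (force simp: abs_le_iff)
  have v_le: "v x \<le> J x c" if "c \<in> \<Gamma> x" for x c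
    unfolding v_def using that bb by (intro cInf_lower) auto
  have v_att: "\<exists>c\<in>\<Gamma> x. J x c \<le> v x" for x
  proof -
    have "\<exists>c\<in>\<Gamma> x \<inter> UNIV. J x c \<le> v x + e" if "e > 0" for e
    proof -
      have "\<exists>y\<in>J x ` \<Gamma> x. y < v x + e"
        unfolding v_def using that ne[of x] by (intro cInf_lessD) auto
      then show ?thesis by force
    qed
    from attained[OF closed_UNIV this] show ?thesis by simp
  qed
  have v_bd: "\<bar>v x\<bar> \<le> m" for x
  proof -
    obtain c where "c \<in> \<Gamma> x" "J x c \<le> v x" using v_att by blast
    then show ?thesis using v_le[of c x] bd[of c x] by simp
  qed
  have v_lsc: "lower_semicontinuous v"
  proof (rule lower_semicontinuousI_sequentially)
    fix r xs x assume x: "xs \<longlonglongrightarrow> x" and r: "\<And>n. v (xs n) \<le> r"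
    have "xs n \<in> {x. \<exists>c\<in>\<Gamma> x \<inter> UNIV. J x c \<le> r}" for n
      using v_att[of "xs n"] r[of n] by force
    then have "x \<in> {x. \<exists>c\<in>\<Gamma> x \<inter> UNIV. J x c \<le> r}"
      using closed[OF closed_UNIV, of r] x closed_sequentially by blast
    then show "v x \<le> r" using v_le order_trans by blast
  qed
  have v_meas [measurable]: "v \<in> borel_measurable borel" using lower_semicontinuous_borel[OF v_lsc] .
  \<comment> \<open>\<open>D\<close> contains a minimiser iff its feasible points reach every rational level above \<open>v x\<close>\<close>
  have hit: "{x. \<exists>c\<in>\<Gamma> x \<inter> D. J x c \<le> v x} \<in> sets borel" if D: "closed D" for D
  proof -
    have "{x. \<exists>c\<in>\<Gamma> x \<inter> D. J x c \<le> v x}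
      = (\<Inter>q::rat. - {x. v x < of_rat q} \<union> {x. \<exists>c\<in>\<Gamma> x \<inter> D. J x c \<le> of_rat q})" (is "?L = ?R")
    proof
      show "?L \<subseteq> ?R" by force
      show "?R \<subseteq> ?L"
      proof
        fix x assume x: "x \<in> ?R"
        have "\<exists>c\<in>\<Gamma> x \<inter> D. J x c \<le> v x + e" if "e > 0" for e
        proof -
          obtain q where q: "v x < of_rat q" "of_rat q < v x + e" using of_rat_dense[of "v x" "v x + e"] \<open>e > 0\<close> by auto
          then have "\<exists>c\<in>\<Gamma> x \<inter> D. J x c \<le> of_rat q" using x by blast
          then show ?thesis using q(2) by force
        qed
        from attained[OF D this] show "x \<in> ?L" by blast
      qed
    qed
    also have "\<dots> \<in> sets borel"
      using closed[OF D] by (intro sets.countable_INT'') (auto intro: borel_closed)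
    finally show ?thesis .
  qed
  define s where "s x = Inf {c \<in> \<Gamma> x. J x c \<le> v x}" for x
  have s_in: "s x \<in> \<Gamma> x \<and> J x (s x) \<le> v x" for x
  proof -
    have "closed {c \<in> \<Gamma> x. J x c \<le> v x}"
      unfolding closed_sequential_limits
    proof (intro allI impI)
      fix cs c assume *: "(\<forall>n. cs n \<in> {c \<in> \<Gamma> x. J x c \<le> v x}) \<and> cs \<longlonglongrightarrow> c"
      then have lim: "cs \<longlonglongrightarrow> c" by simp
      have "c \<in> \<Gamma> x" by (rule cl[OF tendsto_const lim]) (use * in blast)
      moreover have "J x c \<le> v x" by (rule lsc[OF tendsto_const lim]) (use * in blast)+
      ultimately show "c \<in> {c \<in> \<Gamma> x. J x c \<le> v x}" by blast
    qed
    moreover have "{c \<in> \<Gamma> x. J x c \<le> v x} \<noteq> {}" using v_att by blast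
    moreover have "bdd_below {c \<in> \<Gamma> x. J x c \<le> v x}"
      by (rule bdd_below_mono[OF bounded_imp_bdd_below[OF compact_imp_bounded[OF C]]]) (use \<Gamma>C in blast)
    ultimately have "s x \<in> {c \<in> \<Gamma> x. J x c \<le> v x}" unfolding s_def by (intro closed_contains_Inf)
    then show ?thesis by blast
  qed
  have s_min: "s x \<le> c" if "c \<in> \<Gamma> x" "J x c \<le> v x" for x c
  proof -
    have "bdd_below {c \<in> \<Gamma> x. J x c \<le> v x}"
      by (rule bdd_below_mono[OF bounded_imp_bdd_below[OF compact_imp_bounded[OF C]]]) (use \<Gamma>C in blast)
    then show ?thesis unfolding s_def using that by (intro cInf_lower) auto
  qed
  have "s \<in> borel_measurable borel"
  proof (rule borel_measurableI_le)
    fix r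
    have "s x \<le> r \<longleftrightarrow> (\<exists>c\<in>\<Gamma> x \<inter> {..r}. J x c \<le> v x)" for x
    proof
      assume "s x \<le> r"
      then show "\<exists>c\<in>\<Gamma> x \<inter> {..r}. J x c \<le> v x" using s_in[of x] by (intro bexI[of _ "s x"]) auto
    next
      assume "\<exists>c\<in>\<Gamma> x \<inter> {..r}. J x c \<le> v x"
      then obtain c where "c \<in> \<Gamma> x" "c \<le> r" "J x c \<le> v x" by blast
      then show "s x \<le> r" using s_min[of c x] by simp
    qed
    then have "{x \<in> space borel. s x \<le> r} = {x. \<exists>c\<in>\<Gamma> x \<inter> {..r}. J x c \<le> v x}" by simp
    then show "{x \<in> space borel. s x \<le> r} \<in> sets borel" using hit[OF closed_atMost] by simp
  qed
  moreover have "J x (s x) = v x" for x using s_in v_le by (simp add: antisym)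
  ultimately show ?thesis using that v_lsc v_bd s_in v_le by blast
qed

section \<open>Conditional distributions\<close>

text \<open>The kernel is a regular conditional distribution of \<open>Y\<close> given \<open>U\<close>, for a random element
  \<open>Y\<close> of an arbitrary measurable space; for real \<open>Y\<close> this is \<open>is_reg_cond_distr\<close>.\<close>

definition cond_kernel :: "'w measure \<Rightarrow> 'w measure \<Rightarrow> 'b measure \<Rightarrow> ('w \<Rightarrow> 'b) \<Rightarrow> ('w \<Rightarrow> 'b measure) \<Rightarrow> bool" where
  "cond_kernel M U N Y \<kappa> \<longleftrightarrow>
     \<kappa> \<in> U \<rightarrow>\<^sub>M prob_algebra N \<and>
     (\<forall>B\<in>sets N. AE \<omega> in M. cond_prob_in M U Y B \<omega> = measure (\<kappa> \<omega>) B)"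

lemma is_reg_cond_distr_eq: "is_reg_cond_distr M U Y \<kappa> \<longleftrightarrow> cond_kernel M U borel Y \<kappa>"
  by (simp add: is_reg_cond_distr_def cond_kernel_def)

locale prob_subalgebra = prob_space M for M :: "'w measure" +
  fixes U :: "'w measure"
  assumes subalg: "subalgebra M U"
begin

sublocale finite_measure_subalgebra M U
  by unfold_locales (rule subalg)

lemma space_U: "space U = space M"
  using subalg by (simp add: subalgebra_def)

lemma sets_U: "D \<in> sets U \<Longrightarrow> D \<in> sets M"
  using subalg by (auto simp: subalgebra_def)

lemmas U_measurable = measurable_from_subalg[OF subalg]

lemma integrable_indicator_times:
  fixes f :: "'w \<Rightarrow> real"
  assumes "D \<in> sets U" "integrable M f"
  shows "integrable M (\<lambda>\<omega>. indicator D \<omega> * f \<omega>)"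
  using integrable_real_mult_indicator[OF sets_U[OF assms(1)] assms(2)] by (simp add: mult.commute)

lemma emeasure_inter_eq_integral:
  assumes D: "D \<in> sets U" and S: "S \<in> sets M"
  shows "emeasure M (D \<inter> S) = ennreal (\<integral>\<omega>\<in>D. indicator S \<omega> \<partial>M)"
  using S sets_U[OF D]
  by (simp add: set_lebesgue_integral_def indicator_inter_arith[symmetric] emeasure_eq_measure)

lemma nn_integral_indicator_times:
  assumes D: "D \<in> sets U" and f: "integrable M f" "\<And>\<omega>. 0 \<le> f \<omega>"
  shows "(\<integral>\<^sup>+\<omega>. indicator D \<omega> * ennreal (f \<omega>) \<partial>M) = ennreal (\<integral>\<omega>\<in>D. f \<omega> \<partial>M)"
proof -
  have "(\<integral>\<^sup>+\<omega>. indicator D \<omega> * ennreal (f \<omega>) \<partial>M) = (\<integral>\<^sup>+\<omega>. ennreal (indicator D \<omega> * f \<omega>) \<partial>M)"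
    by (intro nn_integral_cong) (simp add: indicator_def)
  also have "\<dots> = ennreal (\<integral>\<omega>\<in>D. f \<omega> \<partial>M)"
    unfolding set_lebesgue_integral_def real_scaleR_def
    using f(2) by (intro nn_integral_eq_integral integrable_indicator_times[OF D f(1)] AE_I2) auto
  finally show ?thesis .
qed

lemma event_measurable:
  assumes "Y \<in> M \<rightarrow>\<^sub>M N" "B \<in> sets N"
  shows "{\<omega> \<in> space M. Y \<omega> \<in> B} \<in> sets M"
  using measurable_sets[OF assms] by (simp add: vimage_def Int_def conj_commute)

lemma kernel_mass:
  assumes \<kappa>: "\<kappa> \<in> U \<rightarrow>\<^sub>M prob_algebra N" and B: "B \<in> sets N"
  shows "(\<lambda>\<omega>. measure (\<kappa> \<omega>) B) \<in> borel_measurable U" "integrable M (\<lambda>\<omega>. measure (\<kappa> \<omega>) B)"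
    and "D \<in> sets U \<Longrightarrow>
      (\<integral>\<^sup>+\<omega>. indicator D \<omega> * emeasure (\<kappa> \<omega>) B \<partial>M) = ennreal (\<integral>\<omega>\<in>D. measure (\<kappa> \<omega>) B \<partial>M)"
proof -
  show m: "(\<lambda>\<omega>. measure (\<kappa> \<omega>) B) \<in> borel_measurable U"
    using measurable_compose[OF \<kappa> measurable_measure_prob_algebra[OF B]] .
  have pk: "prob_space (\<kappa> \<omega>)" if "\<omega> \<in> space M" for \<omega>
    using measurable_space[OF \<kappa>] that space_U by (auto simp: space_prob_algebra)
  show i: "integrable M (\<lambda>\<omega>. measure (\<kappa> \<omega>) B)"
    by (rule integrable_const_bound[where B=1])
      (use pk U_measurable[OF m] in \<open>auto intro!: AE_I2 simp: prob_space.prob_le_1\<close>)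
  assume D: "D \<in> sets U"
  have "(\<integral>\<^sup>+\<omega>. indicator D \<omega> * emeasure (\<kappa> \<omega>) B \<partial>M) = (\<integral>\<^sup>+\<omega>. indicator D \<omega> * ennreal (measure (\<kappa> \<omega>) B) \<partial>M)"
    using pk by (intro nn_integral_cong arg_cong2[where f="(*)"] refl)
      (simp add: finite_measure.emeasure_eq_measure prob_space.finite_measure)
  also have "\<dots> = ennreal (\<integral>\<omega>\<in>D. measure (\<kappa> \<omega>) B \<partial>M)"
    by (rule nn_integral_indicator_times[OF D i]) simp
  finally show "(\<integral>\<^sup>+\<omega>. indicator D \<omega> * emeasure (\<kappa> \<omega>) B \<partial>M) = ennreal (\<integral>\<omega>\<in>D. measure (\<kappa> \<omega>) B \<partial>M)" .
qed

text \<open>Being a conditional distribution is rephrased by integrals over \<open>U\<close>-measurable events, a form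
  in which conditional distributions can be composed without exceptional null sets.\<close>

lemma cond_kernelI:
  assumes Y: "Y \<in> M \<rightarrow>\<^sub>M N" and \<kappa>: "\<kappa> \<in> U \<rightarrow>\<^sub>M prob_algebra N"
    and eq: "\<And>D B. D \<in> sets U \<Longrightarrow> B \<in> sets N \<Longrightarrow>
      emeasure M (D \<inter> {\<omega> \<in> space M. Y \<omega> \<in> B}) = (\<integral>\<^sup>+\<omega>. indicator D \<omega> * emeasure (\<kappa> \<omega>) B \<partial>M)"
  shows "cond_kernel M U N Y \<kappa>"
  unfolding cond_kernel_def
proof (intro conjI \<kappa> ballI)
  fix B assume B: "B \<in> sets N"
  note [measurable] = event_measurable[OF Y B]
  show "AE \<omega> in M. cond_prob_in M U Y B \<omega> = measure (\<kappa> \<omega>) B"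
    unfolding cond_prob_in_def
  proof (rule real_cond_exp_charact[OF _ _ kernel_mass(2,1)[OF \<kappa> B]])
    fix D assume D: "D \<in> sets U"
    from eq[OF D B]
    show "(\<integral>\<omega>\<in>D. indicator {\<omega> \<in> space M. Y \<omega> \<in> B} \<omega> \<partial>M) = (\<integral>\<omega>\<in>D. measure (\<kappa> \<omega>) B \<partial>M)"
      unfolding emeasure_inter_eq_integral[OF D event_measurable[OF Y B]] kernel_mass(3)[OF \<kappa> B D]
      by (subst (asm) ennreal_inj) (auto simp: set_lebesgue_integral_def)
  qed (simp add: emeasure_eq_measure)
qed

lemma cond_kernelD:
  assumes Y: "Y \<in> M \<rightarrow>\<^sub>M N" and ck: "cond_kernel M U N Y \<kappa>" and D: "D \<in> sets U" and B: "B \<in> sets N"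
  shows "emeasure M (D \<inter> {\<omega> \<in> space M. Y \<omega> \<in> B}) = (\<integral>\<^sup>+\<omega>. indicator D \<omega> * emeasure (\<kappa> \<omega>) B \<partial>M)"
proof -
  have \<kappa>: "\<kappa> \<in> U \<rightarrow>\<^sub>M prob_algebra N" and
    eq: "AE \<omega> in M. cond_prob_in M U Y B \<omega> = measure (\<kappa> \<omega>) B"
    using ck B unfolding cond_kernel_def by auto
  note [measurable] = event_measurable[OF Y B] sets_U[OF D] U_measurable[OF kernel_mass(1)[OF \<kappa> B]]
  have "(\<integral>\<omega>\<in>D. indicator {\<omega> \<in> space M. Y \<omega> \<in> B} \<omega> \<partial>M)
      = (\<integral>\<omega>\<in>D. real_cond_exp M U (indicator {\<omega> \<in> space M. Y \<omega> \<in> B}) \<omega> \<partial>M)"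
    by (rule real_cond_exp_intA[OF _ D]) (simp add: emeasure_eq_measure)
  also have "\<dots> = (\<integral>\<omega>\<in>D. measure (\<kappa> \<omega>) B \<partial>M)"
    using eq unfolding set_lebesgue_integral_def cond_prob_in_def
    by (intro integral_cong_AE) (auto elim: eventually_mono)
  finally show ?thesis
    unfolding emeasure_inter_eq_integral[OF D event_measurable[OF Y B]] kernel_mass(3)[OF \<kappa> B D] by simp
qed

text \<open>The joint law of \<open>\<omega>\<close>, seen in \<open>U\<close>, and \<open>Y \<omega>\<close> agrees on rectangles with the law
  built from the kernel, hence everywhere.\<close>

lemma cond_kernel_disintegration:
  assumes Y: "Y \<in> M \<rightarrow>\<^sub>M N" and ck: "cond_kernel M U N Y \<kappa>"
    and h: "h \<in> borel_measurable (U \<Otimes>\<^sub>M N)"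
  shows "(\<integral>\<^sup>+\<omega>. h (\<omega>, Y \<omega>) \<partial>M) = (\<integral>\<^sup>+\<omega>. \<integral>\<^sup>+y. h (\<omega>, y) \<partial>\<kappa> \<omega> \<partial>M)"
proof -
  have \<kappa>: "\<kappa> \<in> U \<rightarrow>\<^sub>M prob_algebra N" using ck unfolding cond_kernel_def by auto
  have idU: "(\<lambda>\<omega>. \<omega>) \<in> M \<rightarrow>\<^sub>M U" by (rule U_measurable) simp
  have YU: "(\<lambda>\<omega>. (\<omega>, Y \<omega>)) \<in> M \<rightarrow>\<^sub>M U \<Otimes>\<^sub>M N" using idU Y by simp
  define K where "K \<omega> = distr (\<kappa> \<omega>) (U \<Otimes>\<^sub>M N) (Pair \<omega>)" for \<omega>
  have "K \<in> U \<rightarrow>\<^sub>M prob_algebra (U \<Otimes>\<^sub>M N)"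
    unfolding K_def using \<kappa> by (intro measurable_distr_prob_space2[where M=N]) auto
  then have KM: "K \<in> M \<rightarrow>\<^sub>M subprob_algebra (U \<Otimes>\<^sub>M N)"
    using U_measurable measurable_prob_algebraD by blast
  have k: "sets (\<kappa> \<omega>) = sets N" if "\<omega> \<in> space M" for \<omega>
    using measurable_space[OF \<kappa>] that space_U by (auto simp: space_prob_algebra)
  have Pm: "Pair \<omega> \<in> \<kappa> \<omega> \<rightarrow>\<^sub>M U \<Otimes>\<^sub>M N" if "\<omega> \<in> space M" for \<omega>
    using that space_U k[OF that] by (subst measurable_cong_sets[OF k[OF that] refl]) simp
  have eq: "distr M (U \<Otimes>\<^sub>M N) (\<lambda>\<omega>. (\<omega>, Y \<omega>)) = M \<bind> K"
  proof (rule measure_eqI_generator_eq[OF Int_stable_pair_measure_generator[of U N]])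
    show "{a \<times> b |a b. a \<in> sets U \<and> b \<in> sets N} \<subseteq> Pow (space U \<times> space N)"
      using sets.space_closed by (auto dest: sets.sets_into_space)
    show "sets (distr M (U \<Otimes>\<^sub>M N) (\<lambda>\<omega>. (\<omega>, Y \<omega>))) = sigma_sets (space U \<times> space N) {a \<times> b |a b. a \<in> sets U \<and> b \<in> sets N}"
      by (simp add: sets_pair_measure)
    show "sets (M \<bind> K) = sigma_sets (space U \<times> space N) {a \<times> b |a b. a \<in> sets U \<and> b \<in> sets N}"
      using sets_bind[of M K "U \<Otimes>\<^sub>M N"] not_empty subprob_measurableD(2)[OF KM] by (simp add: sets_pair_measure)
    fix E assume "E \<in> {a \<times> b |a b. a \<in> sets U \<and> b \<in> sets N}"
    then obtain D B where E: "E = D \<times> B" "D \<in> sets U" "B \<in> sets N" by blast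
    have "emeasure (distr M (U \<Otimes>\<^sub>M N) (\<lambda>\<omega>. (\<omega>, Y \<omega>))) E = emeasure M (D \<inter> {\<omega> \<in> space M. Y \<omega> \<in> B})"
      using E YU sets_U[OF E(2), THEN sets.sets_into_space]
      by (subst emeasure_distr) (auto intro!: arg_cong[where f="emeasure M"])
    also have "\<dots> = (\<integral>\<^sup>+\<omega>. indicator D \<omega> * emeasure (\<kappa> \<omega>) B \<partial>M)"
      by (rule cond_kernelD[OF Y ck E(2,3)])
    also have "\<dots> = (\<integral>\<^sup>+\<omega>. emeasure (K \<omega>) E \<partial>M)"
    proof (rule nn_integral_cong)
      fix \<omega> assume \<omega>: "\<omega> \<in> space M"
      have "emeasure (K \<omega>) E = emeasure (\<kappa> \<omega>) (Pair \<omega> -` E \<inter> space (\<kappa> \<omega>))"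
        unfolding K_def using E Pm[OF \<omega>] by (intro emeasure_distr) auto
      also have "Pair \<omega> -` E \<inter> space (\<kappa> \<omega>) = (if \<omega> \<in> D then B else {})"
        using E sets.sets_into_space[OF E(3)] sets_eq_imp_space_eq[OF k[OF \<omega>]] by auto
      finally show "indicator D \<omega> * emeasure (\<kappa> \<omega>) B = emeasure (K \<omega>) E" by simp
    qed
    also have "\<dots> = emeasure (M \<bind> K) E"
      using E by (intro emeasure_bind[OF not_empty KM, symmetric]) auto
    finally show "emeasure (distr M (U \<Otimes>\<^sub>M N) (\<lambda>\<omega>. (\<omega>, Y \<omega>))) E = emeasure (M \<bind> K) E" .
  next
    show "range (\<lambda>i::nat. space U \<times> space N) \<subseteq> {a \<times> b |a b. a \<in> sets U \<and> b \<in> sets N}" by auto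
    show "emeasure (distr M (U \<Otimes>\<^sub>M N) (\<lambda>\<omega>. (\<omega>, Y \<omega>))) (space U \<times> space N) \<noteq> \<infinity>"
      using YU by (subst emeasure_distr) (auto simp: emeasure_eq_measure)
  qed auto
  have "(\<integral>\<^sup>+\<omega>. h (\<omega>, Y \<omega>) \<partial>M) = (\<integral>\<^sup>+p. h p \<partial>distr M (U \<Otimes>\<^sub>M N) (\<lambda>\<omega>. (\<omega>, Y \<omega>)))"
    using h YU by (intro nn_integral_distr[symmetric]) auto
  also have "\<dots> = (\<integral>\<^sup>+\<omega>. \<integral>\<^sup>+p. h p \<partial>K \<omega> \<partial>M)"
    unfolding eq by (rule nn_integral_bind[OF h KM])
  also have "\<dots> = (\<integral>\<^sup>+\<omega>. \<integral>\<^sup>+y. h (\<omega>, y) \<partial>\<kappa> \<omega> \<partial>M)"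
    unfolding K_def using h Pm by (intro nn_integral_cong nn_integral_distr) auto
  finally show ?thesis .
qed

lemma cond_kernel_AE:
  assumes Y: "Y \<in> M \<rightarrow>\<^sub>M N" and ck: "cond_kernel M U N Y \<kappa>"
    and Q: "Measurable.pred (U \<Otimes>\<^sub>M N) Q" and ae: "AE \<omega> in M. Q (\<omega>, Y \<omega>)"
  shows "AE \<omega> in M. AE y in \<kappa> \<omega>. Q (\<omega>, y)"
proof -
  have \<kappa>: "\<kappa> \<in> U \<rightarrow>\<^sub>M prob_algebra N" using ck unfolding cond_kernel_def by auto
  define h :: "_ \<Rightarrow> ennreal" where "h = indicator {p. \<not> Q p}"
  have h [measurable]: "h \<in> borel_measurable (U \<Otimes>\<^sub>M N)" unfolding h_def using Q by measurable
  have k: "sets (\<kappa> \<omega>) = sets N" if "\<omega> \<in> space M" for \<omega>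
    using measurable_space[OF \<kappa>] that space_U by (auto simp: space_prob_algebra)
  have "(\<lambda>\<omega>. \<integral>\<^sup>+y. h (\<omega>, y) \<partial>\<kappa> \<omega>) \<in> borel_measurable U"
    using measurable_prob_algebraD[OF \<kappa>] h
    by (intro nn_integral_measurable_subprob_algebra2[where N=N]) auto
  then have m: "(\<lambda>\<omega>. \<integral>\<^sup>+y. h (\<omega>, y) \<partial>\<kappa> \<omega>) \<in> borel_measurable M" by (rule U_measurable)
  have "(\<integral>\<^sup>+\<omega>. h (\<omega>, Y \<omega>) \<partial>M) = (\<integral>\<^sup>+\<omega>. 0 \<partial>M)"
    using ae by (intro nn_integral_cong_AE) (auto simp: h_def elim!: eventually_mono)
  then have "(\<integral>\<^sup>+\<omega>. \<integral>\<^sup>+y. h (\<omega>, y) \<partial>\<kappa> \<omega> \<partial>M) = 0"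
    unfolding cond_kernel_disintegration[OF Y ck h] by simp
  then have "AE \<omega> in M. (\<integral>\<^sup>+y. h (\<omega>, y) \<partial>\<kappa> \<omega>) = 0" using m nn_integral_0_iff_AE by blast
  then show ?thesis
    using AE_space
  proof eventually_elim
    case (elim \<omega>)
    then have \<omega>: "\<omega> \<in> space M" and z: "(\<integral>\<^sup>+y. h (\<omega>, y) \<partial>\<kappa> \<omega>) = 0" by auto
    have "(\<lambda>y. h (\<omega>, y)) \<in> borel_measurable N"
      using measurable_compose_Pair1[of \<omega> U h N borel] h \<omega> space_U by (auto simp: comp_def)
    then have "(\<lambda>y. h (\<omega>, y)) \<in> borel_measurable (\<kappa> \<omega>)"
      using measurable_cong_sets[OF k[OF \<omega>] refl] by blast
    then have "AE y in \<kappa> \<omega>. h (\<omega>, y) = 0" using z nn_integral_0_iff_AE by blast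
    then show "AE y in \<kappa> \<omega>. Q (\<omega>, y)" by eventually_elim (simp add: h_def indicator_def split: if_splits)
  qed
qed

text \<open>Stochastic order passes to conditional distributions. With \<open>Y = Y'\<close> almost surely it also
  gives their almost sure uniqueness.\<close>

lemma cond_kernel_cdf_mono:
  assumes Y: "Y \<in> borel_measurable M" "Y' \<in> borel_measurable M"
    and ck: "cond_kernel M U borel Y \<kappa>" "cond_kernel M U borel Y' \<kappa>'"
    and le: "AE \<omega> in M. Y' \<omega> \<le> Y \<omega>"
  shows "AE \<omega> in M. \<forall>r::real. measure (\<kappa> \<omega>) {..r} \<le> measure (\<kappa>' \<omega>) {..r}"
proof -
  have "AE \<omega> in M. measure (\<kappa> \<omega>) {..of_rat r} \<le> measure (\<kappa>' \<omega>) {..of_rat r :: real}" for r :: rat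
  proof -
    have i: "integrable M (indicator {\<omega> \<in> space M. Y \<omega> \<in> {..of_rat r :: real}} :: _ \<Rightarrow> real)"
      "integrable M (indicator {\<omega> \<in> space M. Y' \<omega> \<in> {..of_rat r :: real}} :: _ \<Rightarrow> real)"
      using Y by (auto simp: emeasure_eq_measure)
    have "AE \<omega> in M. cond_prob_in M U Y {..of_rat r} \<omega> \<le> cond_prob_in M U Y' {..of_rat r} \<omega>"
      unfolding cond_prob_in_def
    proof (rule real_cond_exp_mono[OF _ i])
      show "AE \<omega> in M. (indicator {\<omega> \<in> space M. Y \<omega> \<in> {..of_rat r :: real}} \<omega> :: real)
          \<le> indicator {\<omega> \<in> space M. Y' \<omega> \<in> {..of_rat r}} \<omega>"
        using le by eventually_elim (auto simp: indicator_def)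
    qed
    moreover have "AE \<omega> in M. cond_prob_in M U Y {..of_rat r} \<omega> = measure (\<kappa> \<omega>) {..of_rat r}"
      "AE \<omega> in M. cond_prob_in M U Y' {..of_rat r} \<omega> = measure (\<kappa>' \<omega>) {..of_rat r}"
      using ck unfolding cond_kernel_def by auto
    ultimately show ?thesis by eventually_elim simp
  qed
  then have "AE \<omega> in M. \<forall>r::rat. measure (\<kappa> \<omega>) {..of_rat r} \<le> measure (\<kappa>' \<omega>) {..of_rat r :: real}"
    by (simp add: AE_all_countable)
  then show ?thesis
  proof (rule AE_mp, intro AE_I2 impI allI)
    fix \<omega> and x :: real assume \<omega>: "\<omega> \<in> space M"
      and *: "\<forall>r::rat. measure (\<kappa> \<omega>) {..of_rat r} \<le> measure (\<kappa>' \<omega>) {..of_rat r :: real}"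
    have "\<kappa> \<in> U \<rightarrow>\<^sub>M prob_algebra borel" "\<kappa>' \<in> U \<rightarrow>\<^sub>M prob_algebra borel"
      using ck unfolding cond_kernel_def by simp_all
    then have "\<kappa> \<omega> \<in> borel_probs" "\<kappa>' \<omega> \<in> borel_probs"
      using measurable_space[of _ U _ \<omega>] \<omega> unfolding borel_probs_eq_space space_U by blast+
    then show "measure (\<kappa> \<omega>) {..x} \<le> measure (\<kappa>' \<omega>) {..x}"
      by (rule cdf_le_if_le_on_rationals) (use * in blast)
  qed
qed

text \<open>Condition first on the larger \<open>\<sigma>\<close>-algebra \<open>V\<close>, which knows the action \<open>A\<close>, and then on
  \<open>U\<close>: by the tower property the two kernels are chained.\<close>

lemma cond_kernel_composition:
  assumes sub2: "prob_subalgebra M V" and UV: "sets U \<subseteq> sets V"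
    and X: "X \<in> U \<rightarrow>\<^sub>M N1" and A: "A \<in> V \<rightarrow>\<^sub>M N2" and X': "X' \<in> M \<rightarrow>\<^sub>M N3"
    and ckA: "cond_kernel M U N2 A \<kappa>"
    and p: "p \<in> N1 \<Otimes>\<^sub>M N2 \<rightarrow>\<^sub>M prob_algebra N3"
    and ckX: "cond_kernel M V N3 X' (\<lambda>\<omega>. p (X \<omega>, A \<omega>))"
    and g: "g \<in> N1 \<Otimes>\<^sub>M N2 \<Otimes>\<^sub>M N3 \<rightarrow>\<^sub>M N"
  shows "cond_kernel M U N (\<lambda>\<omega>. g (X \<omega>, A \<omega>, X' \<omega>))
    (\<lambda>\<omega>. \<kappa> \<omega> \<bind> (\<lambda>a. distr (p (X \<omega>, a)) N (\<lambda>y. g (X \<omega>, a, y))))"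
proof -
  interpret V: prob_subalgebra M V by (rule sub2)
  have subUV: "subalgebra V U" using UV space_U V.space_U by (simp add: subalgebra_def)
  have XV [measurable]: "X \<in> V \<rightarrow>\<^sub>M N1" using measurable_from_subalg[OF subUV X] .
  have XM [measurable]: "X \<in> M \<rightarrow>\<^sub>M N1" using V.U_measurable[OF XV] .
  note [measurable] = X A p g X'
  have AM [measurable]: "A \<in> M \<rightarrow>\<^sub>M N2" using V.U_measurable[OF A] .
  have \<kappa> [measurable]: "\<kappa> \<in> U \<rightarrow>\<^sub>M prob_algebra N2" using ckA unfolding cond_kernel_def by simp
  define q where "q \<omega> a = distr (p (X \<omega>, a)) N (\<lambda>y. g (X \<omega>, a, y))" for \<omega> a
  have q [measurable]: "(\<lambda>(\<omega>, a). q \<omega> a) \<in> U \<Otimes>\<^sub>M N2 \<rightarrow>\<^sub>M prob_algebra N"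
    unfolding q_def split_beta by measurable
  have bnd: "(\<lambda>\<omega>. \<kappa> \<omega> \<bind> q \<omega>) \<in> U \<rightarrow>\<^sub>M prob_algebra N" by measurable
  have "cond_kernel M U N (\<lambda>\<omega>. g (X \<omega>, A \<omega>, X' \<omega>)) (\<lambda>\<omega>. \<kappa> \<omega> \<bind> q \<omega>)"
  proof (rule cond_kernelI[OF _ bnd])
    show "(\<lambda>\<omega>. g (X \<omega>, A \<omega>, X' \<omega>)) \<in> M \<rightarrow>\<^sub>M N" by measurable
    fix D B assume D: "D \<in> sets U" and B: "B \<in> sets N"
    note [measurable] = D B
    have DV [measurable]: "D \<in> sets V" using D UV by blast
    note DM [measurable] = V.sets_U[OF DV]
    define h where "h p = (indicator D (fst p) * indicator B (g (X (fst p), A (fst p), snd p)) :: ennreal)" for p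
    have h: "h \<in> borel_measurable (V \<Otimes>\<^sub>M N3)" unfolding h_def by measurable
    have "emeasure M (D \<inter> {\<omega> \<in> space M. g (X \<omega>, A \<omega>, X' \<omega>) \<in> B})
        = (\<integral>\<^sup>+\<omega>. indicator (D \<inter> {\<omega> \<in> space M. g (X \<omega>, A \<omega>, X' \<omega>) \<in> B}) \<omega> \<partial>M)"
      by (rule nn_integral_indicator[symmetric]) measurable
    also have "\<dots> = (\<integral>\<^sup>+\<omega>. h (\<omega>, X' \<omega>) \<partial>M)"
      by (intro nn_integral_cong) (auto simp: h_def indicator_def)
    also have "\<dots> = (\<integral>\<^sup>+\<omega>. \<integral>\<^sup>+y. h (\<omega>, y) \<partial>p (X \<omega>, A \<omega>) \<partial>M)"
      by (rule V.cond_kernel_disintegration[OF X' ckX h])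
    also have "\<dots> = (\<integral>\<^sup>+\<omega>. indicator D \<omega> * emeasure (q \<omega> (A \<omega>)) B \<partial>M)"
    proof (rule nn_integral_cong)
      fix \<omega> assume \<omega>: "\<omega> \<in> space M"
      have pX: "p (X \<omega>, A \<omega>) \<in> space (prob_algebra N3)"
        using measurable_space[OF p] measurable_space[OF XM \<omega>] measurable_space[OF AM \<omega>]
        by (auto simp: space_pair_measure)
      have s: "sets (p (X \<omega>, A \<omega>)) = sets N3" using pX by (simp add: space_prob_algebra)
      have gm: "(\<lambda>y. g (X \<omega>, A \<omega>, y)) \<in> p (X \<omega>, A \<omega>) \<rightarrow>\<^sub>M N"
        unfolding measurable_cong_sets[OF s refl]
        using measurable_space[OF XM \<omega>] measurable_space[OF AM \<omega>] by measurable
      have "(\<integral>\<^sup>+y. h (\<omega>, y) \<partial>p (X \<omega>, A \<omega>)) = (\<integral>\<^sup>+y. indicator D \<omega> * indicator B (g (X \<omega>, A \<omega>, y)) \<partial>p (X \<omega>, A \<omega>))"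
        unfolding h_def by simp
      also have "\<dots> = indicator D \<omega> * (\<integral>\<^sup>+y. indicator B (g (X \<omega>, A \<omega>, y)) \<partial>p (X \<omega>, A \<omega>))"
        using gm by (intro nn_integral_cmult) simp
      also have "(\<integral>\<^sup>+y. indicator B (g (X \<omega>, A \<omega>, y)) \<partial>p (X \<omega>, A \<omega>)) = emeasure (q \<omega> (A \<omega>)) B"
        unfolding q_def using gm
        by (subst nn_integral_distr[symmetric, where f = "indicator B"]) auto
      finally show "(\<integral>\<^sup>+y. h (\<omega>, y) \<partial>p (X \<omega>, A \<omega>)) = indicator D \<omega> * emeasure (q \<omega> (A \<omega>)) B" .
    qed
    also have "\<dots> = (\<integral>\<^sup>+\<omega>. \<integral>\<^sup>+a. indicator D \<omega> * emeasure (q \<omega> a) B \<partial>\<kappa> \<omega> \<partial>M)"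
    proof -
      have em: "(\<lambda>x. emeasure (case x of (\<omega>, a) \<Rightarrow> q \<omega> a) B) \<in> borel_measurable (U \<Otimes>\<^sub>M N2)"
        by (rule measurable_compose[OF measurable_prob_algebraD[OF q] measurable_emeasure_subprob_algebra[OF B]])
      have "(\<lambda>x. indicator D (fst x) * emeasure (q (fst x) (snd x)) B) \<in> borel_measurable (U \<Otimes>\<^sub>M N2)"
      proof -
        have [measurable]: "(\<lambda>x. emeasure (q (fst x) (snd x)) B) \<in> borel_measurable (U \<Otimes>\<^sub>M N2)"
          using em by (simp add: split_beta)
        show ?thesis by measurable
      qed
      from cond_kernel_disintegration[OF AM ckA this] show ?thesis by simp
    qed
    also have "\<dots> = (\<integral>\<^sup>+\<omega>. indicator D \<omega> * emeasure (\<kappa> \<omega> \<bind> q \<omega>) B \<partial>M)"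
    proof (rule nn_integral_cong)
      fix \<omega> assume \<omega>: "\<omega> \<in> space M"
      then have \<omega>U: "\<omega> \<in> space U" using space_U by simp
      have k: "\<kappa> \<omega> \<in> space (prob_algebra N2)" using measurable_space[OF \<kappa> \<omega>U] .
      have qm: "q \<omega> \<in> N2 \<rightarrow>\<^sub>M prob_algebra N" using measurable_compose_Pair1[OF \<omega>U q] by simp
      have "(\<lambda>a. emeasure (q \<omega> a) B) \<in> borel_measurable N2"
        by (rule measurable_compose[OF measurable_prob_algebraD[OF qm] measurable_emeasure_subprob_algebra[OF B]])
      then have "(\<lambda>a. emeasure (q \<omega> a) B) \<in> borel_measurable (\<kappa> \<omega>)"
        using k by (simp add: space_prob_algebra cong: measurable_cong_sets)
      then show "(\<integral>\<^sup>+a. indicator D \<omega> * emeasure (q \<omega> a) B \<partial>\<kappa> \<omega>) = indicator D \<omega> * emeasure (\<kappa> \<omega> \<bind> q \<omega>) B"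
        unfolding emeasure_bind_prob_algebra[OF k qm B] by (rule nn_integral_cmult)
    qed
    finally show "emeasure M (D \<inter> {\<omega> \<in> space M. g (X \<omega>, A \<omega>, X' \<omega>) \<in> B})
      = (\<integral>\<^sup>+\<omega>. indicator D \<omega> * emeasure (\<kappa> \<omega> \<bind> q \<omega>) B \<partial>M)" .
  qed
  then show ?thesis unfolding q_def .
qed

text \<open>The conditional distribution function is built from the conditional probabilities \<open>G s\<close> of
  \<open>Y \<le> s\<close> at rational levels \<open>s\<close>. The infimum over the levels beyond \<open>x\<close> is monotone and right
  continuous in \<open>x\<close> whatever the values of \<open>G\<close> are. Prescribing \<open>0\<close> below \<open>-m\<close> and \<open>1\<close> from \<open>m\<close>
  on therefore yields a probability measure on \<open>[-m, m]\<close> for every \<open>\<omega>\<close>; relations between the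
  levels, which hold only almost surely, enter only in the identification of the integrals.\<close>

proposition real_cond_kernel_exists:
  fixes Y :: "'w \<Rightarrow> real"
  assumes Y [measurable]: "Y \<in> borel_measurable M" and m: "AE \<omega> in M. \<bar>Y \<omega>\<bar> \<le> m" "0 \<le> m"
  obtains \<kappa> where "cond_kernel M U borel Y \<kappa>" "\<And>\<omega>. \<kappa> \<omega> \<in> probs_on {-m..m}"
proof -
  define G where "G s = cond_prob_in M U Y {..of_rat s}" for s :: rat
  define H where "H s \<omega> = (if of_rat s < -m then 0 else if m \<le> of_rat s then 1 else max 0 (min 1 (G s \<omega>)))" for s :: rat and \<omega>
  define Fc where "Fc \<omega> x = (INF s\<in>{s::rat. x < of_rat s}. H s \<omega>)" for \<omega> and x :: real
  have GU [measurable]: "G s \<in> borel_measurable U" for s unfolding G_def cond_prob_in_def by measurable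
  have HU [measurable]: "H s \<in> borel_measurable U" for s unfolding H_def by measurable
  have H01: "0 \<le> H s \<omega>" "H s \<omega> \<le> 1" for s \<omega> unfolding H_def by auto
  have ne: "{s::rat. x < of_rat s} \<noteq> {}" for x :: real
    using of_rat_dense[of x "x + 1"] by auto
  have bb: "bdd_below ((\<lambda>s. H s \<omega>) ` S)" for S \<omega> using H01(1) by (intro bdd_belowI[of _ 0]) auto
  have Fc_le: "Fc \<omega> x \<le> H s \<omega>" if "x < of_rat s" for \<omega> x s
    unfolding Fc_def using that bb by (intro cINF_lower) auto
  have Fc0: "0 \<le> Fc \<omega> x" for \<omega> x unfolding Fc_def using H01 ne by (intro cINF_greatest) auto
  have Fc_mono: "Fc \<omega> x \<le> Fc \<omega> y" if "x \<le> y" for \<omega> x y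
    unfolding Fc_def using that bb ne by (intro cINF_superset_mono) auto
  have Fc_small: "Fc \<omega> x = 0" if "x < -m" for \<omega> x
  proof -
    obtain s where s: "x < of_rat s" "of_rat s < -m" using of_rat_dense[OF \<open>x < -m\<close>] by blast
    then have "H s \<omega> = 0" unfolding H_def by simp
    then show ?thesis using Fc_le[OF s(1), of \<omega>] Fc0[of \<omega> x] by simp
  qed
  have Fc_large: "Fc \<omega> x = 1" if "m \<le> x" for \<omega> x
  proof -
    have "H s \<omega> = 1" if "x < of_rat s" for s using that \<open>m \<le> x\<close> m(2) unfolding H_def by simp
    then have "Fc \<omega> x = (INF s\<in>{s::rat. x < of_rat s}. 1)" unfolding Fc_def by (intro INF_cong) auto
    then show ?thesis using ne by simp
  qed
  have Fc_right: "continuous (at_right x) (Fc \<omega>)" for x \<omega>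
    unfolding continuous_within
  proof (rule order_tendstoI)
    fix a assume "a < Fc \<omega> x"
    then show "\<forall>\<^sub>F y in at_right x. a < Fc \<omega> y"
      using Fc_mono[of x _ \<omega>] by (intro eventually_at_right_less[THEN eventually_mono]) (auto intro: less_le_trans)
  next
    fix a assume "Fc \<omega> x < a"
    then obtain s where s: "x < of_rat s" "H s \<omega> < a"
      unfolding Fc_def using cINF_less_iff[OF ne bb] by auto
    have "Fc \<omega> y < a" if "x < y" "y < of_rat s" for y using Fc_le[OF that(2), of \<omega>] s(2) by simp
    then show "\<forall>\<^sub>F y in at_right x. Fc \<omega> y < a"
      unfolding eventually_at_right_field using s(1) by blast
  qed
  have Fc_bot: "(Fc \<omega> \<longlongrightarrow> 0) at_bot" for \<omega>
    using Fc_small by (intro tendsto_eventually eventually_at_bot_dense[THEN iffD2] exI[of _ "-m"]) auto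
  have Fc_top: "(Fc \<omega> \<longlongrightarrow> 1) at_top" for \<omega>
    using Fc_large by (intro tendsto_eventually eventually_at_top_linorder[THEN iffD2] exI[of _ "m"]) auto
  define \<kappa> where "\<kappa> \<omega> = interval_measure (Fc \<omega>)" for \<omega>
  have \<kappa>b: "\<kappa> \<omega> \<in> borel_probs" for \<omega>
    unfolding \<kappa>_def real_distribution_borel_probs[symmetric]
    by (rule real_distribution_interval_measure[OF Fc_mono Fc_right Fc_bot Fc_top])
  have \<kappa>_Iic: "emeasure (\<kappa> \<omega>) {..x} = ennreal (Fc \<omega> x)" for \<omega> x
    unfolding \<kappa>_def by (rule emeasure_interval_measure_Iic[OF Fc_mono Fc_right Fc_bot])
  have \<kappa>_m: "\<kappa> \<omega> \<in> probs_on {-m..m}" for \<omega>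
  proof -
    interpret k: prob_space "\<kappa> \<omega>" using borel_probsD[OF \<kappa>b] by simp
    have s: "{..x} \<in> sets (\<kappa> \<omega>)" for x using borel_probsD(2)[OF \<kappa>b] by simp
    have "emeasure (\<kappa> \<omega>) {..m} = 1" using \<kappa>_Iic Fc_large by simp
    then have 1: "AE x in \<kappa> \<omega>. x \<in> {..m}" using k.prob_eq_1[OF s] by (simp add: measure_def)
    have "AE x in \<kappa> \<omega>. \<not> x \<le> - m - 1 / Suc n" for n
    proof (rule AE_I[of _ _ "{..- m - 1 / Suc n}"])
      show "emeasure (\<kappa> \<omega>) {..- m - 1 / Suc n} = 0" using \<kappa>_Iic Fc_small by simp
    qed (use s in auto)
    then have 2: "AE x in \<kappa> \<omega>. \<forall>n. \<not> x \<le> - m - 1 / Suc n" by (simp add: AE_all_countable)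
    have "AE x in \<kappa> \<omega>. x \<in> {-m..m}"
      using 1 2
    proof eventually_elim
      case (elim x)
      have "-m \<le> x"
      proof (rule ccontr)
        assume "\<not> -m \<le> x"
        then obtain n where "1 / real (Suc n) < -m - x" using nat_approx_posE[of "-m - x"] by auto
        then have "x \<le> - m - 1 / Suc n" by simp
        then show False using elim by blast
      qed
      then show ?case using elim by simp
    qed
    then show ?thesis using \<kappa>b by (simp add: probs_on_AE)
  qed
  have FcU: "(\<lambda>\<omega>. Fc \<omega> x) \<in> borel_measurable U" for x
    unfolding Fc_def by (intro borel_measurable_cINF bb) auto
  have Iic: "sets borel = sigma_sets UNIV (range (\<lambda>x::real. {..x}))"
    by (simp add: borel_eq_atMost)
  have Int: "Int_stable (range (\<lambda>x::real. {..x}))"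
    by (auto simp: Int_stable_def intro: exI[of _ "min _ _"])
  have \<kappa>U: "\<kappa> \<in> U \<rightarrow>\<^sub>M prob_algebra borel"
  proof (rule measurable_prob_algebra_generated[OF Iic Int])
    fix A assume "A \<in> range (\<lambda>x::real. {..x})"
    then show "(\<lambda>\<omega>. emeasure (\<kappa> \<omega>) A) \<in> borel_measurable U" using FcU \<kappa>_Iic by auto
  qed (use borel_probsD[OF \<kappa>b] in auto)
  have HG: "AE \<omega> in M. H s \<omega> = cond_prob_in M U Y {..of_rat s} \<omega>" for s
  proof -
    have i: "integrable M (indicator {\<omega> \<in> space M. Y \<omega> \<in> {..of_rat s :: real}} :: _ \<Rightarrow> real)"
      by (auto simp: emeasure_eq_measure)
    have "AE \<omega> in M. 0 \<le> G s \<omega>" "AE \<omega> in M. G s \<omega> \<le> 1"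
      unfolding G_def cond_prob_in_def
      by (rule real_cond_exp_ge_c[OF i], simp, rule real_cond_exp_le_c[OF i], simp add: indicator_def)
    moreover have "AE \<omega> in M. G s \<omega> = 0" if "of_rat s < -m"
    proof -
      have "AE \<omega> in M. G s \<omega> = real_cond_exp M U (\<lambda>\<omega>. 0) \<omega>"
        unfolding G_def cond_prob_in_def
      proof (rule real_cond_exp_cong)
        show "AE \<omega> in M. (indicator {\<omega> \<in> space M. Y \<omega> \<in> {..of_rat s}} \<omega> :: real) = 0"
          using m(1) by eventually_elim (use that in \<open>auto simp: indicator_def\<close>)
      qed auto
      moreover have "AE \<omega> in M. real_cond_exp M U (\<lambda>\<omega>. 0) \<omega> = 0" by (rule real_cond_exp_F_meas) auto
      ultimately show ?thesis by eventually_elim simp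
    qed
    moreover have "AE \<omega> in M. G s \<omega> = 1" if "m \<le> of_rat s"
    proof -
      have "AE \<omega> in M. G s \<omega> = real_cond_exp M U (\<lambda>\<omega>. 1) \<omega>"
        unfolding G_def cond_prob_in_def
      proof (rule real_cond_exp_cong)
        show "AE \<omega> in M. (indicator {\<omega> \<in> space M. Y \<omega> \<in> {..of_rat s}} \<omega> :: real) = 1"
          using m(1) AE_space by eventually_elim (use that in \<open>auto simp: indicator_def\<close>)
      qed auto
      moreover have "AE \<omega> in M. real_cond_exp M U (\<lambda>\<omega>. 1) \<omega> = 1" by (rule real_cond_exp_F_meas) auto
      ultimately show ?thesis by eventually_elim simp
    qed
    ultimately show ?thesis
      unfolding G_def[symmetric] H_def
      by (cases "of_rat s < -m"; cases "m \<le> of_rat s") (auto elim: eventually_elim2)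
  qed
  have int_H: "(\<integral>\<^sup>+\<omega>. indicator D \<omega> * ennreal (H s \<omega>) \<partial>M) = emeasure M (D \<inter> {\<omega> \<in> space M. Y \<omega> \<in> {..of_rat s}})"
    if D: "D \<in> sets U" for D s
  proof -
    note [measurable] = sets_U[OF D] U_measurable[OF HU]
    have iH: "integrable M (H s)" using H01 by (intro integrable_const_bound[of _ 1]) auto
    have "(\<integral>\<^sup>+\<omega>. indicator D \<omega> * ennreal (H s \<omega>) \<partial>M) = ennreal (\<integral>\<omega>\<in>D. H s \<omega> \<partial>M)"
      by (rule nn_integral_indicator_times[OF D iH H01(1)])
    also have "(\<integral>\<omega>\<in>D. H s \<omega> \<partial>M) = (\<integral>\<omega>\<in>D. real_cond_exp M U (indicator {\<omega> \<in> space M. Y \<omega> \<in> {..of_rat s}}) \<omega> \<partial>M)"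
      using HG[of s] unfolding set_lebesgue_integral_def cond_prob_in_def
      by (intro integral_cong_AE) (auto elim: eventually_mono)
    also have "\<dots> = (\<integral>\<omega>\<in>D. indicator {\<omega> \<in> space M. Y \<omega> \<in> {..of_rat s}} \<omega> \<partial>M)"
      by (rule real_cond_exp_intA[OF _ D, symmetric]) (simp add: emeasure_eq_measure)
    also have "ennreal \<dots> = emeasure M (D \<inter> {\<omega> \<in> space M. Y \<omega> \<in> {..of_rat s}})"
      by (rule emeasure_inter_eq_integral[OF D, symmetric]) measurable
    finally show ?thesis .
  qed
  have int_Fc: "(\<integral>\<^sup>+\<omega>. indicator D \<omega> * ennreal (Fc \<omega> x) \<partial>M) = emeasure M (D \<inter> {\<omega> \<in> space M. Y \<omega> \<in> {..x}})"
    if D: "D \<in> sets U" for D x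
  proof (rule antisym)
    note [measurable] = sets_U[OF D] U_measurable[OF HU] U_measurable[OF FcU]
    have mS: "D \<inter> {\<omega> \<in> space M. Y \<omega> \<in> {..y}} \<in> sets M" for y by measurable
    have "(\<integral>\<^sup>+\<omega>. indicator D \<omega> * ennreal (Fc \<omega> x) \<partial>M) \<le> emeasure M (D \<inter> {\<omega> \<in> space M. Y \<omega> \<in> {..x + 1 / Suc n}})" for n
    proof -
      obtain s where s: "x < of_rat s" "of_rat s < x + 1 / Suc n" using of_rat_dense[of x "x + 1 / Suc n"] by auto
      have "(\<integral>\<^sup>+\<omega>. indicator D \<omega> * ennreal (Fc \<omega> x) \<partial>M) \<le> (\<integral>\<^sup>+\<omega>. indicator D \<omega> * ennreal (H s \<omega>) \<partial>M)"
        using Fc_le[OF s(1)] by (intro nn_integral_mono mult_left_mono ennreal_leI) auto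
      also have "\<dots> \<le> emeasure M (D \<inter> {\<omega> \<in> space M. Y \<omega> \<in> {..x + 1 / Suc n}})"
        unfolding int_H[OF D] using s by (intro emeasure_mono mS) auto
      finally show ?thesis .
    qed
    moreover have "(\<lambda>n. emeasure M (D \<inter> {\<omega> \<in> space M. Y \<omega> \<in> {..x + 1 / Suc n}})) \<longlonglongrightarrow>
        emeasure M (\<Inter>n. D \<inter> {\<omega> \<in> space M. Y \<omega> \<in> {..x + 1 / Suc n}})"
    proof (rule Lim_emeasure_decseq)
      show "decseq (\<lambda>n. D \<inter> {\<omega> \<in> space M. Y \<omega> \<in> {..x + 1 / Suc n}})"
      proof (rule decseq_SucI)
        fix n have "1 / real (Suc (Suc n)) \<le> 1 / real (Suc n)" by (simp add: frac_le)
        then show "D \<inter> {\<omega> \<in> space M. Y \<omega> \<in> {..x + 1 / Suc (Suc n)}} \<subseteq> D \<inter> {\<omega> \<in> space M. Y \<omega> \<in> {..x + 1 / Suc n}}" by auto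
      qed
    qed (use mS in \<open>auto simp: emeasure_eq_measure\<close>)
    moreover have "(\<Inter>n. D \<inter> {\<omega> \<in> space M. Y \<omega> \<in> {..x + 1 / Suc n}}) = D \<inter> {\<omega> \<in> space M. Y \<omega> \<in> {..x}}"
    proof -
      have "y \<le> x" if "\<And>n. y \<le> x + 1 / Suc n" for y :: real
      proof (rule field_le_epsilon)
        fix e :: real assume "e > 0"
        then obtain n where "1 / real (Suc n) < e" using nat_approx_posE by blast
        then show "y \<le> x + e" using that[of n] by linarith
      qed
      then show ?thesis by (auto intro: order_trans)
    qed
    ultimately show "(\<integral>\<^sup>+\<omega>. indicator D \<omega> * ennreal (Fc \<omega> x) \<partial>M) \<le> emeasure M (D \<inter> {\<omega> \<in> space M. Y \<omega> \<in> {..x}})"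
      using LIMSEQ_le_const by (metis (no_types, lifting))
    \<comment> \<open>the converse: almost surely \<open>P (Y \<le> x | U) \<le> H s\<close> for all rational \<open>s > x\<close> at once\<close>
    define Gx where "Gx = cond_prob_in M U Y {..x}"
    have i: "integrable M (indicator {\<omega> \<in> space M. Y \<omega> \<in> {..y :: real}} :: _ \<Rightarrow> real)" for y
      by (auto simp: emeasure_eq_measure)
    have "AE \<omega> in M. Gx \<omega> \<le> H s \<omega>" if "x < of_rat s" for s
    proof -
      have "AE \<omega> in M. Gx \<omega> \<le> cond_prob_in M U Y {..of_rat s} \<omega>"
        unfolding Gx_def cond_prob_in_def using that
        by (intro real_cond_exp_mono[OF _ i i] AE_I2) (auto simp: indicator_def)
      then show ?thesis using HG[of s] by eventually_elim simp
    qed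
    then have "AE \<omega> in M. \<forall>s. x < of_rat s \<longrightarrow> Gx \<omega> \<le> H s \<omega>" by (auto simp: AE_all_countable)
    then have le: "AE \<omega> in M. Gx \<omega> \<le> Fc \<omega> x"
      by eventually_elim (use ne in \<open>auto simp: Fc_def intro!: cINF_greatest\<close>)
    have [measurable]: "Gx \<in> borel_measurable M" unfolding Gx_def cond_prob_in_def by measurable
    have iF: "integrable M (\<lambda>\<omega>. Fc \<omega> x)"
    proof (rule integrable_const_bound[of _ 1])
      have "Fc \<omega> x \<le> 1" for \<omega>
      proof -
        obtain s where "s \<in> {s::rat. x < of_rat s}" using ne[of x] by blast
        then show ?thesis using Fc_le[of x s \<omega>] H01(2)[of s \<omega>] by simp
      qed
      then show "AE \<omega> in M. norm (Fc \<omega> x) \<le> 1" using Fc0 by simp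
    qed measurable
    have "emeasure M (D \<inter> {\<omega> \<in> space M. Y \<omega> \<in> {..x}}) = ennreal (\<integral>\<omega>\<in>D. indicator {\<omega> \<in> space M. Y \<omega> \<in> {..x}} \<omega> \<partial>M)"
      by (rule emeasure_inter_eq_integral[OF D]) measurable
    also have "(\<integral>\<omega>\<in>D. indicator {\<omega> \<in> space M. Y \<omega> \<in> {..x}} \<omega> \<partial>M) = (\<integral>\<omega>\<in>D. Gx \<omega> \<partial>M)"
      unfolding Gx_def cond_prob_in_def by (rule real_cond_exp_intA[OF _ D]) (simp add: emeasure_eq_measure)
    also have "\<dots> \<le> (\<integral>\<omega>\<in>D. Fc \<omega> x \<partial>M)"
      unfolding set_lebesgue_integral_def real_scaleR_def
    proof (rule integral_mono_AE)
      have "integrable M Gx" unfolding Gx_def cond_prob_in_def by (rule real_cond_exp_int(1)[OF i])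
      then show "integrable M (\<lambda>\<omega>. indicator D \<omega> * Gx \<omega>)"
        by (rule integrable_indicator_times[OF D])
      show "integrable M (\<lambda>\<omega>. indicator D \<omega> * Fc \<omega> x)"
        by (rule integrable_indicator_times[OF D iF])
      show "AE \<omega> in M. indicator D \<omega> * Gx \<omega> \<le> indicator D \<omega> * Fc \<omega> x"
        using le by eventually_elim (auto intro: mult_left_mono)
    qed
    also have "ennreal (\<integral>\<omega>\<in>D. Fc \<omega> x \<partial>M) = (\<integral>\<^sup>+\<omega>. indicator D \<omega> * ennreal (Fc \<omega> x) \<partial>M)"
      by (rule nn_integral_indicator_times[OF D iF Fc0, symmetric])
    finally show "emeasure M (D \<inter> {\<omega> \<in> space M. Y \<omega> \<in> {..x}}) \<le> (\<integral>\<^sup>+\<omega>. indicator D \<omega> * ennreal (Fc \<omega> x) \<partial>M)"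
      by (simp add: ennreal_leI)
  qed
  have "cond_kernel M U borel Y \<kappa>"
  proof (rule cond_kernelI[OF Y \<kappa>U])
    fix D and B :: "real set" assume D: "D \<in> sets U" and B: "B \<in> sets borel"
    note [measurable] = sets_U[OF D]
    have \<kappa>M: "\<kappa> \<in> density M (indicator D) \<rightarrow>\<^sub>M subprob_algebra borel"
      using measurable_prob_algebraD[OF U_measurable[OF \<kappa>U]] by simp
    define \<nu>1 where "\<nu>1 = distr (density M (indicator D)) borel Y"
    define \<nu>2 where "\<nu>2 = density M (indicator D) \<bind> \<kappa>"
    have \<nu>1: "emeasure \<nu>1 B = emeasure M (D \<inter> {\<omega> \<in> space M. Y \<omega> \<in> B})" if [measurable]: "B \<in> sets borel" for B
    proof -
      have "emeasure \<nu>1 B = emeasure (density M (indicator D)) (Y -` B \<inter> space M)"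
        unfolding \<nu>1_def by (subst emeasure_distr) auto
      also have "\<dots> = (\<integral>\<^sup>+\<omega>. indicator D \<omega> * indicator (Y -` B \<inter> space M) \<omega> \<partial>M)"
        by (rule emeasure_density) measurable
      also have "\<dots> = (\<integral>\<^sup>+\<omega>. indicator (D \<inter> {\<omega> \<in> space M. Y \<omega> \<in> B}) \<omega> \<partial>M)"
        by (intro nn_integral_cong) (auto simp: indicator_def)
      also have "\<dots> = emeasure M (D \<inter> {\<omega> \<in> space M. Y \<omega> \<in> B})"
        by (rule nn_integral_indicator) measurable
      finally show ?thesis .
    qed
    have \<nu>2: "emeasure \<nu>2 B = (\<integral>\<^sup>+\<omega>. indicator D \<omega> * emeasure (\<kappa> \<omega>) B \<partial>M)" if B: "B \<in> sets borel" for B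
    proof -
      have [measurable]: "(\<lambda>\<omega>. emeasure (\<kappa> \<omega>) B) \<in> borel_measurable M"
        by (rule measurable_compose[OF measurable_prob_algebraD[OF U_measurable[OF \<kappa>U]] measurable_emeasure_subprob_algebra[OF B]])
      show ?thesis unfolding \<nu>2_def using not_empty
        by (subst emeasure_bind[OF _ \<kappa>M B]) (auto simp: nn_integral_density)
    qed
    have "\<nu>1 = \<nu>2"
    proof (rule measure_eqI_generator_eq[OF Int, of UNIV _ _ "\<lambda>n::nat. {..real n}"])
      show "sets \<nu>1 = sigma_sets UNIV (range (\<lambda>x::real. {..x}))" unfolding \<nu>1_def using Iic by simp
      show "sets \<nu>2 = sigma_sets UNIV (range (\<lambda>x::real. {..x}))"
        unfolding \<nu>2_def using Iic sets_bind[of "density M (indicator D)" \<kappa> borel] subprob_measurableD(2)[OF \<kappa>M] not_empty by simp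
      show "emeasure \<nu>1 E = emeasure \<nu>2 E" if "E \<in> range (\<lambda>x::real. {..x})" for E
        using that int_Fc[OF D] \<nu>1 \<nu>2 \<kappa>_Iic by auto
      show "(\<Union>n::nat. {..real n}) = UNIV" using real_arch_simple by auto
      show "emeasure \<nu>1 {..real n} \<noteq> \<infinity>" for n using \<nu>1 by (simp add: emeasure_eq_measure)
    qed auto
    then show "emeasure M (D \<inter> {\<omega> \<in> space M. Y \<omega> \<in> B}) = (\<integral>\<^sup>+\<omega>. indicator D \<omega> * emeasure (\<kappa> \<omega>) B \<partial>M)"
      using \<nu>1[OF B] \<nu>2[OF B] by simp
  qed
  then show ?thesis using that \<kappa>_m by blast
qed

end

context prob_subalgebra
begin

lemma Linf_norm_bound:
  fixes Y :: "'w \<Rightarrow> real"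
  assumes Y [measurable]: "Y \<in> borel_measurable M" and m: "AE \<omega> in M. \<bar>Y \<omega>\<bar> \<le> m"
  shows "AE \<omega> in M. \<bar>Y \<omega>\<bar> \<le> Linf_norm M Y" "0 \<le> Linf_norm M Y" "Linf_norm M Y \<le> m"
proof -
  define e where "e = esssup M (\<lambda>\<omega>. ereal \<bar>Y \<omega>\<bar>)"
  have le: "e \<le> ereal m" unfolding e_def using m by (intro esssup_I) auto
  have ae: "AE \<omega> in M. ereal \<bar>Y \<omega>\<bar> \<le> e" unfolding e_def by (rule esssup_AE)
  have "0 \<le> e"
  proof (rule ccontr)
    assume "\<not> 0 \<le> e"
    have "AE \<omega> in M. False"
      using ae
    proof eventually_elim
      case (elim \<omega>)
      have "0 \<le> ereal \<bar>Y \<omega>\<bar>" by simp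
      then show False using elim \<open>\<not> 0 \<le> e\<close> by (meson order_trans)
    qed
    then show False by simp
  qed
  then obtain L where L: "e = ereal L" "0 \<le> L" using le by (cases e) auto
  then have "Linf_norm M Y = L" unfolding Linf_norm_def e_def[symmetric] by simp
  then show "AE \<omega> in M. \<bar>Y \<omega>\<bar> \<le> Linf_norm M Y" "0 \<le> Linf_norm M Y" "Linf_norm M Y \<le> m"
    using ae L le by auto
qed

text \<open>As a conditional distribution supported everywhere in the required interval exists, the
  chosen version \<open>reg_cond_distr\<close> has these properties.\<close>

lemma reg_cond_distr_spec:
  fixes Y :: "'w \<Rightarrow> real"
  assumes Y: "Y \<in> borel_measurable M" and m: "AE \<omega> in M. \<bar>Y \<omega>\<bar> \<le> m"
  shows "cond_kernel M U borel Y (reg_cond_distr M U Y)"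
    and "\<And>\<omega>. \<omega> \<in> space M \<Longrightarrow> reg_cond_distr M U Y \<omega> \<in> probs_on {-m..m}"
proof -
  note L = Linf_norm_bound[OF assms]
  obtain \<kappa> where "cond_kernel M U borel Y \<kappa>" "\<And>\<omega>. \<kappa> \<omega> \<in> probs_on {- Linf_norm M Y .. Linf_norm M Y}"
    using real_cond_kernel_exists[OF Y L(1,2)] by blast
  then have "\<exists>\<kappa>. is_reg_cond_distr M U Y \<kappa> \<and> (\<forall>\<omega>\<in>space M. \<kappa> \<omega> \<in> probs_on {- Linf_norm M Y .. Linf_norm M Y})"
    unfolding is_reg_cond_distr_eq by blast
  from someI_ex[OF this]
  have *: "cond_kernel M U borel Y (reg_cond_distr M U Y)"
    "\<forall>\<omega>\<in>space M. reg_cond_distr M U Y \<omega> \<in> probs_on {- Linf_norm M Y .. Linf_norm M Y}"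
    unfolding reg_cond_distr_def is_reg_cond_distr_eq by auto
  show "cond_kernel M U borel Y (reg_cond_distr M U Y)" by (rule *(1))
  show "reg_cond_distr M U Y \<omega> \<in> probs_on {-m..m}" if "\<omega> \<in> space M" for \<omega>
    by (rule probs_on_mono[OF *(2)[rule_format, OF that]]) (use L(3) in auto)
qed

text \<open>Condition the real code of \<open>A\<close> and decode.\<close>

lemma compact_cond_kernel_exists:
  fixes A :: "'w \<Rightarrow> 'a::polish_space"
  assumes A [measurable]: "A \<in> M \<rightarrow>\<^sub>M borel" and K: "compact K" "K \<noteq> {}" and AK: "AE \<omega> in M. A \<omega> \<in> K"
  obtains \<kappa> where "cond_kernel M U borel A \<kappa>" "\<And>\<omega>. \<kappa> \<omega> \<in> probs_on K"
proof -
  obtain C :: "real set" and q :: "real \<Rightarrow> 'a" and s :: "'a \<Rightarrow> real"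
    where q [measurable]: "q \<in> borel_measurable borel" and qK: "range q = K"
    and s: "s \<in> borel_measurable borel" "\<And>x. x \<in> K \<Longrightarrow> q (s x) = x" "\<And>x. \<bar>s x\<bar> \<le> 2"
    by (rule compact_real_coding[OF K]) blast
  have clK: "K \<in> sets borel" using compact_imp_closed[OF K(1)] by auto
  have Y: "(\<lambda>\<omega>. s (A \<omega>)) \<in> borel_measurable M" using measurable_compose[OF A s(1)] .
  obtain \<kappa> where \<kappa>: "cond_kernel M U borel (\<lambda>\<omega>. s (A \<omega>)) \<kappa>" "\<And>\<omega>. \<kappa> \<omega> \<in> probs_on {-2..2}"
    by (rule real_cond_kernel_exists[OF Y, of 2]) (use s(3) in auto)
  have \<kappa>m: "\<kappa> \<in> U \<rightarrow>\<^sub>M prob_algebra borel" using \<kappa>(1) unfolding cond_kernel_def by simp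
  have \<kappa>b: "\<kappa> \<omega> \<in> borel_probs" for \<omega> using \<kappa>(2) probs_on_borel_probs by blast
  have "cond_kernel M U borel A (\<lambda>\<omega>. distr (\<kappa> \<omega>) borel q)"
    unfolding cond_kernel_def
  proof (intro conjI ballI)
    show "(\<lambda>\<omega>. distr (\<kappa> \<omega>) borel q) \<in> U \<rightarrow>\<^sub>M prob_algebra borel"
      using measurable_compose[OF \<kappa>m measurable_distr_prob_space[OF q]] .
    fix B :: "'a set" assume [measurable]: "B \<in> sets borel"
    have B': "q -` B \<in> sets borel" using measurable_sets[OF q, of B] by simp
    have 1: "AE \<omega> in M. cond_prob_in M U A B \<omega> = cond_prob_in M U (\<lambda>\<omega>. s (A \<omega>)) (q -` B) \<omega>"
      unfolding cond_prob_in_def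
    proof (rule real_cond_exp_cong)
      show "AE \<omega> in M. (indicator {\<omega> \<in> space M. A \<omega> \<in> B} \<omega> :: real)
          = indicator {\<omega> \<in> space M. s (A \<omega>) \<in> q -` B} \<omega>"
        using AK by eventually_elim (auto simp: indicator_def s(2))
      have [measurable]: "(\<lambda>\<omega>. q (s (A \<omega>))) \<in> M \<rightarrow>\<^sub>M borel" using measurable_compose[OF Y q] .
      show "(indicator {\<omega> \<in> space M. s (A \<omega>) \<in> q -` B} :: _ \<Rightarrow> real) \<in> borel_measurable M"
        unfolding vimage_eq by measurable
    qed measurable
    have 2: "AE \<omega> in M. cond_prob_in M U (\<lambda>\<omega>. s (A \<omega>)) (q -` B) \<omega> = measure (\<kappa> \<omega>) (q -` B)"
      using \<kappa>(1) B' unfolding cond_kernel_def by blast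
    have dm: "measure (distr (\<kappa> \<omega>) borel q) B = measure (\<kappa> \<omega>) (q -` B)" for \<omega>
      using q borel_probsD(3)[OF \<kappa>b[of \<omega>]]
      by (subst measure_distr) (simp_all add: borel_probs_measurable[OF \<kappa>b])
    show "AE \<omega> in M. cond_prob_in M U A B \<omega> = measure (distr (\<kappa> \<omega>) borel q) B"
      unfolding dm using 1 2 by eventually_elim simp
  qed
  moreover have "distr (\<kappa> \<omega>) borel q \<in> probs_on K" for \<omega>
    using qK clK by (intro distr_probs_on \<kappa>b q) auto
  ultimately show ?thesis using that by blast
qed

end

section \<open>The law of a cost under a weakly continuous kernel\<close>

text \<open>The law of \<open>g (x, a, y)\<close> when the action \<open>a\<close> is drawn from \<open>\<mu>\<close> and the next state \<open>y\<close>
  from \<open>p x a\<close>.\<close>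

definition cost_law :: "('x \<Rightarrow> 'a \<Rightarrow> 'x measure) \<Rightarrow> ('x \<times> 'a \<times> 'x \<Rightarrow> real) \<Rightarrow> 'x \<Rightarrow> 'a measure \<Rightarrow> real measure" where
  "cost_law p g x \<mu> = \<mu> \<bind> (\<lambda>a. distr (p x a) borel (\<lambda>y. g (x, a, y)))"

locale feller_kernel =
  fixes p :: "'x::polish_space \<Rightarrow> 'a::polish_space \<Rightarrow> 'x measure"
  assumes p_prob: "p x a \<in> borel_probs"
    and p_meas: "(\<lambda>(x, a). p x a) \<in> borel \<Otimes>\<^sub>M borel \<rightarrow>\<^sub>M prob_algebra borel"
    and p_cont: "xs \<longlonglongrightarrow> x \<Longrightarrow> as \<longlonglongrightarrow> a \<Longrightarrow> weakly_tendsto (\<lambda>n. p (xs n) (as n)) (p x a)"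
begin

lemma step_measurable:
  assumes "g \<in> borel_measurable borel"
  shows "(\<lambda>a. distr (p x a) borel (\<lambda>y. g (x, a, y))) \<in> borel \<rightarrow>\<^sub>M prob_algebra borel"
proof -
  have "(\<lambda>a. p x a) \<in> borel \<rightarrow>\<^sub>M prob_algebra borel"
    using measurable_compose_Pair1[of x borel "\<lambda>(x, a). p x a" borel] p_meas by simp
  moreover have "(\<lambda>(a, y). g (x, a, y)) \<in> borel \<Otimes>\<^sub>M borel \<rightarrow>\<^sub>M borel"
  proof -
    have [measurable]: "g \<in> borel \<Otimes>\<^sub>M borel \<Otimes>\<^sub>M borel \<rightarrow>\<^sub>M borel" using assms by (simp add: borel_prod)
    show ?thesis by measurable
  qed
  ultimately show ?thesis by (rule measurable_distr_prob_space2)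
qed

lemma cost_law_borel_probs:
  assumes "g \<in> borel_measurable borel" "\<mu> \<in> borel_probs"
  shows "cost_law p g x \<mu> \<in> borel_probs"
  unfolding cost_law_def borel_probs_eq_space space_prob_algebra
  using prob_space_bind'[OF borel_probsD(4)[OF assms(2)] step_measurable[OF assms(1)]]
    sets_bind'[OF borel_probsD(4)[OF assms(2)] step_measurable[OF assms(1)]] by blast

lemma integral_cost_law:
  fixes h :: "real \<Rightarrow> real"
  assumes g: "g \<in> borel_measurable borel" and l: "\<mu> \<in> borel_probs"
    and h: "h \<in> borel_measurable borel" "\<And>r. \<bar>h r\<bar> \<le> B"
  shows "(\<integral>r. h r \<partial>cost_law p g x \<mu>) = (\<integral>a. \<integral>y. h (g (x, a, y)) \<partial>p x a \<partial>\<mu>)"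
proof -
  interpret prob_space \<mu> using borel_probsD[OF l] by simp
  have m: "(\<lambda>a. distr (p x a) borel (\<lambda>y. g (x, a, y))) \<in> \<mu> \<rightarrow>\<^sub>M prob_algebra borel"
    using step_measurable[OF g] by (simp add: borel_probs_measurable[OF l])
  have gm: "(\<lambda>y. g (x, a, y)) \<in> borel_measurable borel" for a
    using g by measurable
  have "(\<integral>r. h r \<partial>cost_law p g x \<mu>) = (\<integral>a. \<integral>r. h r \<partial>distr (p x a) borel (\<lambda>y. g (x, a, y)) \<partial>\<mu>)"
    unfolding cost_law_def
  proof (rule integral_bind[of h borel B "\<lambda>a. distr (p x a) borel (\<lambda>y. g (x, a, y))" \<mu> 1])
    show "AE a in \<mu>. emeasure (distr (p x a) borel (\<lambda>y. g (x, a, y))) (space (distr (p x a) borel (\<lambda>y. g (x, a, y)))) \<le> ennreal 1"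
    proof (intro AE_I2)
      fix a assume "a \<in> space \<mu>"
      then have "prob_space (distr (p x a) borel (\<lambda>y. g (x, a, y)))"
        using measurable_space[OF m] by (auto simp: space_prob_algebra)
      from prob_space.emeasure_space_1[OF this]
      show "emeasure (distr (p x a) borel (\<lambda>y. g (x, a, y))) (space (distr (p x a) borel (\<lambda>y. g (x, a, y)))) \<le> ennreal 1" by simp
    qed
  qed (use h measurable_prob_algebraD[OF m] finite_measure_axioms in auto)
  also have "\<dots> = (\<integral>a. \<integral>y. h (g (x, a, y)) \<partial>p x a \<partial>\<mu>)"
    using gm h by (intro Bochner_Integration.integral_cong refl integral_distr) (simp_all add: borel_probs_measurable[OF p_prob])
  finally show ?thesis .
qed

lemma emeasure_cost_law:
  assumes g: "g \<in> borel_measurable borel" and \<mu>: "\<mu> \<in> borel_probs" and B: "B \<in> sets borel"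
  shows "emeasure (cost_law p g x \<mu>) B = (\<integral>\<^sup>+a. emeasure (p x a) {y. g (x, a, y) \<in> B} \<partial>\<mu>)"
proof -
  have gm: "(\<lambda>y. g (x, a, y)) \<in> borel_measurable borel" for a using g by measurable
  have "emeasure (distr (p x a) borel (\<lambda>y. g (x, a, y))) B = emeasure (p x a) {y. g (x, a, y) \<in> B}" for a
    using gm B borel_probsD(3)[OF p_prob, of x a]
    by (subst emeasure_distr) (simp_all add: borel_probs_measurable[OF p_prob] vimage_def)
  then show ?thesis
    unfolding cost_law_def emeasure_bind_prob_algebra[OF borel_probsD(4)[OF \<mu>] step_measurable[OF g] B] by simp
qed

lemma cost_law_bounded:
  assumes g: "g \<in> borel_measurable borel" "\<And>z. \<bar>g z\<bar> \<le> m" and \<mu>: "\<mu> \<in> borel_probs"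
  shows "cost_law p g x \<mu> \<in> probs_on {-m..m}"
proof -
  have "{y. g (x, a, y) \<in> {-m..m}} = UNIV" for a using g(2) by (auto simp: abs_le_iff minus_le_iff)
  moreover have "emeasure (p x a) UNIV = 1" for a
    using borel_probsD(1,3)[OF p_prob, of x a] prob_space.emeasure_space_1 by metis
  moreover have "emeasure \<mu> UNIV = 1"
    using borel_probsD(1,3)[OF \<mu>] prob_space.emeasure_space_1 by metis
  ultimately have "emeasure (cost_law p g x \<mu>) {-m..m} = 1"
    using borel_probsD(3)[OF \<mu>] by (simp add: emeasure_cost_law[OF g(1) \<mu>] del: atLeastAtMost_iff)
  then show ?thesis using cost_law_borel_probs[OF g(1) \<mu>] by (simp add: probs_on_def measure_def)
qed

lemma inner_integral_measurable:
  fixes f :: "'a \<times> 'x \<Rightarrow> real"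
  assumes "f \<in> borel_measurable borel"
  shows "(\<lambda>a. \<integral>y. f (a, y) \<partial>p x a) \<in> borel_measurable borel"
proof -
  have "(\<lambda>a. p x a) \<in> borel \<rightarrow>\<^sub>M prob_algebra borel"
    using measurable_compose_Pair1[of x borel "\<lambda>(x, a). p x a" borel] p_meas by simp
  then have 1: "(\<lambda>a. distr (p x a) borel (\<lambda>y. f (a, y))) \<in> borel \<rightarrow>\<^sub>M prob_algebra borel"
    by (rule measurable_distr_prob_space2) (use assms in \<open>simp add: borel_prod\<close>)
  have "(\<lambda>a. \<integral>r. r \<partial>distr (p x a) borel (\<lambda>y. f (a, y))) \<in> borel_measurable borel"
    using measurable_compose[OF measurable_prob_algebraD[OF 1] integral_measurable_subprob_algebra[of "\<lambda>r::real. r" borel]] by simp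
  moreover have "(\<lambda>y. f (a, y)) \<in> borel_measurable borel" for a using assms by measurable
  then have "(\<integral>r. r \<partial>distr (p x a) borel (\<lambda>y. f (a, y))) = (\<integral>y. f (a, y) \<partial>p x a)" for a
    by (intro integral_distr) (simp_all add: borel_probs_measurable[OF p_prob])
  ultimately show ?thesis by simp
qed

lemma cost_law_cdf_mono:
  assumes g: "g \<in> borel_measurable borel" "g' \<in> borel_measurable borel" and le: "\<And>z. g' z \<le> g z"
    and \<mu>: "\<mu> \<in> borel_probs"
  shows "measure (cost_law p g x \<mu>) {..r} \<le> measure (cost_law p g' x \<mu>) {..r}"
proof -
  interpret prob_space "cost_law p g' x \<mu>" using borel_probsD[OF cost_law_borel_probs[OF g(2) \<mu>]] by simp
  have "{y. g' (x, a, y) \<in> {..r}} \<in> sets (p x a)" for a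
  proof -
    have "(\<lambda>y. g' (x, a, y)) \<in> borel_measurable borel" using g(2) by measurable
    from measurable_sets[OF this, of "{..r}"] show ?thesis
      using borel_probsD(2)[OF p_prob] by (simp add: vimage_def)
  qed
  then have "emeasure (cost_law p g x \<mu>) {..r} \<le> emeasure (cost_law p g' x \<mu>) {..r}"
    unfolding emeasure_cost_law[OF g(1) \<mu> atMost_borel] emeasure_cost_law[OF g(2) \<mu> atMost_borel]
    by (intro nn_integral_mono emeasure_mono) (auto intro: order_trans[OF le])
  then show ?thesis unfolding measure_def by (intro enn2real_mono) (auto simp: less_top[symmetric])
qed

end

lemma (in prob_space) abs_integral_le:
  fixes f :: "'a \<Rightarrow> real"
  assumes "f \<in> borel_measurable M" "\<And>x. \<bar>f x\<bar> \<le> B"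
  shows "\<bar>\<integral>x. f x \<partial>M\<bar> \<le> B"
proof -
  have i: "integrable M f" using assms by (intro integrable_const_bound[of _ B]) auto
  have "\<bar>\<integral>x. f x \<partial>M\<bar> \<le> (\<integral>x. \<bar>f x\<bar> \<partial>M)" by (rule integral_abs_bound)
  also have "\<dots> \<le> (\<integral>x. B \<partial>M)" using i assms by (intro integral_mono integrable_abs) auto
  finally show ?thesis by (simp add: prob_space)
qed

lemma (in prob_space) integral_dist_le:
  fixes f g :: "'a \<Rightarrow> real"
  assumes i: "integrable M f" "integrable M g" and e: "AE x in M. \<bar>f x - g x\<bar> \<le> e"
  shows "\<bar>(\<integral>x. f x \<partial>M) - (\<integral>x. g x \<partial>M)\<bar> \<le> e"
proof -
  have "\<bar>(\<integral>x. f x \<partial>M) - (\<integral>x. g x \<partial>M)\<bar> = \<bar>\<integral>x. f x - g x \<partial>M\<bar>" by (simp add: i)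
  also have "\<dots> \<le> (\<integral>x. \<bar>f x - g x\<bar> \<partial>M)" by (rule integral_abs_bound)
  also have "\<dots> \<le> (\<integral>x. e \<partial>M)"
    using i by (intro integral_mono_AE e integrable_abs Bochner_Integration.integrable_diff) auto
  finally show ?thesis by (simp add: prob_space)
qed

context feller_kernel
begin

text \<open>For uniformly continuous \<open>f\<close> the change of \<open>f (xs n, as n, y)\<close> is small uniformly in
  \<open>y\<close>, and the weak continuity of the kernel takes care of the remaining fixed integrand. Mere
  continuity of \<open>f\<close> would require tightness of the transition laws.\<close>

lemma inner_integral_continuous:
  fixes f :: "'x \<times> 'a \<times> 'x \<Rightarrow> real"
  assumes uc: "uniformly_continuous_on UNIV f" and B: "\<And>z. \<bar>f z\<bar> \<le> B"
  shows "continuous_on UNIV (\<lambda>(x, a). \<integral>y. f (x, a, y) \<partial>p x a)"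
  unfolding continuous_on_sequentially
proof (intro allI ballI impI)
  fix zs :: "nat \<Rightarrow> 'x \<times> 'a" and z assume *: "(\<forall>n. zs n \<in> UNIV) \<and> zs \<longlonglongrightarrow> z"
  obtain x a where z: "z = (x, a)" by (cases z)
  define xs where "xs n = fst (zs n)" for n
  define as where "as n = snd (zs n)" for n
  have xn: "xs \<longlonglongrightarrow> x" and an: "as \<longlonglongrightarrow> a"
    using * tendsto_fst[of zs z sequentially] tendsto_snd[of zs z sequentially] unfolding xs_def as_def z by auto
  have cf: "continuous_on UNIV f" using uc by (rule uniformly_continuous_imp_continuous)
  have c1: "continuous_on UNIV (\<lambda>y. f (x, a, y))" for x a
    by (rule continuous_on_compose2[OF cf]) (auto intro!: continuous_intros)
  have m1: "(\<lambda>y. f (x, a, y)) \<in> borel_measurable borel" for x a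
    using c1 by (rule borel_measurable_continuous_onI)
  have b1: "bounded (range (\<lambda>y. f (x, a, y)))" for x a
    unfolding bounded_iff using B by auto
  note i1 = bounded_borel_integrable[OF p_prob m1 b1]
  have lim: "(\<lambda>n. \<integral>y. f (x, a, y) \<partial>p (xs n) (as n)) \<longlonglongrightarrow> (\<integral>y. f (x, a, y) \<partial>p x a)"
    using p_cont[OF xn an] c1 b1 unfolding weakly_tendsto_def by blast
  have diff: "(\<lambda>n. (\<integral>y. f (xs n, as n, y) \<partial>p (xs n) (as n)) - (\<integral>y. f (x, a, y) \<partial>p (xs n) (as n))) \<longlonglongrightarrow> 0"
  proof (rule LIMSEQ_I)
    fix e :: real assume "e > 0"
    then obtain d where d: "d > 0" "\<And>z z'. dist z' z < d \<Longrightarrow> dist (f z') (f z) < e / 2"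
      using uc unfolding uniformly_continuous_on_def by (meson UNIV_I half_gt_zero)
    have "\<forall>\<^sub>F n in sequentially. dist (zs n) z < d" using * d(1) tendstoD by blast
    then obtain N where N: "\<And>n. n \<ge> N \<Longrightarrow> dist (zs n) z < d" unfolding eventually_sequentially by blast
    show "\<exists>N. \<forall>n\<ge>N. norm ((\<integral>y. f (xs n, as n, y) \<partial>p (xs n) (as n)) - (\<integral>y. f (x, a, y) \<partial>p (xs n) (as n)) - 0) < e"
    proof (intro exI[of _ N] allI impI)
      fix n assume n: "n \<ge> N"
      interpret prob_space "p (xs n) (as n)" using borel_probsD[OF p_prob] by simp
      have near: "\<bar>f (xs n, as n, y) - f (x, a, y)\<bar> \<le> e / 2" for y
      proof -
        have "dist (xs n, as n, y) (x, a, y) = dist (zs n) z"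
          unfolding z xs_def as_def by (simp add: dist_prod_def)
        then show ?thesis using d(2)[of "(xs n, as n, y)" "(x, a, y)"] N[OF n] by (simp add: dist_real_def)
      qed
      have "\<bar>(\<integral>y. f (xs n, as n, y) \<partial>p (xs n) (as n)) - (\<integral>y. f (x, a, y) \<partial>p (xs n) (as n))\<bar> \<le> e / 2"
        by (rule integral_dist_le[OF i1 i1]) (use near in simp)
      then show "norm ((\<integral>y. f (xs n, as n, y) \<partial>p (xs n) (as n)) - (\<integral>y. f (x, a, y) \<partial>p (xs n) (as n)) - 0) < e"
        using \<open>e > 0\<close> by simp
    qed
  qed
  have "(\<lambda>n. \<integral>y. f (xs n, as n, y) \<partial>p (xs n) (as n)) \<longlonglongrightarrow> (\<integral>y. f (x, a, y) \<partial>p x a)"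
    using tendsto_add[OF diff lim] by simp
  then show "((\<lambda>(x, a). \<integral>y. f (x, a, y) \<partial>p x a) \<circ> zs) \<longlonglongrightarrow> (\<lambda>(x, a). \<integral>y. f (x, a, y) \<partial>p x a) z"
    unfolding comp_def z xs_def as_def split_beta by simp
qed

end

lemma compact_convergent_sequence:
  fixes xs :: "nat \<Rightarrow> 'x::topological_space"
  assumes "xs \<longlonglongrightarrow> x"
  shows "compact (insert x (range xs))"
  unfolding compact_eq_Heine_Borel
proof (intro allI impI, elim conjE)
  fix \<C> assume \<C>: "\<forall>t\<in>\<C>. open t" "insert x (range xs) \<subseteq> \<Union>\<C>"
  then obtain t where t: "t \<in> \<C>" "x \<in> t" by blast
  then have "\<forall>\<^sub>F n in sequentially. xs n \<in> t" using \<C>(1) assms topological_tendstoD by blast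
  then obtain N where N: "\<And>n. n \<ge> N \<Longrightarrow> xs n \<in> t" unfolding eventually_sequentially by blast
  have "\<forall>n. \<exists>u. u \<in> \<C> \<and> xs n \<in> u" using \<C>(2) by blast
  then obtain u where u: "\<And>n. u n \<in> \<C>" "\<And>n. xs n \<in> u n" by metis
  have "xs n \<in> t \<union> (\<Union>k<N. u k)" for n using N[of n] u(2)[of n] by (cases "n < N") auto
  then show "\<exists>\<C>'\<subseteq>\<C>. finite \<C>' \<and> insert x (range xs) \<subseteq> \<Union>\<C>'"
    using t u(1) by (intro exI[of _ "insert t (u ` {..<N})"]) auto
qed

text \<open>On the compact set \<open>insert x (range xs) \<times> K\<close> the integrand is uniformly continuous, so the
  parameter can be frozen at its limit.\<close>

lemma parametric_integral_tendsto:
  fixes \<phi> :: "'x::metric_space \<times> 'a::metric_space \<Rightarrow> real"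
  assumes \<phi>: "continuous_on UNIV \<phi>" "\<And>z. \<bar>\<phi> z\<bar> \<le> B" and K: "compact K"
    and \<mu>n: "\<And>n. \<mu>s n \<in> probs_on K" and lim: "weakly_tendsto \<mu>s \<mu>" and x: "xs \<longlonglongrightarrow> x"
  shows "(\<lambda>n. \<integral>a. \<phi> (xs n, a) \<partial>\<mu>s n) \<longlonglongrightarrow> (\<integral>a. \<phi> (x, a) \<partial>\<mu>)"
proof -
  have c1: "continuous_on UNIV (\<lambda>a. \<phi> (x, a))" for x
    by (rule continuous_on_compose2[OF \<phi>(1)]) (auto intro!: continuous_intros)
  have m1: "(\<lambda>a. \<phi> (x, a)) \<in> borel_measurable borel" for x
    using c1 by (rule borel_measurable_continuous_onI)
  have b1: "bounded (range (\<lambda>a. \<phi> (x, a)))" for x unfolding bounded_iff using \<phi>(2) by auto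
  have \<mu>b: "\<mu>s n \<in> borel_probs" for n using \<mu>n probs_on_borel_probs by blast
  note i1 = bounded_borel_integrable[OF \<mu>b m1 b1]
  have clK: "K \<in> sets borel" using compact_imp_closed[OF K] by simp
  have fixed: "(\<lambda>n. \<integral>a. \<phi> (x, a) \<partial>\<mu>s n) \<longlonglongrightarrow> (\<integral>a. \<phi> (x, a) \<partial>\<mu>)"
    using lim c1 b1 unfolding weakly_tendsto_def by blast
  define S where "S = insert x (range xs) \<times> K"
  have "compact S" unfolding S_def by (intro compact_Times compact_convergent_sequence[OF x] K)
  then have uc: "uniformly_continuous_on S \<phi>"
    using \<phi>(1) by (intro compact_uniformly_continuous) (auto intro: continuous_on_subset)
  have diff: "(\<lambda>n. (\<integral>a. \<phi> (xs n, a) \<partial>\<mu>s n) - (\<integral>a. \<phi> (x, a) \<partial>\<mu>s n)) \<longlonglongrightarrow> 0"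
  proof (rule LIMSEQ_I)
    fix e :: real assume "e > 0"
    then have "e / 2 > 0" by simp
    then obtain d where d: "d > 0" "\<And>z z'. z \<in> S \<Longrightarrow> z' \<in> S \<Longrightarrow> dist z' z < d \<Longrightarrow> dist (\<phi> z') (\<phi> z) < e / 2"
      using uc unfolding uniformly_continuous_on_def by blast
    have "\<forall>\<^sub>F n in sequentially. dist (xs n) x < d" using x d(1) tendstoD by blast
    then obtain N where N: "\<And>n. n \<ge> N \<Longrightarrow> dist (xs n) x < d" unfolding eventually_sequentially by blast
    show "\<exists>N. \<forall>n\<ge>N. norm ((\<integral>a. \<phi> (xs n, a) \<partial>\<mu>s n) - (\<integral>a. \<phi> (x, a) \<partial>\<mu>s n) - 0) < e"
    proof (intro exI[of _ N] allI impI)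
      fix n assume n: "n \<ge> N"
      interpret prob_space "\<mu>s n" using borel_probsD[OF \<mu>b] by simp
      have near: "\<bar>\<phi> (xs n, a) - \<phi> (x, a)\<bar> \<le> e / 2" if "a \<in> K" for a
      proof -
        have "dist (xs n, a) (x, a) < d" using N[OF n] by (simp add: dist_prod_def)
        then show ?thesis using d(2)[of "(x, a)" "(xs n, a)"] that by (simp add: S_def dist_real_def)
      qed
      have "AE a in \<mu>s n. \<bar>\<phi> (xs n, a) - \<phi> (x, a)\<bar> \<le> e / 2"
        using \<mu>n[of n] near unfolding probs_on_AE[OF clK] by (auto elim: eventually_mono)
      from integral_dist_le[OF i1 i1 this]
      have "\<bar>(\<integral>a. \<phi> (xs n, a) \<partial>\<mu>s n) - (\<integral>a. \<phi> (x, a) \<partial>\<mu>s n)\<bar> \<le> e / 2" .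
      then show "norm ((\<integral>a. \<phi> (xs n, a) \<partial>\<mu>s n) - (\<integral>a. \<phi> (x, a) \<partial>\<mu>s n) - 0) < e" using \<open>e > 0\<close> by simp
    qed
  qed
  show ?thesis using tendsto_add[OF diff fixed] by simp
qed

context feller_kernel
begin

text \<open>A continuous test function is uniformly continuous on the bounded range of \<open>g\<close>, hence its
  composition with \<open>g\<close> is uniformly continuous as well.\<close>

lemma cost_law_weakly_tendsto:
  assumes uc: "uniformly_continuous_on UNIV g" and m: "\<And>z. \<bar>g z\<bar> \<le> m" and K: "compact K"
    and \<mu>n: "\<And>n. \<mu>s n \<in> probs_on K" and \<mu>: "\<mu> \<in> borel_probs"
    and lim: "weakly_tendsto \<mu>s \<mu>" and x: "xs \<longlonglongrightarrow> x"
  shows "weakly_tendsto (\<lambda>n. cost_law p g (xs n) (\<mu>s n)) (cost_law p g x \<mu>)"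
  unfolding weakly_tendsto_def
proof (intro allI impI)
  fix h :: "real \<Rightarrow> real" assume h: "continuous_on UNIV h" "bounded (range h)"
  have \<mu>b: "\<mu>s n \<in> borel_probs" for n using \<mu>n probs_on_borel_probs by blast
  have g: "g \<in> borel_measurable borel"
    using uniformly_continuous_imp_continuous[OF uc] by (rule borel_measurable_continuous_onI)
  have hm: "h \<in> borel_measurable borel" using h(1) by (rule borel_measurable_continuous_onI)
  obtain B where B: "\<And>r. \<bar>h r\<bar> \<le> B" using h(2) by (auto simp: bounded_iff)
  have "uniformly_continuous_on {-m..m} h"
    using h(1) by (intro compact_uniformly_continuous) (auto intro: continuous_on_subset)
  moreover have "g ` UNIV \<subseteq> {-m..m}" using m by (auto simp: abs_le_iff minus_le_iff)
  ultimately have "uniformly_continuous_on (g ` UNIV) h"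
    unfolding uniformly_continuous_on_def by (meson subsetD)
  from uniformly_continuous_on_compose[OF uc this]
  have uch: "uniformly_continuous_on UNIV (\<lambda>z. h (g z))" .
  define \<phi> where "\<phi> = (\<lambda>(x, a). \<integral>y. h (g (x, a, y)) \<partial>p x a)"
  have c\<phi>: "continuous_on UNIV \<phi>" unfolding \<phi>_def using inner_integral_continuous[OF uch] B by blast
  have "\<bar>\<phi> z\<bar> \<le> B" for z
  proof -
    obtain x a where z: "z = (x, a)" by (cases z)
    interpret prob_space "p x a" using borel_probsD[OF p_prob] by simp
    have "(\<lambda>y. h (g (x, a, y))) \<in> borel_measurable borel" using g hm by measurable
    then have "(\<lambda>y. h (g (x, a, y))) \<in> borel_measurable (p x a)" by (simp add: borel_probs_measurable[OF p_prob])
    from abs_integral_le[OF this, of B] show ?thesis unfolding \<phi>_def z using B by simp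
  qed
  from parametric_integral_tendsto[OF c\<phi> this K \<mu>n lim x]
  show "(\<lambda>n. \<integral>r. h r \<partial>cost_law p g (xs n) (\<mu>s n)) \<longlonglongrightarrow> (\<integral>r. h r \<partial>cost_law p g x \<mu>)"
    unfolding \<phi>_def integral_cost_law[OF g \<mu>b hm B] integral_cost_law[OF g \<mu> hm B] by simp
qed

lemma cost_law_pointwise_limit:
  assumes gk: "\<And>k. gk k \<in> borel_measurable borel" and g: "g \<in> borel_measurable borel"
    and lim: "\<And>z. (\<lambda>k. gk k z) \<longlonglongrightarrow> g z" and \<mu>: "\<mu> \<in> borel_probs"
  shows "weakly_tendsto (\<lambda>k. cost_law p (gk k) x \<mu>) (cost_law p g x \<mu>)"
  unfolding weakly_tendsto_def
proof (intro allI impI)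
  fix h :: "real \<Rightarrow> real" assume h: "continuous_on UNIV h" "bounded (range h)"
  have hm [measurable]: "h \<in> borel_measurable borel" using h(1) by (rule borel_measurable_continuous_onI)
  obtain B where B: "\<And>r. \<bar>h r\<bar> \<le> B" using h(2) by (auto simp: bounded_iff)
  have hlim: "(\<lambda>k. h (gk k z)) \<longlonglongrightarrow> h (g z)" for z
    using h(1) lim by (intro continuous_on_tendsto_compose[OF h(1)]) auto
  have ym: "(\<lambda>y. h (g (x, a, y))) \<in> borel_measurable (p x a)" if "g \<in> borel_measurable borel" for a g
  proof -
    have "(\<lambda>y. h (g (x, a, y))) \<in> borel_measurable borel" using that by measurable
    then show ?thesis by (simp add: borel_probs_measurable[OF p_prob])
  qed
  have am: "(\<lambda>a. \<integral>y. h (g (x, a, y)) \<partial>p x a) \<in> borel_measurable \<mu>" if "g \<in> borel_measurable borel" for g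
  proof -
    have [measurable]: "g \<in> borel \<Otimes>\<^sub>M borel \<Otimes>\<^sub>M borel \<rightarrow>\<^sub>M borel" using that by (simp add: borel_prod)
    have "(\<lambda>z. h (g (x, fst z, snd z))) \<in> borel_measurable (borel \<Otimes>\<^sub>M borel)" by measurable
    then have "(\<lambda>z. h (g (x, fst z, snd z))) \<in> borel_measurable borel" by (simp add: borel_prod)
    from inner_integral_measurable[OF this, of x] show ?thesis by (simp add: borel_probs_measurable[OF \<mu>])
  qed
  interpret \<mu>: prob_space \<mu> using borel_probsD[OF \<mu>] by simp
  have in1: "(\<lambda>k. \<integral>y. h (gk k (x, a, y)) \<partial>p x a) \<longlonglongrightarrow> (\<integral>y. h (g (x, a, y)) \<partial>p x a)" for a
  proof -
    interpret prob_space "p x a" using borel_probsD[OF p_prob] by simp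
    show ?thesis using ym[OF gk] ym[OF g] hlim B
      by (intro integral_dominated_convergence[where w="\<lambda>_. B"]) auto
  qed
  have bd: "\<bar>\<integral>y. h (gk k (x, a, y)) \<partial>p x a\<bar> \<le> B" for k a
  proof -
    interpret prob_space "p x a" using borel_probsD[OF p_prob] by simp
    show ?thesis using ym[OF gk] B by (intro abs_integral_le) auto
  qed
  have "(\<lambda>k. \<integral>a. \<integral>y. h (gk k (x, a, y)) \<partial>p x a \<partial>\<mu>) \<longlonglongrightarrow> (\<integral>a. \<integral>y. h (g (x, a, y)) \<partial>p x a \<partial>\<mu>)"
    using am[OF gk] am[OF g] in1 bd
    by (intro integral_dominated_convergence[where w="\<lambda>_. B"]) auto
  then show "(\<lambda>k. \<integral>r. h r \<partial>cost_law p (gk k) x \<mu>) \<longlonglongrightarrow> (\<integral>r. h r \<partial>cost_law p g x \<mu>)"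
    by (simp add: integral_cost_law[OF gk \<mu> hm B] integral_cost_law[OF g \<mu> hm B])
qed

end

section \<open>Law-invariant convex risk measures\<close>

lemma probs_on_bounded_probs: "\<mu> \<in> probs_on {-m..m::real} \<Longrightarrow> \<mu> \<in> bounded_probs"
  unfolding bounded_probs_def using closed_atLeastAtMost bounded_closed_interval by blast

lemma convex_risk_measure_mono:
  assumes "convex_risk_measure \<rho>" "\<mu> \<in> probs_on {-m..m}" "\<nu> \<in> probs_on {-m'..m'}"
    and "\<And>r. measure \<nu> {..r} \<le> measure \<mu> {..r}"
  shows "\<rho> \<mu> \<le> \<rho> \<nu>"
  using assms probs_on_bounded_probs unfolding convex_risk_measure_def by blast

lemma return_zero_convolution: "return borel 0 \<star> return borel c = return borel (c::real)"
proof (rule measure_eqI)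
  fix A assume "A \<in> sets (return borel 0 \<star> return borel c)"
  then have A: "A \<in> sets borel" by simp
  have "{a. a + x \<in> A} \<in> sets borel" for x
  proof -
    have "(\<lambda>a. a + x) -` A \<inter> space borel \<in> sets borel" using A by (intro measurable_sets[of _ _ borel]) auto
    then show ?thesis by (simp add: vimage_def)
  qed
  then have e: "emeasure (return borel c) {a. a + x \<in> A} = indicator A (c + x)" for x
    by (simp add: indicator_def)
  have "emeasure (return borel 0 \<star> return borel c) A = (\<integral>\<^sup>+x. emeasure (return borel c) {a. a + x \<in> A} \<partial>return borel 0)"
    using A by (intro convolution_emeasure prob_space.finite_measure prob_space_return) auto
  also have "\<dots> = (\<integral>\<^sup>+x. indicator A (c + x) \<partial>return borel 0)" unfolding e ..
  also have "\<dots> = indicator A (c + 0)" using A by (intro nn_integral_return) auto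
  finally show "emeasure (return borel 0 \<star> return borel c) A = emeasure (return borel c) A" using A by simp
qed simp

text \<open>Compare \<open>\<mu>\<close> with the point masses at \<open>-m\<close> and \<open>m\<close>. The bound justifies the conversions
  between real numbers and extended reals below.\<close>

lemma convex_risk_measure_bound:
  assumes \<rho>: "convex_risk_measure \<rho>" and \<beta>: "\<bar>\<rho> (return borel 0)\<bar> \<le> ereal \<beta>" and \<mu>: "\<mu> \<in> probs_on {-m..m}"
  shows "\<bar>\<rho> \<mu>\<bar> \<le> ereal (\<beta> + m)"
proof -
  have \<mu>b: "\<mu> \<in> borel_probs" "AE x in \<mu>. x \<in> {-m..m}" using \<mu> probs_on_AE[of "{-m..m}"] by auto
  interpret prob_space \<mu> using borel_probsD[OF \<mu>b(1)] by simp
  have m: "0 \<le> m"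
  proof (rule ccontr)
    assume "\<not> 0 \<le> m"
    then have "AE x in \<mu>. False" using \<mu>b(2) by simp
    then show False by simp
  qed
  have b: "\<rho> (return borel c) = \<rho> (return borel 0) + ereal c" for c
  proof -
    have "return borel (0::real) \<in> bounded_probs"
      by (rule probs_on_bounded_probs[of _ 0], rule return_probs_on) auto
    then show ?thesis using \<rho> return_zero_convolution[of c] unfolding convex_risk_measure_def by metis
  qed
  have ret: "return borel c \<in> probs_on {-m..m}" if "\<bar>c\<bar> \<le> m" for c :: real
    using that by (intro return_probs_on) auto
  have s: "{..r} \<in> sets \<mu>" for r using borel_probsD(2)[OF \<mu>b(1)] by simp
  have "\<rho> \<mu> \<le> \<rho> (return borel m)"
  proof (rule convex_risk_measure_mono[OF \<rho> \<mu> ret])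
    fix r show "measure (return borel m) {..r} \<le> measure \<mu> {..r}"
    proof (cases "m \<le> r")
      case True
      then have "AE x in \<mu>. x \<in> {..r}" using \<mu>b(2) by (auto elim: eventually_mono)
      then have "measure \<mu> {..r} = 1" using prob_eq_1[OF s] by simp
      then show ?thesis using True by (simp add: measure_return)
    qed (simp add: measure_return)
  qed (use m in simp)
  moreover have "\<rho> (return borel (-m)) \<le> \<rho> \<mu>"
  proof (rule convex_risk_measure_mono[OF \<rho> ret \<mu>])
    fix r show "measure \<mu> {..r} \<le> measure (return borel (-m)) {..r}"
    proof (cases "-m \<le> r")
      case False
      then have "AE x in \<mu>. x \<notin> {..r}" using \<mu>b(2) by (auto elim: eventually_mono)
      then have "measure \<mu> {..r} = 0" using prob_eq_0[OF s] by simp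
      then show ?thesis by simp
    qed (simp add: measure_return)
  qed (use m in simp)
  ultimately have "\<rho> (return borel 0) - ereal m \<le> \<rho> \<mu>" "\<rho> \<mu> \<le> \<rho> (return borel 0) + ereal m"
    unfolding b[of m] b[of "- m"] by (simp_all add: minus_ereal_def)
  then show ?thesis using \<beta>
    by (cases "\<rho> (return borel 0)"; cases "\<rho> \<mu>") (auto simp: abs_le_iff)
qed

section \<open>One step of dynamic programming\<close>

lemma upper_hemicontinuous_closed_graph:
  fixes \<Phi> :: "'x::metric_space \<Rightarrow> 'a::metric_space set"
  assumes uhc: "upper_hemicontinuous \<Phi>" and cl: "\<And>x. closed (\<Phi> x)"
  shows "closed {z. snd z \<in> \<Phi> (fst z)}"
proof -
  have "open (- {z. snd z \<in> \<Phi> (fst z)})"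
  proof (subst open_subopen, intro ballI)
    fix z assume "z \<in> - {z. snd z \<in> \<Phi> (fst z)}"
    then have z: "snd z \<notin> \<Phi> (fst z)" by simp
    have "open (- \<Phi> (fst z))" using cl by (simp add: open_Compl)
    then obtain e where e: "e > 0" "cball (snd z) e \<subseteq> - \<Phi> (fst z)"
      using z open_contains_cball by (metis ComplI)
    have "open (- cball (snd z) e)" "\<Phi> (fst z) \<subseteq> - cball (snd z) e" using e(2) by auto
    then obtain W where W: "open W" "fst z \<in> W" "\<And>x. x \<in> W \<Longrightarrow> \<Phi> x \<subseteq> - cball (snd z) e"
      using uhc unfolding upper_hemicontinuous_def by meson
    show "\<exists>T. open T \<and> z \<in> T \<and> T \<subseteq> - {z. snd z \<in> \<Phi> (fst z)}"
    proof (intro exI[of _ "W \<times> ball (snd z) e"] conjI)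
      show "open (W \<times> ball (snd z) e)" using W(1) by (intro open_Times) auto
      show "z \<in> W \<times> ball (snd z) e" using W(2) e(1) by (cases z) auto
      show "W \<times> ball (snd z) e \<subseteq> - {z. snd z \<in> \<Phi> (fst z)}" using W(3) ball_subset_cball by fastforce
    qed
  qed
  then show ?thesis by (simp add: closed_def)
qed

context feller_kernel
begin

text \<open>The one-step problem of minimising \<open>\<rho> x (cost_law p g x \<mu>)\<close> over the laws \<open>\<mu>\<close> on \<open>\<A> x\<close>.
  Its objective is jointly lower semicontinuous: for Lipschitz costs this is the semicontinuity of
  \<open>\<rho>\<close> along the weakly convergent cost laws, and a lower semicontinuous \<open>g\<close> is reached by increasing
  Lipschitz approximations, using monotonicity of \<open>\<rho>\<close> from below and its semicontinuity, now at
  a fixed state, in the limit. After coding the laws on the compact action space by real numbers,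
  \<open>measurable_minimizer\<close> gives the value and an optimal randomised decision rule.\<close>

proposition bellman_step:
  fixes \<rho> :: "'x \<Rightarrow> real measure \<Rightarrow> ereal" and \<A> :: "'x \<Rightarrow> 'a set" and g :: "'x \<times> 'a \<times> 'x \<Rightarrow> real"
  assumes \<rho>: "\<And>x. convex_risk_measure (\<rho> x)" "\<And>x. \<bar>\<rho> x (return borel 0)\<bar> \<le> ereal \<beta>"
    and \<rho>_lsc: "\<And>K \<mu>s \<mu> xs x. compact K \<Longrightarrow> (\<And>n. \<mu>s n \<in> probs_on K) \<Longrightarrow> \<mu> \<in> probs_on K \<Longrightarrow>
          limitin weak_topology \<mu>s \<mu> sequentially \<Longrightarrow> xs \<longlonglongrightarrow> x \<Longrightarrow>
          \<rho> x \<mu> \<le> liminf (\<lambda>n. \<rho> (xs n) (\<mu>s n))"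
    and \<A>: "\<And>x. \<A> x \<noteq> {}" "\<And>x. closed (\<A> x)" "compact (\<Union>x. \<A> x)" "upper_hemicontinuous \<A>"
    and g: "lower_semicontinuous g" "\<And>z. \<bar>g z\<bar> \<le> m"
  obtains v \<pi> where "lower_semicontinuous v" "\<And>x. \<bar>v x\<bar> \<le> \<beta> + m"
    "\<pi> \<in> borel \<rightarrow>\<^sub>M prob_algebra borel" "\<pi> \<in> borel \<rightarrow>\<^sub>M borel_of weak_topology"
    "\<And>x. \<pi> x \<in> probs_on (\<A> x)" "\<And>x. \<rho> x (cost_law p g x (\<pi> x)) = ereal (v x)"
    "\<And>x \<mu>. \<mu> \<in> probs_on (\<A> x) \<Longrightarrow> ereal (v x) \<le> \<rho> x (cost_law p g x \<mu>)"
proof -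
  define K where "K = (\<Union>x. \<A> x)"
  have K: "compact K" "K \<noteq> {}" using \<A> unfolding K_def by auto
  have clK: "closed K" using compact_imp_closed[OF K(1)] .
  have gm: "g \<in> borel_measurable borel" using lower_semicontinuous_borel[OF g(1)] .
  have AK: "probs_on (\<A> x) \<subseteq> probs_on K" for x
  proof
    fix \<mu> assume "\<mu> \<in> probs_on (\<A> x)"
    then show "\<mu> \<in> probs_on K" by (rule probs_on_mono) (use \<A>(2) clK in \<open>auto simp: K_def\<close>)
  qed
  obtain C :: "real set" and \<Lambda> :: "real \<Rightarrow> 'a measure"
    where C: "compact C" "\<Lambda> ` C = probs_on K"
    and \<Lambda>: "\<And>cs c. (\<And>n. cs n \<in> C) \<Longrightarrow> c \<in> C \<Longrightarrow> cs \<longlonglongrightarrow> c \<Longrightarrow> weakly_tendsto (\<lambda>n. \<Lambda> (cs n)) (\<Lambda> c)"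
    by (rule probs_on_compact_coding[OF K]) blast
  have clC: "closed C" using compact_imp_closed[OF C(1)] .
  have \<Lambda>K: "\<Lambda> c \<in> probs_on K" if "c \<in> C" for c using C(2) that by blast
  have \<Lambda>b: "\<Lambda> c \<in> borel_probs" if "c \<in> C" for c using \<Lambda>K[OF that] probs_on_borel_probs by blast
  define \<Gamma> where "\<Gamma> x = {c \<in> C. \<Lambda> c \<in> probs_on (\<A> x)}" for x
  define J where "J x c = real_of_ereal (\<rho> x (cost_law p g x (\<Lambda> c)))" for x c
  have law_m: "cost_law p g x \<mu> \<in> probs_on {-m..m}" if "\<mu> \<in> borel_probs" for x \<mu>
    using cost_law_bounded[OF gm g(2) that] .
  have \<rho>_bd: "\<bar>\<rho> x (cost_law p g x \<mu>)\<bar> \<le> ereal (\<beta> + m)" if "\<mu> \<in> borel_probs" for x \<mu>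
    using convex_risk_measure_bound[OF \<rho>(1,2) law_m[OF that]] .
  have J: "\<rho> x (cost_law p g x (\<Lambda> c)) = ereal (J x c)" "\<bar>J x c\<bar> \<le> \<beta> + m" if "c \<in> C" for x c
    using \<rho>_bd[OF \<Lambda>b[OF that], of x] unfolding J_def
    by (cases "\<rho> x (cost_law p g x (\<Lambda> c))"; simp)+
  obtain h :: "nat \<Rightarrow> 'x \<times> 'a \<times> 'x \<Rightarrow> real" where h: "\<And>k. (real k)-lipschitz_on UNIV (h k)"
    "\<And>k z. h k z \<le> g z" "\<And>k z. \<bar>h k z\<bar> \<le> m" "\<And>z. (\<lambda>k. h k z) \<longlonglongrightarrow> g z"
    by (rule lower_semicontinuous_lipschitz_approximation[OF g]) blast
  have hu: "uniformly_continuous_on UNIV (h k)" for k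
    using h(1) by (rule lipschitz_on_uniformly_continuous)
  have hm: "h k \<in> borel_measurable borel" for k
    using uniformly_continuous_imp_continuous[OF hu] by (rule borel_measurable_continuous_onI)
  have feasible: "c \<in> \<Gamma> x" if x: "xs \<longlonglongrightarrow> x" and c: "cs \<longlonglongrightarrow> c" and cn: "\<And>n. cs n \<in> \<Gamma> (xs n)" for xs x cs c
  proof -
    have cnC: "cs n \<in> C" for n using cn[of n] unfolding \<Gamma>_def by simp
    have cC: "c \<in> C" by (rule closed_sequentially[OF clC _ c]) (rule cnC)
    have wt: "weakly_tendsto (\<lambda>n. \<Lambda> (cs n)) (\<Lambda> c)" by (rule \<Lambda>[OF cnC cC c])
    have "\<Lambda> c \<in> probs_on (\<A> x)"
    proof (rule weakly_tendsto_closed_support[OF wt \<Lambda>b[OF cnC] \<Lambda>b[OF cC] \<A>(2,1)])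
      fix e :: real assume e: "e > 0"
      \<comment> \<open>upper hemicontinuity puts the action sets of nearby states into this neighbourhood\<close>
      define V where "V = {a. infdist a (\<A> x) < e}"
      have "open V" unfolding V_def by (intro open_Collect_less continuous_intros)
      moreover have "\<A> x \<subseteq> V" using e unfolding V_def by auto
      ultimately obtain W where W: "open W" "x \<in> W" "\<And>z. z \<in> W \<Longrightarrow> \<A> z \<subseteq> V"
        using \<A>(4) unfolding upper_hemicontinuous_def by meson
      have "\<forall>\<^sub>F n in sequentially. xs n \<in> W" using topological_tendstoD[OF x W(1,2)] .
      then show "\<forall>\<^sub>F n in sequentially. AE a in \<Lambda> (cs n). infdist a (\<A> x) \<le> e"
      proof (rule eventually_mono)
        fix n assume n: "xs n \<in> W"
        have "AE a in \<Lambda> (cs n). a \<in> \<A> (xs n)"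
          using cn[of n] probs_on_AE[OF borel_closed[OF \<A>(2)]] unfolding \<Gamma>_def by blast
        then show "AE a in \<Lambda> (cs n). infdist a (\<A> x) \<le> e"
        proof (rule eventually_mono)
          fix a assume "a \<in> \<A> (xs n)"
          then have "a \<in> V" using W(3)[OF n] by blast
          then show "infdist a (\<A> x) \<le> e" unfolding V_def by simp
        qed
      qed
    qed
    then show ?thesis using cC unfolding \<Gamma>_def by simp
  qed
  have J_lsc: "J x c \<le> r"
    if x: "xs \<longlonglongrightarrow> x" and c: "cs \<longlonglongrightarrow> c" and cn: "\<And>n. cs n \<in> \<Gamma> (xs n)" and r: "\<And>n. J (xs n) (cs n) \<le> r"
    for xs x cs c r
  proof -
    have cnC: "cs n \<in> C" for n using cn[of n] unfolding \<Gamma>_def by simp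
    have cC: "c \<in> C" by (rule closed_sequentially[OF clC _ c]) (rule cnC)
    have wt: "weakly_tendsto (\<lambda>n. \<Lambda> (cs n)) (\<Lambda> c)" by (rule \<Lambda>[OF cnC cC c])
    \<comment> \<open>for fixed \<open>k\<close> let \<open>n\<close> tend to infinity; as \<open>h k \<le> g\<close>, the bound \<open>r\<close> is inherited\<close>
    have hbound: "\<rho> x (cost_law p (h k) x (\<Lambda> c)) \<le> ereal r" for k
    proof -
      have "\<rho> x (cost_law p (h k) x (\<Lambda> c)) \<le> liminf (\<lambda>n. \<rho> (xs n) (cost_law p (h k) (xs n) (\<Lambda> (cs n))))"
      proof (rule \<rho>_lsc[OF compact_Icc[of "-m" m] _ _ _ x])
        show "cost_law p (h k) (xs n) (\<Lambda> (cs n)) \<in> probs_on {-m..m}" for n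
          by (rule cost_law_bounded[OF hm h(3) \<Lambda>b[OF cnC]])
        show "cost_law p (h k) x (\<Lambda> c) \<in> probs_on {-m..m}"
          by (rule cost_law_bounded[OF hm h(3) \<Lambda>b[OF cC]])
        show "limitin weak_topology (\<lambda>n. cost_law p (h k) (xs n) (\<Lambda> (cs n))) (cost_law p (h k) x (\<Lambda> c)) sequentially"
          by (rule limitin_weak_topology[OF cost_law_weakly_tendsto[OF hu h(3) K(1) \<Lambda>K[OF cnC] \<Lambda>b[OF cC] wt x]
              cost_law_borel_probs[OF hm \<Lambda>b[OF cnC]] cost_law_borel_probs[OF hm \<Lambda>b[OF cC]]])
      qed
      also have "\<dots> \<le> ereal r"
      proof (intro Liminf_le always_eventually allI)
        fix n
        have "\<rho> (xs n) (cost_law p (h k) (xs n) (\<Lambda> (cs n))) \<le> \<rho> (xs n) (cost_law p g (xs n) (\<Lambda> (cs n)))"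
          by (rule convex_risk_measure_mono[OF \<rho>(1) cost_law_bounded[OF hm h(3) \<Lambda>b[OF cnC]] law_m[OF \<Lambda>b[OF cnC]]])
            (rule cost_law_cdf_mono[OF gm hm h(2) \<Lambda>b[OF cnC]])
        also have "\<dots> \<le> ereal r" using r[of n] J(1)[OF cnC] by simp
        finally show "\<rho> (xs n) (cost_law p (h k) (xs n) (\<Lambda> (cs n))) \<le> ereal r" .
      qed simp
      finally show ?thesis .
    qed
    have "\<rho> x (cost_law p g x (\<Lambda> c)) \<le> liminf (\<lambda>k. \<rho> x (cost_law p (h k) x (\<Lambda> c)))"
    proof (rule \<rho>_lsc[OF compact_Icc[of "-m" m] _ law_m[OF \<Lambda>b[OF cC]] _ tendsto_const])
      show "cost_law p (h k) x (\<Lambda> c) \<in> probs_on {-m..m}" for k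
        by (rule cost_law_bounded[OF hm h(3) \<Lambda>b[OF cC]])
      show "limitin weak_topology (\<lambda>k. cost_law p (h k) x (\<Lambda> c)) (cost_law p g x (\<Lambda> c)) sequentially"
        by (rule limitin_weak_topology[OF cost_law_pointwise_limit[OF hm gm h(4) \<Lambda>b[OF cC]]
              cost_law_borel_probs[OF hm \<Lambda>b[OF cC]] cost_law_borel_probs[OF gm \<Lambda>b[OF cC]]])
    qed
    also have "\<dots> \<le> ereal r" by (rule Liminf_le) (use hbound in simp_all)
    finally show ?thesis using J(1)[OF cC] by simp
  qed
  have ne: "\<Gamma> x \<noteq> {}" for x
  proof -
    obtain a where "a \<in> \<A> x" using \<A>(1) by blast
    then have ra: "return borel a \<in> probs_on (\<A> x)" using \<A>(2) by (intro return_probs_on) auto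
    then have "return borel a \<in> \<Lambda> ` C" unfolding C(2) using AK by blast
    then obtain c where c: "c \<in> C" "return borel a = \<Lambda> c" by blast
    then have "c \<in> \<Gamma> x" using ra unfolding \<Gamma>_def by simp
    then show ?thesis by blast
  qed
  obtain v s where vs: "lower_semicontinuous v" "\<And>x. \<bar>v x\<bar> \<le> \<beta> + m" "s \<in> borel_measurable borel"
    "\<And>x. s x \<in> \<Gamma> x" "\<And>x. J x (s x) = v x" "\<And>x c. c \<in> \<Gamma> x \<Longrightarrow> v x \<le> J x c"
  proof (rule measurable_minimizer[of C \<Gamma> J "\<beta> + m"])
    show "compact C" by (rule C(1))
    show "\<Gamma> x \<subseteq> C" for x unfolding \<Gamma>_def by blast
    show "\<bar>J x c\<bar> \<le> \<beta> + m" if "c \<in> \<Gamma> x" for x c using J(2) that unfolding \<Gamma>_def by blast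
    show "\<Gamma> x \<noteq> {}" for x by (rule ne)
    show "c \<in> \<Gamma> x" if "xs \<longlonglongrightarrow> x" "cs \<longlonglongrightarrow> c" "\<And>n. cs n \<in> \<Gamma> (xs n)" for xs x cs c
      using that by (rule feasible)
    show "J x c \<le> r" if "xs \<longlonglongrightarrow> x" "cs \<longlonglongrightarrow> c" "\<And>n. cs n \<in> \<Gamma> (xs n)" "\<And>n. J (xs n) (cs n) \<le> r"
      for xs x cs c r
      using that by (rule J_lsc)
  qed (rule that; assumption)
  have sC: "s x \<in> C" "\<Lambda> (s x) \<in> probs_on (\<A> x)" for x using vs(4)[of x] unfolding \<Gamma>_def by auto
  define \<pi> where "\<pi> x = \<Lambda> (s x)" for x
  have "\<pi> \<in> borel \<rightarrow>\<^sub>M prob_algebra borel"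
    unfolding \<pi>_def by (rule weakly_continuous_code_measurable[OF vs(3) sC(1) clC \<Lambda>b \<Lambda>])
  moreover have "\<pi> \<in> borel \<rightarrow>\<^sub>M borel_of weak_topology"
  proof (rule measurable_borel_of)
    show "\<pi> \<in> space borel \<rightarrow> topspace weak_topology"
      using \<Lambda>b sC(1) unfolding \<pi>_def by (auto simp: topspace_weak_topology)
    fix O' :: "'a measure set" assume O': "openin weak_topology O'"
    have "{c \<in> C. \<Lambda> c \<in> O'} \<in> sets borel"
      by (rule continuous_map_borel_preimage[OF continuous_map_weak_topology[OF \<Lambda>b \<Lambda>] borel_closed[OF clC] O'])
    from measurable_sets[OF vs(3) this]
    have "s -` {c \<in> C. \<Lambda> c \<in> O'} \<in> sets borel" by simp
    moreover have "\<pi> -` O' \<inter> space borel = s -` {c \<in> C. \<Lambda> c \<in> O'}" using sC(1) unfolding \<pi>_def by auto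
    ultimately show "\<pi> -` O' \<inter> space borel \<in> sets borel" by simp
  qed
  moreover have "\<pi> x \<in> probs_on (\<A> x)" for x unfolding \<pi>_def by (rule sC(2))
  moreover have "\<rho> x (cost_law p g x (\<pi> x)) = ereal (v x)" for x
    unfolding \<pi>_def J(1)[OF sC(1)] vs(5) ..
  moreover have "ereal (v x) \<le> \<rho> x (cost_law p g x \<mu>)" if \<mu>: "\<mu> \<in> probs_on (\<A> x)" for x \<mu>
  proof -
    have "\<mu> \<in> \<Lambda> ` C" unfolding C(2) using \<mu> AK by blast
    then obtain c where c: "c \<in> C" "\<mu> = \<Lambda> c" by blast
    then have "c \<in> \<Gamma> x" using \<mu> unfolding \<Gamma>_def by simp
    then show ?thesis using vs(6)[of c x] J(1)[OF c(1), of x] c(2) by simp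
  qed
  ultimately show ?thesis using that vs(1,2) by blast
qed

end

section \<open>Backward induction along a controlled process\<close>

text \<open>The standing assumptions together with the continuity and compactness hypotheses of the
  main theorem.\<close>

locale lower_semicontinuous_mdp = risk_averse_mdp M F G \<sigma>\<^sub>0 \<sigma> \<A> P \<xi> \<Psi> X\<^sub>p A\<^sub>p C
  for M :: "'w measure" and F G :: "nat \<Rightarrow> 'w measure"
    and \<sigma>\<^sub>0 :: "real measure \<Rightarrow> ereal"
    and \<sigma> :: "nat \<Rightarrow> 'x::polish_space \<Rightarrow> real measure \<Rightarrow> ereal"
    and \<A> :: "nat \<Rightarrow> 'x \<Rightarrow> 'a::polish_space set"
    and P :: "nat \<Rightarrow> 'x \<Rightarrow> 'a \<Rightarrow> 'x measure"
    and \<xi> :: "'x measure"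
    and \<Psi> :: "((nat \<Rightarrow> 'w \<Rightarrow> 'x) \<times> (nat \<Rightarrow> 'w \<Rightarrow> 'a)) set"
    and X\<^sub>p :: "(nat \<Rightarrow> 'x \<Rightarrow> 'a measure) \<Rightarrow> nat \<Rightarrow> 'w \<Rightarrow> 'x"
    and A\<^sub>p :: "(nat \<Rightarrow> 'x \<Rightarrow> 'a measure) \<Rightarrow> nat \<Rightarrow> 'w \<Rightarrow> 'a"
    and C :: "nat \<Rightarrow> 'x \<times> 'a \<times> 'x \<Rightarrow> real" +
  fixes \<gamma> b :: real and T :: nat
  assumes \<gamma>: "\<gamma> \<in> {0..1}" and T: "T \<ge> 1" and b: "b > 0"
    and kernel_weakly_continuous: "\<And>t xs x as a (f :: 'x \<Rightarrow> real). t \<ge> 1 \<Longrightarrow>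
          xs \<longlonglongrightarrow> x \<Longrightarrow> as \<longlonglongrightarrow> a \<Longrightarrow> continuous_on UNIV f \<Longrightarrow> bounded (range f) \<Longrightarrow>
          (\<lambda>n. \<integral>y. f y \<partial>P t (xs n) (as n)) \<longlonglongrightarrow> (\<integral>y. f y \<partial>P t x a)"
    and actions_compact: "\<And>t. t \<ge> 1 \<Longrightarrow> compact (\<Union>x. \<A> t x)"
    and actions_uhc: "\<And>t. t \<ge> 1 \<Longrightarrow> upper_hemicontinuous (\<A> t)"
    and risk_lsc: "\<And>t K \<mu>s \<mu> xs x. t \<ge> 1 \<Longrightarrow> compact K \<Longrightarrow>
          (\<And>n. \<mu>s n \<in> probs_on K) \<Longrightarrow> \<mu> \<in> probs_on K \<Longrightarrow>
          limitin weak_topology \<mu>s \<mu> sequentially \<Longrightarrow> xs \<longlonglongrightarrow> x \<Longrightarrow>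
          \<sigma> t x \<mu> \<le> liminf (\<lambda>n. \<sigma> t (xs n) (\<mu>s n))"
    and cost_lsc: "\<And>t. t \<ge> 1 \<Longrightarrow> lower_semicontinuous (C t)"
    and cost_bounded: "\<And>t z. t \<ge> 1 \<Longrightarrow> \<bar>C t z\<bar> \<le> b"
begin

lemma kernel_feller: "t \<ge> 1 \<Longrightarrow> feller_kernel (P t)"
proof (unfold_locales)
  assume t: "t \<ge> 1"
  show pp: "P t x a \<in> borel_probs" for x a using kernel_prob[OF t] .
  show "(\<lambda>(x, a). P t x a) \<in> borel \<Otimes>\<^sub>M borel \<rightarrow>\<^sub>M prob_algebra borel"
  proof (rule measurable_prob_algebraI)
    show "prob_space (case z of (x, a) \<Rightarrow> P t x a)" for z using borel_probsD(1)[OF pp] by (cases z) simp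
    show "(\<lambda>(x, a). P t x a) \<in> borel \<Otimes>\<^sub>M borel \<rightarrow>\<^sub>M subprob_algebra borel"
    proof (rule measurable_subprob_algebra)
      show "subprob_space (case z of (x, a) \<Rightarrow> P t x a)" for z
        using borel_probsD(1)[OF pp] by (cases z) (simp add: prob_space_imp_subprob_space)
      show "sets (case z of (x, a) \<Rightarrow> P t x a) = sets borel" for z
        using borel_probsD(2)[OF pp] by (cases z) simp
      fix B :: "'x set" assume "B \<in> sets borel"
      then have "(\<lambda>z. ennreal (case z of (x, a) \<Rightarrow> measure (P t x a) B)) \<in> borel_measurable (borel \<Otimes>\<^sub>M borel)"
        using kernel_measurable[OF t, of B] unfolding borel_prod by measurable
      moreover have "ennreal (case z of (x, a) \<Rightarrow> measure (P t x a) B) = emeasure (case z of (x, a) \<Rightarrow> P t x a) B" for z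
        using prob_space.finite_measure[OF borel_probsD(1)[OF pp]]
        by (cases z) (simp add: finite_measure.emeasure_eq_measure)
      ultimately show "(\<lambda>z. emeasure (case z of (x, a) \<Rightarrow> P t x a) B) \<in> borel_measurable (borel \<Otimes>\<^sub>M borel)" by simp
    qed
  qed
  show "weakly_tendsto (\<lambda>n. P t (xs n) (as n)) (P t x a)" if "xs \<longlonglongrightarrow> x" "as \<longlonglongrightarrow> a" for xs x as a
    unfolding weakly_tendsto_def using kernel_weakly_continuous[OF t that] by blast
qed

abbreviation "U \<equiv> joint_filt M F G"

lemma sets_joint_filt: "sets (U t) = sigma_sets (space M) (sets (G (t - 1)) \<union> sets (F t))"
  unfolding joint_filt_def
  using sets.space_closed[of "G (t - 1)"] sets.space_closed[of "F t"] F.space_F G.space_F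
  by (intro sets_measure_of) auto

lemma space_joint_filt: "space (U t) = space M"
  unfolding joint_filt_def
  using sets.space_closed[of "G (t - 1)"] sets.space_closed[of "F t"] F.space_F G.space_F
  by (intro space_measure_of) auto

lemma joint_filt_le_G: "sets (U t) \<subseteq> sets (G t)"
  unfolding sets_joint_filt G.space_F[of t, symmetric]
  using G.sets_F_mono[of "t - 1" t] F_sub_G[of t] by (intro sets.sigma_sets_subset) auto

lemma F_le_joint_filt: "sets (F t) \<subseteq> sets (U t)"
  unfolding sets_joint_filt by auto

lemma G_sub: "prob_subalgebra M (G t)"
  by unfold_locales (auto simp: subalgebra_def G.space_F G_sub_M[THEN subsetD])

lemma U_sub: "prob_subalgebra M (U t)"
  by unfold_locales (use joint_filt_le_G G_sub_M in \<open>auto simp: subalgebra_def space_joint_filt\<close>)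

lemma X_measurable:
  assumes "(X, A) \<in> \<Psi>" "t \<ge> 1"
  shows "X t \<in> U t \<rightarrow>\<^sub>M borel" "X t \<in> M \<rightarrow>\<^sub>M borel"
proof -
  have X: "X t \<in> F t \<rightarrow>\<^sub>M borel" using \<Psi>_controlled[OF assms(1)] assms(2) unfolding controlled_process_def by blast
  show XU: "X t \<in> U t \<rightarrow>\<^sub>M borel"
    by (rule measurable_from_subalg[OF _ X]) (use F_le_joint_filt in \<open>auto simp: subalgebra_def space_joint_filt F.space_F\<close>)
  show "X t \<in> M \<rightarrow>\<^sub>M borel" using prob_subalgebra.U_measurable[OF U_sub XU] .
qed

lemma A_measurable:
  assumes "(X, A) \<in> \<Psi>" "t \<ge> 1"
  shows "A t \<in> G t \<rightarrow>\<^sub>M borel" "A t \<in> M \<rightarrow>\<^sub>M borel"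
proof -
  show AG: "A t \<in> G t \<rightarrow>\<^sub>M borel" using \<Psi>_controlled[OF assms(1)] assms(2) unfolding controlled_process_def by blast
  show "A t \<in> M \<rightarrow>\<^sub>M borel" using prob_subalgebra.U_measurable[OF G_sub AG] .
qed

text \<open>The random variable \<open>\<varsigma>\<^sub>t\<close> evaluated at the current state. The value \<open>0\<close> beyond
  the horizon makes the last step an instance of the general recursion.\<close>

definition cost_to_go :: "(nat \<Rightarrow> 'w \<Rightarrow> 'x) \<Rightarrow> (nat \<Rightarrow> 'w \<Rightarrow> 'a) \<Rightarrow> nat \<Rightarrow> 'w \<Rightarrow> real" where
  "cost_to_go X A t \<omega> =
     (if t \<le> T then real_of_ereal (dyn_risk M F G \<sigma> \<gamma> T X (cost_process C X A) t (X t \<omega>) \<omega>) else 0)"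

definition tail_cost :: "(nat \<Rightarrow> 'w \<Rightarrow> 'x) \<Rightarrow> (nat \<Rightarrow> 'w \<Rightarrow> 'a) \<Rightarrow> nat \<Rightarrow> 'w \<Rightarrow> real" where
  "tail_cost X A t \<omega> = C t (X t \<omega>, A t \<omega>, X (Suc t) \<omega>) + \<gamma> * cost_to_go X A (Suc t) \<omega>"

lemma cost_to_go_step:
  assumes "t \<ge> 1" "t \<le> T"
  shows "cost_to_go X A t \<omega> = real_of_ereal (\<sigma> t (X t \<omega>) (reg_cond_distr M (U t) (tail_cost X A t) \<omega>))"
proof (cases "t < T")
  case True
  then have "tail_cost X A t = (\<lambda>\<omega>. cost_process C X A t \<omega> + \<gamma> * real_of_ereal
      (dyn_risk M F G \<sigma> \<gamma> T X (cost_process C X A) (t + 1) (X (t + 1) \<omega>) \<omega>))"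
    using assms by (auto simp: tail_cost_def cost_to_go_def cost_process_def fun_eq_iff)
  then show ?thesis using assms True by (simp add: cost_to_go_def dyn_risk.simps[of M F G \<sigma> \<gamma> T X _ t])
next
  case False
  then have "t = T" using assms by simp
  moreover have "tail_cost X A T = cost_process C X A T"
    using T by (auto simp: tail_cost_def cost_to_go_def cost_process_def fun_eq_iff)
  ultimately show ?thesis using assms by (simp add: cost_to_go_def dyn_risk.simps[of M F G \<sigma> \<gamma> T X _ T])
qed

lemma tail_cost_bounded:
  assumes "t \<ge> 1" "\<bar>cost_to_go X A (Suc t) \<omega>\<bar> \<le> m"
  shows "\<bar>tail_cost X A t \<omega>\<bar> \<le> b + m"
proof -
  have "\<bar>\<gamma> * cost_to_go X A (Suc t) \<omega>\<bar> \<le> 1 * m"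
    unfolding abs_mult using \<gamma> assms(2) by (intro mult_mono) auto
  then show ?thesis using cost_bounded[OF assms(1), of "(X t \<omega>, A t \<omega>, X (Suc t) \<omega>)"] unfolding tail_cost_def by linarith
qed

lemma tail_cost_measurable:
  assumes XA: "(X, A) \<in> \<Psi>" and t: "t \<ge> 1" and c: "cost_to_go X A (Suc t) \<in> borel_measurable M"
  shows "tail_cost X A t \<in> borel_measurable M"
proof -
  have [measurable]: "X t \<in> M \<rightarrow>\<^sub>M borel" "A t \<in> M \<rightarrow>\<^sub>M borel" "X (Suc t) \<in> M \<rightarrow>\<^sub>M borel"
    using X_measurable(2)[OF XA] A_measurable(2)[OF XA] t by auto
  note [measurable] = cost_measurable[OF t] c
  show ?thesis unfolding tail_cost_def by measurable
qed

lemma risk_bound: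
  assumes "t \<ge> 1"
  obtains \<beta> where "0 \<le> \<beta>" "\<And>x. \<bar>\<sigma> t x (return borel 0)\<bar> \<le> ereal \<beta>"
    "\<And>x \<mu> m. \<mu> \<in> probs_on {-m..m} \<Longrightarrow> \<bar>\<sigma> t x \<mu>\<bar> \<le> ereal (\<beta> + m)"
  using risk_bounded[OF assms] convex_risk_measure_bound[OF risk[OF assms]] by blast

text \<open>The inductive step needs measurability of the later cost, since only then is its conditional
  distribution meaningful.\<close>

lemma cost_to_go_regular:
  assumes XA: "(X, A) \<in> \<Psi>" and t: "t \<ge> 1" "t \<le> Suc T"
  shows "cost_to_go X A t \<in> borel_measurable M \<and> (\<exists>m\<ge>0. \<forall>\<omega>\<in>space M. \<bar>cost_to_go X A t \<omega>\<bar> \<le> m)"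
  using t(2)
proof (induction t rule: inc_induct)
  case base
  have "cost_to_go X A (Suc T) = (\<lambda>_. 0)" by (simp add: cost_to_go_def fun_eq_iff)
  then show ?case by (auto intro: exI[of _ 0])
next
  case (step n)
  then have n: "n \<ge> 1" "n \<le> T" using t by auto
  from step obtain m where m: "cost_to_go X A (Suc n) \<in> borel_measurable M" "m \<ge> 0"
    "\<And>\<omega>. \<omega> \<in> space M \<Longrightarrow> \<bar>cost_to_go X A (Suc n) \<omega>\<bar> \<le> m" by blast
  obtain \<beta> where \<beta>: "0 \<le> \<beta>" "\<And>x \<mu> m. \<mu> \<in> probs_on {-m..m} \<Longrightarrow> \<bar>\<sigma> n x \<mu>\<bar> \<le> ereal (\<beta> + m)"
    using risk_bound[OF n(1)] by metis
  interpret U: prob_subalgebra M "U n" by (rule U_sub)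
  define \<kappa> where "\<kappa> = reg_cond_distr M (U n) (tail_cost X A n)"
  have tm: "tail_cost X A n \<in> borel_measurable M" by (rule tail_cost_measurable[OF XA n(1) m(1)])
  have "AE \<omega> in M. \<bar>tail_cost X A n \<omega>\<bar> \<le> b + m" using tail_cost_bounded[OF n(1) m(3)] by (rule AE_I2)
  note \<kappa> = U.reg_cond_distr_spec[OF tm this, folded \<kappa>_def]
  have "(\<lambda>\<omega>. (\<lambda>(x, \<mu>). \<sigma> n x \<mu>) (X n \<omega>, \<kappa> \<omega>)) \<in> U n \<rightarrow>\<^sub>M borel"
  proof (rule measurable_compose_weak_borel[OF _ _ risk_measurable[OF n(1)]])
    show "compact {-(b + m)..b + m}" "{-(b + m)..b + m} \<noteq> {}" "compact {-(b + m)..b + m}" using b m(2) by auto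
    show "X n \<in> U n \<rightarrow>\<^sub>M borel" by (rule X_measurable[OF XA n(1)])
    show "\<kappa> \<in> U n \<rightarrow>\<^sub>M prob_algebra borel" using \<kappa>(1) unfolding cond_kernel_def by simp
    show "\<kappa> \<omega> \<in> probs_on {-(b + m)..b + m}" if "\<omega> \<in> space (U n)" for \<omega> using \<kappa>(2) that space_joint_filt by simp
  qed
  from U.U_measurable[OF this] have [measurable]: "(\<lambda>\<omega>. \<sigma> n (X n \<omega>) (\<kappa> \<omega>)) \<in> borel_measurable M" by simp
  have eq: "cost_to_go X A n = (\<lambda>\<omega>. real_of_ereal (\<sigma> n (X n \<omega>) (\<kappa> \<omega>)))"
    using cost_to_go_step[OF n] unfolding \<kappa>_def by (simp add: fun_eq_iff)
  have "\<bar>real_of_ereal (\<sigma> n (X n \<omega>) (\<kappa> \<omega>))\<bar> \<le> \<beta> + (b + m)" if "\<omega> \<in> space M" for \<omega>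
    using \<beta>(2)[OF \<kappa>(2)[OF that], of "X n \<omega>"] by (cases "\<sigma> n (X n \<omega>) (\<kappa> \<omega>)") auto
  then show ?case unfolding eq using \<beta>(1) m(2) b by (auto intro!: exI[of _ "\<beta> + (b + m)"])
qed

text \<open>Given the past and the current state, the action follows \<open>\<kappa> \<omega>\<close> and the next state
  follows the transition kernel, so a cost of the current transition has the law \<open>cost_law\<close>.\<close>

lemma cond_kernel_cost_law:
  assumes XA: "(X, A) \<in> \<Psi>" and t: "t \<ge> 1" and g: "g \<in> borel_measurable borel"
    and \<kappa>: "cond_kernel M (U t) borel (A t) \<kappa>"
  shows "cond_kernel M (U t) borel (\<lambda>\<omega>. g (X t \<omega>, A t \<omega>, X (Suc t) \<omega>)) (\<lambda>\<omega>. cost_law (P t) g (X t \<omega>) (\<kappa> \<omega>))"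
proof -
  interpret U: prob_subalgebra M "U t" by (rule U_sub)
  interpret p: feller_kernel "P t" by (rule kernel_feller[OF t])
  have "cond_kernel M (U t) borel (\<lambda>\<omega>. g (X t \<omega>, A t \<omega>, X (Suc t) \<omega>))
    (\<lambda>\<omega>. \<kappa> \<omega> \<bind> (\<lambda>a. distr ((\<lambda>(x, a). P t x a) (X t \<omega>, a)) borel (\<lambda>y. g (X t \<omega>, a, y))))"
  proof (rule U.cond_kernel_composition[OF G_sub joint_filt_le_G])
    show "X t \<in> U t \<rightarrow>\<^sub>M borel" by (rule X_measurable[OF XA t])
    show "A t \<in> G t \<rightarrow>\<^sub>M borel" by (rule A_measurable[OF XA t])
    show "X (Suc t) \<in> M \<rightarrow>\<^sub>M borel" by (rule X_measurable[OF XA]) simp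
    show "cond_kernel M (U t) borel (A t) \<kappa>" by (rule \<kappa>)
    show pm: "(\<lambda>(x, a). P t x a) \<in> borel \<Otimes>\<^sub>M borel \<rightarrow>\<^sub>M prob_algebra borel" by (rule p.p_meas)
    show "g \<in> borel \<Otimes>\<^sub>M borel \<Otimes>\<^sub>M borel \<rightarrow>\<^sub>M borel" using g by (simp add: borel_prod)
    have XG: "X t \<in> G t \<rightarrow>\<^sub>M borel"
      by (rule measurable_from_subalg[OF _ X_measurable(1)[OF XA t]])
        (use joint_filt_le_G in \<open>auto simp: subalgebra_def space_joint_filt G.space_F\<close>)
    have "(\<lambda>\<omega>. (X t \<omega>, A t \<omega>)) \<in> G t \<rightarrow>\<^sub>M borel \<Otimes>\<^sub>M borel" using XG A_measurable(1)[OF XA t] by simp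
    from measurable_compose[OF this pm]
    have "(\<lambda>\<omega>. (\<lambda>(x, a). P t x a) (X t \<omega>, A t \<omega>)) \<in> G t \<rightarrow>\<^sub>M prob_algebra borel" .
    moreover have "\<forall>B\<in>sets borel. AE \<omega> in M. cond_prob_in M (G t) (X (Suc t)) B \<omega> = measure (P t (X t \<omega>) (A t \<omega>)) B"
      using \<Psi>_controlled[OF XA] t unfolding controlled_process_def by simp
    ultimately show "cond_kernel M (G t) borel (X (Suc t)) (\<lambda>\<omega>. (\<lambda>(x, a). P t x a) (X t \<omega>, A t \<omega>))"
      unfolding cond_kernel_def by simp
  qed
  then show ?thesis by (simp add: cost_law_def)
qed

definition extended_cost :: "nat \<Rightarrow> ('x \<Rightarrow> real) \<Rightarrow> 'x \<times> 'a \<times> 'x \<Rightarrow> real" where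
  "extended_cost t v z = C t z + \<gamma> * v (snd (snd z))"

lemma extended_cost_lsc:
  assumes "t \<ge> 1" "lower_semicontinuous v"
  shows "lower_semicontinuous (extended_cost t v)"
proof -
  have "lower_semicontinuous (\<lambda>z::'x \<times> 'a \<times> 'x. v (snd (snd z)))"
    by (rule lower_semicontinuous_compose[OF assms(2)]) (intro continuous_intros)
  then show ?thesis
    unfolding extended_cost_def[abs_def] using \<gamma> cost_lsc[OF assms(1)]
    by (intro lower_semicontinuous_add_cmult) auto
qed

lemma extended_cost_bounded:
  assumes "t \<ge> 1" "\<And>x. \<bar>v x\<bar> \<le> m"
  shows "\<bar>extended_cost t v z\<bar> \<le> b + m"
proof -
  have "\<bar>\<gamma> * v (snd (snd z))\<bar> \<le> 1 * m" unfolding abs_mult using \<gamma> assms(2) by (intro mult_mono) auto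
  then show ?thesis using cost_bounded[OF assms(1), of z] unfolding extended_cost_def by linarith
qed

text \<open>If \<open>v\<close> bounds the later cost on one side, then replacing the later cost by \<open>v\<close> moves the
  conditional law in the stochastic order, and the risk measure is monotone for that order. The
  history enters only through the conditional law \<open>\<kappa> \<omega>\<close> of the action.\<close>

lemma risk_comparison:
  assumes XA: "(X, A) \<in> \<Psi>" and t: "t \<ge> 1" "t \<le> T"
    and v: "lower_semicontinuous v" "\<And>x. \<bar>v x\<bar> \<le> m"
    and \<kappa>: "cond_kernel M (U t) borel (A t) \<kappa>"
  shows "AE \<omega> in M. v (X (Suc t) \<omega>) \<le> cost_to_go X A (Suc t) \<omega> \<Longrightarrow>
      AE \<omega> in M. \<sigma> t (X t \<omega>) (cost_law (P t) (extended_cost t v) (X t \<omega>) (\<kappa> \<omega>)) \<le> ereal (cost_to_go X A t \<omega>)"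
    and "AE \<omega> in M. cost_to_go X A (Suc t) \<omega> \<le> v (X (Suc t) \<omega>) \<Longrightarrow>
      AE \<omega> in M. ereal (cost_to_go X A t \<omega>) \<le> \<sigma> t (X t \<omega>) (cost_law (P t) (extended_cost t v) (X t \<omega>) (\<kappa> \<omega>))"
proof -
  interpret U: prob_subalgebra M "U t" by (rule U_sub)
  interpret p: feller_kernel "P t" by (rule kernel_feller[OF t(1)])
  define g where "g = extended_cost t v"
  have g: "g \<in> borel_measurable borel"
    unfolding g_def by (rule lower_semicontinuous_borel[OF extended_cost_lsc[OF t(1) v(1)]])
  have gb: "\<bar>g z\<bar> \<le> b + m" for z unfolding g_def by (rule extended_cost_bounded[OF t(1) v(2)])
  define Y where "Y \<omega> = g (X t \<omega>, A t \<omega>, X (Suc t) \<omega>)" for \<omega>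
  note Yk = cond_kernel_cost_law[OF XA t(1) g \<kappa>, folded Y_def]
  have Ym: "Y \<in> borel_measurable M"
  proof -
    have [measurable]: "X t \<in> M \<rightarrow>\<^sub>M borel" "A t \<in> M \<rightarrow>\<^sub>M borel" "X (Suc t) \<in> M \<rightarrow>\<^sub>M borel"
      using X_measurable(2)[OF XA] A_measurable(2)[OF XA] t by auto
    note [measurable] = g
    show ?thesis unfolding Y_def by measurable
  qed
  obtain m' where m': "cost_to_go X A (Suc t) \<in> borel_measurable M"
    "\<And>\<omega>. \<omega> \<in> space M \<Longrightarrow> \<bar>cost_to_go X A (Suc t) \<omega>\<bar> \<le> m'"
    using cost_to_go_regular[OF XA, of "Suc t"] t by auto
  have tm: "tail_cost X A t \<in> borel_measurable M" by (rule tail_cost_measurable[OF XA t(1) m'(1)])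
  have tb: "AE \<omega> in M. \<bar>tail_cost X A t \<omega>\<bar> \<le> b + m'" using tail_cost_bounded[OF t(1) m'(2)] by (rule AE_I2)
  define \<tau> where "\<tau> = reg_cond_distr M (U t) (tail_cost X A t)"
  note \<tau> = U.reg_cond_distr_spec[OF tm tb, folded \<tau>_def]
  have \<kappa>b: "\<kappa> \<omega> \<in> borel_probs" if "\<omega> \<in> space M" for \<omega>
    using \<kappa> measurable_space[of \<kappa> "U t" _ \<omega>] that
    unfolding borel_probs_eq_space cond_kernel_def space_joint_filt by blast
  have law: "cost_law (P t) g (X t \<omega>) (\<kappa> \<omega>) \<in> probs_on {-(b + m)..b + m}" if "\<omega> \<in> space M" for \<omega>
    by (rule p.cost_law_bounded[OF g gb \<kappa>b[OF that]])
  obtain \<beta> where \<beta>: "\<And>x \<mu> m. \<mu> \<in> probs_on {-m..m} \<Longrightarrow> \<bar>\<sigma> t x \<mu>\<bar> \<le> ereal (\<beta> + m)"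
    using risk_bound[OF t(1)] by metis
  have ctg: "ereal (cost_to_go X A t \<omega>) = \<sigma> t (X t \<omega>) (\<tau> \<omega>)" if "\<omega> \<in> space M" for \<omega>
    using \<beta>[OF \<tau>(2)[OF that], of "X t \<omega>"] unfolding cost_to_go_step[OF t] \<tau>_def[symmetric]
    by (cases "\<sigma> t (X t \<omega>) (\<tau> \<omega>)") auto
  have \<gamma>0: "0 \<le> \<gamma>" using \<gamma> by simp
  show "AE \<omega> in M. \<sigma> t (X t \<omega>) (cost_law (P t) (extended_cost t v) (X t \<omega>) (\<kappa> \<omega>)) \<le> ereal (cost_to_go X A t \<omega>)"
    if le: "AE \<omega> in M. v (X (Suc t) \<omega>) \<le> cost_to_go X A (Suc t) \<omega>"
  proof -
    have "AE \<omega> in M. Y \<omega> \<le> tail_cost X A t \<omega>"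
      using le by eventually_elim (auto simp: Y_def g_def extended_cost_def tail_cost_def intro: mult_left_mono[OF _ \<gamma>0])
    from U.cond_kernel_cdf_mono[OF tm Ym \<tau>(1) Yk this]
    show ?thesis using AE_space
    proof eventually_elim
      case (elim \<omega>)
      have "\<sigma> t (X t \<omega>) (cost_law (P t) g (X t \<omega>) (\<kappa> \<omega>)) \<le> \<sigma> t (X t \<omega>) (\<tau> \<omega>)"
        by (rule convex_risk_measure_mono[OF risk[OF t(1)] law[OF elim(2)] \<tau>(2)[OF elim(2)]]) (use elim(1) in blast)
      then show ?case unfolding g_def ctg[OF elim(2)] .
    qed
  qed
  show "AE \<omega> in M. ereal (cost_to_go X A t \<omega>) \<le> \<sigma> t (X t \<omega>) (cost_law (P t) (extended_cost t v) (X t \<omega>) (\<kappa> \<omega>))"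
    if le: "AE \<omega> in M. cost_to_go X A (Suc t) \<omega> \<le> v (X (Suc t) \<omega>)"
  proof -
    have "AE \<omega> in M. tail_cost X A t \<omega> \<le> Y \<omega>"
      using le by eventually_elim (auto simp: Y_def g_def extended_cost_def tail_cost_def intro: mult_left_mono[OF _ \<gamma>0])
    from U.cond_kernel_cdf_mono[OF Ym tm Yk \<tau>(1) this]
    show ?thesis using AE_space
    proof eventually_elim
      case (elim \<omega>)
      have "\<sigma> t (X t \<omega>) (\<tau> \<omega>) \<le> \<sigma> t (X t \<omega>) (cost_law (P t) g (X t \<omega>) (\<kappa> \<omega>))"
        by (rule convex_risk_measure_mono[OF risk[OF t(1)] \<tau>(2)[OF elim(2)] law[OF elim(2)]]) (use elim(1) in blast)
      then show ?case unfolding g_def ctg[OF elim(2)] .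
    qed
  qed
qed

lemma optimal_step:
  assumes t: "t \<ge> 1" and w: "lower_semicontinuous w" "\<And>x. \<bar>w x\<bar> \<le> m"
  obtains v m' \<pi> where "lower_semicontinuous v" "\<And>x. \<bar>v x\<bar> \<le> m'"
    "\<pi> \<in> borel \<rightarrow>\<^sub>M prob_algebra borel" "\<pi> \<in> borel \<rightarrow>\<^sub>M borel_of weak_topology"
    "\<And>x. \<pi> x \<in> probs_on (\<A> t x)"
    "\<And>x. \<sigma> t x (cost_law (P t) (extended_cost t w) x (\<pi> x)) = ereal (v x)"
    "\<And>x \<mu>. \<mu> \<in> probs_on (\<A> t x) \<Longrightarrow> ereal (v x) \<le> \<sigma> t x (cost_law (P t) (extended_cost t w) x \<mu>)"
proof -
  interpret p: feller_kernel "P t" by (rule kernel_feller[OF t])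
  obtain \<beta> where \<beta>: "\<And>x. \<bar>\<sigma> t x (return borel 0)\<bar> \<le> ereal \<beta>" using risk_bound[OF t] by metis
  show ?thesis
    by (rule p.bellman_step[OF risk[OF t] \<beta> risk_lsc[OF t] actions_nonempty[OF t] actions_closed[OF t]
      actions_compact[OF t] actions_uhc[OF t] extended_cost_lsc[OF t w(1)] extended_cost_bounded[OF t w(2)]])
      (assumption | rule that)+
qed

lemma markov_policy_exists: "markov_policies \<A> \<noteq> {}"
proof -
  have lsc0: "lower_semicontinuous (\<lambda>x::'x. 0)" unfolding lower_semicontinuous_def by simp
  have "\<exists>\<pi>. \<pi> \<in> borel \<rightarrow>\<^sub>M borel_of weak_topology \<and> (\<forall>x. \<pi> x \<in> probs_on (\<A> t x))" if "t \<ge> 1" for t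
    using optimal_step[OF that lsc0, of 0] by (metis abs_zero order_refl)
  then have "\<forall>t. \<exists>\<pi>. t \<ge> 1 \<longrightarrow> \<pi> \<in> borel \<rightarrow>\<^sub>M borel_of weak_topology \<and> (\<forall>x. \<pi> x \<in> probs_on (\<A> t x))" by blast
  from choice[OF this] show ?thesis unfolding markov_policies_def by blast
qed

lemma actions_AE:
  assumes XA: "(X, A) \<in> \<Psi>" and t: "t \<ge> 1"
  shows "AE \<omega> in M. A t \<omega> \<in> \<A> t (X t \<omega>)"
proof -
  have "AE \<omega> in M. \<forall>t\<ge>1. A t \<omega> \<in> \<A> t (X t \<omega>)"
    using \<Psi>_controlled[OF XA] unfolding controlled_process_def by blast
  then show ?thesis by eventually_elim (use t in blast)
qed

text \<open>Even for a history-dependent process the conditional law of the action is an admissible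
  randomised action in the current state, because the graph of the action sets is closed and hence
  measurable.\<close>

lemma conditional_action_law:
  assumes XA: "(X, A) \<in> \<Psi>" and t: "t \<ge> 1"
  obtains \<kappa> where "cond_kernel M (U t) borel (A t) \<kappa>" "AE \<omega> in M. \<kappa> \<omega> \<in> probs_on (\<A> t (X t \<omega>))"
proof -
  interpret U: prob_subalgebra M "U t" by (rule U_sub)
  define K where "K = (\<Union>x. \<A> t x)"
  have K: "compact K" "K \<noteq> {}" using actions_compact[OF t] actions_nonempty[OF t] unfolding K_def by auto
  note Am = A_measurable(2)[OF XA t]
  have "AE \<omega> in M. A t \<omega> \<in> K" using actions_AE[OF XA t] by eventually_elim (auto simp: K_def)
  then obtain \<kappa> where \<kappa>: "cond_kernel M (U t) borel (A t) \<kappa>" "\<And>\<omega>. \<kappa> \<omega> \<in> probs_on K"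
    using U.compact_cond_kernel_exists[OF Am K] by metis
  have graph: "{z. snd z \<in> \<A> t (fst z)} \<in> sets (borel \<Otimes>\<^sub>M borel)"
    unfolding borel_prod
    by (intro borel_closed upper_hemicontinuous_closed_graph actions_uhc[OF t] actions_closed[OF t])
  have "(\<lambda>z. (X t (fst z), snd z)) \<in> U t \<Otimes>\<^sub>M borel \<rightarrow>\<^sub>M borel \<Otimes>\<^sub>M (borel :: 'a measure)"
    using X_measurable(1)[OF XA t] by measurable
  from measurable_sets[OF this graph]
  have "Measurable.pred (U t \<Otimes>\<^sub>M borel) (\<lambda>z. snd z \<in> \<A> t (X t (fst z)))"
    by (simp add: pred_def vimage_def Int_def conj_commute)
  from U.cond_kernel_AE[OF Am \<kappa>(1) this] actions_AE[OF XA t]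
  have "AE \<omega> in M. AE a in \<kappa> \<omega>. a \<in> \<A> t (X t \<omega>)" by simp
  then have "AE \<omega> in M. \<kappa> \<omega> \<in> probs_on (\<A> t (X t \<omega>))"
  proof (rule eventually_mono)
    fix \<omega> assume "AE a in \<kappa> \<omega>. a \<in> \<A> t (X t \<omega>)"
    then show "\<kappa> \<omega> \<in> probs_on (\<A> t (X t \<omega>))"
      using probs_on_AE[OF borel_closed[OF actions_closed[OF t]]] probs_on_borel_probs[OF \<kappa>(2)] by blast
  qed
  then show ?thesis using that \<kappa>(1) by blast
qed

text \<open>The induction carries a value function that bounds every controlled process from below and
  the processes of one policy from above. The upper bound is claimed for all policies that agree with
  \<open>\<pi>\<close> from time \<open>t\<close> on, so that the decision rules of earlier times can still be changed.\<close>

lemma value_exists: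
  assumes "t \<ge> 1" "t \<le> Suc T"
  shows "\<exists>v m \<pi>. lower_semicontinuous v \<and> (\<forall>x. \<bar>v x\<bar> \<le> m) \<and> \<pi> \<in> markov_policies \<A> \<and>
    (\<forall>(X, A)\<in>\<Psi>. AE \<omega> in M. v (X t \<omega>) \<le> cost_to_go X A t \<omega>) \<and>
    (\<forall>\<pi>'\<in>markov_policies \<A>. (\<forall>s\<ge>t. \<pi>' s = \<pi> s) \<longrightarrow>
       (AE \<omega> in M. cost_to_go (X\<^sub>p \<pi>') (A\<^sub>p \<pi>') t \<omega> \<le> v (X\<^sub>p \<pi>' t \<omega>)))"
  using assms(2)
proof (induction t rule: inc_induct)
  case base
  obtain \<pi> where "\<pi> \<in> markov_policies \<A>" using markov_policy_exists by blast
  then show ?case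
    by (intro exI[of _ "\<lambda>x. 0"] exI[of _ 0] exI[of _ \<pi>])
      (auto simp: lower_semicontinuous_def cost_to_go_def)
next
  case (step n)
  then have n: "n \<ge> 1" "n \<le> T" using assms(1) by auto
  from step.IH obtain w m \<pi> where w: "lower_semicontinuous w" "\<And>x. \<bar>w x\<bar> \<le> m"
    and \<pi>: "\<pi> \<in> markov_policies \<A>"
    and lower: "\<And>X A. (X, A) \<in> \<Psi> \<Longrightarrow> AE \<omega> in M. w (X (Suc n) \<omega>) \<le> cost_to_go X A (Suc n) \<omega>"
    and upper: "\<And>\<pi>'. \<pi>' \<in> markov_policies \<A> \<Longrightarrow> (\<forall>s\<ge>Suc n. \<pi>' s = \<pi> s) \<Longrightarrow>
       AE \<omega> in M. cost_to_go (X\<^sub>p \<pi>') (A\<^sub>p \<pi>') (Suc n) \<omega> \<le> w (X\<^sub>p \<pi>' (Suc n) \<omega>)"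
    by blast
  obtain v m' \<pi>n where v: "lower_semicontinuous v" "\<And>x. \<bar>v x\<bar> \<le> m'"
    and \<pi>n: "\<pi>n \<in> borel \<rightarrow>\<^sub>M prob_algebra borel" "\<pi>n \<in> borel \<rightarrow>\<^sub>M borel_of weak_topology"
      "\<And>x. \<pi>n x \<in> probs_on (\<A> n x)"
      "\<And>x. \<sigma> n x (cost_law (P n) (extended_cost n w) x (\<pi>n x)) = ereal (v x)"
    and v_le: "\<And>x \<mu>. \<mu> \<in> probs_on (\<A> n x) \<Longrightarrow> ereal (v x) \<le> \<sigma> n x (cost_law (P n) (extended_cost n w) x \<mu>)"
    by (rule optimal_step[OF n(1) w]) blast
  define \<pi>2 where "\<pi>2 = \<pi>(n := \<pi>n)"
  have "\<pi>2 \<in> markov_policies \<A>" using \<pi> \<pi>n unfolding markov_policies_def \<pi>2_def by auto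
  moreover have "AE \<omega> in M. v (X n \<omega>) \<le> cost_to_go X A n \<omega>" if XA: "(X, A) \<in> \<Psi>" for X A
  proof -
    obtain \<kappa> where \<kappa>: "cond_kernel M (U n) borel (A n) \<kappa>" "AE \<omega> in M. \<kappa> \<omega> \<in> probs_on (\<A> n (X n \<omega>))"
      by (rule conditional_action_law[OF XA n(1)])
    from risk_comparison(1)[OF XA n w \<kappa>(1) lower[OF XA]] \<kappa>(2)
    show ?thesis
    proof eventually_elim
      case (elim \<omega>)
      show ?case using order_trans[OF v_le[OF elim(2)] elim(1)] by simp
    qed
  qed
  moreover have "AE \<omega> in M. cost_to_go (X\<^sub>p \<pi>') (A\<^sub>p \<pi>') n \<omega> \<le> v (X\<^sub>p \<pi>' n \<omega>)"
    if \<pi>': "\<pi>' \<in> markov_policies \<A>" and eq: "\<forall>s\<ge>n. \<pi>' s = \<pi>2 s" for \<pi>'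
  proof -
    have XA: "(X\<^sub>p \<pi>', A\<^sub>p \<pi>') \<in> \<Psi>" and fp: "follows_policy M F G \<pi>' (X\<^sub>p \<pi>') (A\<^sub>p \<pi>')"
      using policy_pair[OF \<pi>'] by auto
    have "AE \<omega> in M. cost_to_go (X\<^sub>p \<pi>') (A\<^sub>p \<pi>') (Suc n) \<omega> \<le> w (X\<^sub>p \<pi>' (Suc n) \<omega>)"
      by (rule upper[OF \<pi>']) (use eq in \<open>auto simp: \<pi>2_def\<close>)
    moreover have "cond_kernel M (U n) borel (A\<^sub>p \<pi>' n) (\<lambda>\<omega>. \<pi>n (X\<^sub>p \<pi>' n \<omega>))"
      unfolding cond_kernel_def
    proof (intro conjI ballI)
      show "(\<lambda>\<omega>. \<pi>n (X\<^sub>p \<pi>' n \<omega>)) \<in> U n \<rightarrow>\<^sub>M prob_algebra borel"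
        by (rule measurable_compose[OF X_measurable(1)[OF XA n(1)] \<pi>n(1)])
      fix B :: "'a set" assume B: "B \<in> sets borel"
      have "\<pi>' n = \<pi>n" using eq by (simp add: \<pi>2_def)
      have "AE \<omega> in M. cond_prob_in M (U n) (A\<^sub>p \<pi>' n) B \<omega>
          = cond_prob_in M (vimage_algebra (space M) (X\<^sub>p \<pi>' n) borel) (A\<^sub>p \<pi>' n) B \<omega> \<and>
        cond_prob_in M (vimage_algebra (space M) (X\<^sub>p \<pi>' n) borel) (A\<^sub>p \<pi>' n) B \<omega>
          = measure (\<pi>' n (X\<^sub>p \<pi>' n \<omega>)) B"
        using fp n(1) B unfolding follows_policy_def by blast
      then show "AE \<omega> in M. cond_prob_in M (U n) (A\<^sub>p \<pi>' n) B \<omega> = measure (\<pi>n (X\<^sub>p \<pi>' n \<omega>)) B"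
        unfolding \<open>\<pi>' n = \<pi>n\<close> by eventually_elim simp
    qed
    ultimately have "AE \<omega> in M. ereal (cost_to_go (X\<^sub>p \<pi>') (A\<^sub>p \<pi>') n \<omega>)
        \<le> \<sigma> n (X\<^sub>p \<pi>' n \<omega>) (cost_law (P n) (extended_cost n w) (X\<^sub>p \<pi>' n \<omega>) (\<pi>n (X\<^sub>p \<pi>' n \<omega>)))"
      by (intro risk_comparison(2)[OF XA n w])
    then show ?thesis unfolding \<pi>n(4) by simp
  qed
  ultimately show ?case using v by (intro exI[of _ v] exI[of _ m'] exI[of _ \<pi>2]) auto
qed

text \<open>Almost sure order implies the stochastic order of the laws.\<close>

lemma initial_risk_mono:
  assumes Y: "Y \<in> borel_measurable M" "Y' \<in> borel_measurable M"
    and m: "\<And>\<omega>. \<omega> \<in> space M \<Longrightarrow> \<bar>Y \<omega>\<bar> \<le> m" "\<And>\<omega>. \<omega> \<in> space M \<Longrightarrow> \<bar>Y' \<omega>\<bar> \<le> m"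
    and le: "AE \<omega> in M. Y \<omega> \<le> Y' \<omega>"
  shows "\<sigma>\<^sub>0 (distr M borel Y) \<le> \<sigma>\<^sub>0 (distr M borel Y')"
proof (rule convex_risk_measure_mono[OF risk_0])
  have d: "distr M borel Z \<in> probs_on {-m..m}"
    if "Z \<in> borel_measurable M" "\<And>\<omega>. \<omega> \<in> space M \<Longrightarrow> \<bar>Z \<omega>\<bar> \<le> m" for Z :: "'w \<Rightarrow> real"
    using that prob_space_distr[OF that(1)]
    by (auto simp: probs_on_AE borel_probs_def AE_distr_iff abs_le_iff minus_le_iff intro!: AE_I2)
  show "distr M borel Y \<in> probs_on {-m..m}" "distr M borel Y' \<in> probs_on {-m..m}"
    by (rule d; fact)+
  fix r
  have "measure (distr M borel Z) {..r} = measure M {\<omega> \<in> space M. Z \<omega> \<le> r}"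
    if "Z \<in> borel_measurable M" for Z :: "'w \<Rightarrow> real"
    using that by (subst measure_distr) (auto intro!: arg_cong[where f="measure M"])
  moreover have "measure M {\<omega> \<in> space M. Y' \<omega> \<le> r} \<le> measure M {\<omega> \<in> space M. Y \<omega> \<le> r}"
    using le Y by (intro finite_measure_mono_AE) (auto elim: eventually_mono)
  ultimately show "measure (distr M borel Y') {..r} \<le> measure (distr M borel Y) {..r}" using Y by simp
qed

lemma dyn_risk0_eq: "dyn_risk0 M F G \<sigma>\<^sub>0 \<sigma> \<gamma> T X (cost_process C X A) = \<sigma>\<^sub>0 (distr M borel (\<lambda>\<omega>. \<gamma> * cost_to_go X A 1 \<omega>))"
  using T by (simp add: dyn_risk0_def cost_to_go_def cost_process_def)

text \<open>All processes in \<open>\<Psi>\<close> have the initial law \<open>\<xi>\<close>, so the value at time \<open>1\<close> has the same law for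
  the optimal policy and for the given process, and the initial risk measure sees only laws.\<close>

theorem markov_policies_suffice:
  assumes XA: "(X, A) \<in> \<Psi>"
  shows "(INF \<pi> \<in> markov_policies \<A>. dyn_risk0 M F G \<sigma>\<^sub>0 \<sigma> \<gamma> T (X\<^sub>p \<pi>) (cost_process C (X\<^sub>p \<pi>) (A\<^sub>p \<pi>)))
    \<le> dyn_risk0 M F G \<sigma>\<^sub>0 \<sigma> \<gamma> T X (cost_process C X A)"
proof -
  have \<gamma>0: "0 \<le> \<gamma>" using \<gamma> by simp
  obtain v m \<pi> where v: "lower_semicontinuous v" "\<And>x. \<bar>v x\<bar> \<le> m" and \<pi>: "\<pi> \<in> markov_policies \<A>"
    and lower: "\<And>X A. (X, A) \<in> \<Psi> \<Longrightarrow> AE \<omega> in M. v (X 1 \<omega>) \<le> cost_to_go X A 1 \<omega>"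
    and upper: "AE \<omega> in M. cost_to_go (X\<^sub>p \<pi>) (A\<^sub>p \<pi>) 1 \<omega> \<le> v (X\<^sub>p \<pi> 1 \<omega>)"
    using value_exists[of 1] by auto blast
  have vm: "v \<in> borel_measurable borel" by (rule lower_semicontinuous_borel[OF v(1)])
  have regular: "\<exists>m'. (\<lambda>\<omega>. \<gamma> * v (X 1 \<omega>)) \<in> borel_measurable M \<and> (\<lambda>\<omega>. \<gamma> * cost_to_go X A 1 \<omega>) \<in> borel_measurable M \<and>
      (\<forall>\<omega>\<in>space M. \<bar>\<gamma> * v (X 1 \<omega>)\<bar> \<le> m') \<and> (\<forall>\<omega>\<in>space M. \<bar>\<gamma> * cost_to_go X A 1 \<omega>\<bar> \<le> m') \<and>
      distr M borel (\<lambda>\<omega>. \<gamma> * v (X 1 \<omega>)) = distr \<xi> borel (\<lambda>x. \<gamma> * v x)"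
    if XA: "(X, A) \<in> \<Psi>" for X A
  proof -
    obtain m1 where m1: "cost_to_go X A 1 \<in> borel_measurable M" "\<And>\<omega>. \<omega> \<in> space M \<Longrightarrow> \<bar>cost_to_go X A 1 \<omega>\<bar> \<le> m1"
      using cost_to_go_regular[OF XA, of 1] by auto
    note [measurable] = m1(1) vm X_measurable(2)[OF XA order_refl]
    have "distr M borel (X 1) = \<xi>" using \<Psi>_controlled[OF XA] unfolding controlled_process_def by blast
    then have "distr \<xi> borel (\<lambda>x. \<gamma> * v x) = distr M borel ((\<lambda>x. \<gamma> * v x) \<circ> X 1)"
      using X_measurable(2)[OF XA order_refl] vm by (subst distr_distr[symmetric, where N=borel]) auto
    moreover have "\<bar>\<gamma> * v (X 1 \<omega>)\<bar> \<le> max m m1" for \<omega>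
    proof -
      have "\<bar>\<gamma> * v (X 1 \<omega>)\<bar> \<le> 1 * m" unfolding abs_mult using \<gamma> v(2) by (intro mult_mono) auto
      then show ?thesis by simp
    qed
    moreover have "\<bar>\<gamma> * cost_to_go X A 1 \<omega>\<bar> \<le> max m m1" if "\<omega> \<in> space M" for \<omega>
    proof -
      have "\<bar>\<gamma> * cost_to_go X A 1 \<omega>\<bar> \<le> 1 * m1" unfolding abs_mult using \<gamma> m1(2)[OF that] by (intro mult_mono) auto
      then show ?thesis by simp
    qed
    moreover have "(\<lambda>\<omega>. \<gamma> * v (X 1 \<omega>)) \<in> borel_measurable M" "(\<lambda>\<omega>. \<gamma> * cost_to_go X A 1 \<omega>) \<in> borel_measurable M"
      by measurable
    ultimately show ?thesis by (intro exI[of _ "max m m1"]) (auto simp: comp_def)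
  qed
  have XA\<pi>: "(X\<^sub>p \<pi>, A\<^sub>p \<pi>) \<in> \<Psi>" using policy_pair[OF \<pi>] by simp
  obtain m1 where r1: "(\<lambda>\<omega>. \<gamma> * v (X\<^sub>p \<pi> 1 \<omega>)) \<in> borel_measurable M"
      "(\<lambda>\<omega>. \<gamma> * cost_to_go (X\<^sub>p \<pi>) (A\<^sub>p \<pi>) 1 \<omega>) \<in> borel_measurable M"
      "\<And>\<omega>. \<omega> \<in> space M \<Longrightarrow> \<bar>\<gamma> * v (X\<^sub>p \<pi> 1 \<omega>)\<bar> \<le> m1"
      "\<And>\<omega>. \<omega> \<in> space M \<Longrightarrow> \<bar>\<gamma> * cost_to_go (X\<^sub>p \<pi>) (A\<^sub>p \<pi>) 1 \<omega>\<bar> \<le> m1"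
      "distr M borel (\<lambda>\<omega>. \<gamma> * v (X\<^sub>p \<pi> 1 \<omega>)) = distr \<xi> borel (\<lambda>x. \<gamma> * v x)"
    using regular[OF XA\<pi>] by blast
  obtain m2 where r2: "(\<lambda>\<omega>. \<gamma> * v (X 1 \<omega>)) \<in> borel_measurable M"
      "(\<lambda>\<omega>. \<gamma> * cost_to_go X A 1 \<omega>) \<in> borel_measurable M"
      "\<And>\<omega>. \<omega> \<in> space M \<Longrightarrow> \<bar>\<gamma> * v (X 1 \<omega>)\<bar> \<le> m2"
      "\<And>\<omega>. \<omega> \<in> space M \<Longrightarrow> \<bar>\<gamma> * cost_to_go X A 1 \<omega>\<bar> \<le> m2"
      "distr M borel (\<lambda>\<omega>. \<gamma> * v (X 1 \<omega>)) = distr \<xi> borel (\<lambda>x. \<gamma> * v x)"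
    using regular[OF XA] by blast
  have "(INF \<pi> \<in> markov_policies \<A>. dyn_risk0 M F G \<sigma>\<^sub>0 \<sigma> \<gamma> T (X\<^sub>p \<pi>) (cost_process C (X\<^sub>p \<pi>) (A\<^sub>p \<pi>)))
      \<le> \<sigma>\<^sub>0 (distr M borel (\<lambda>\<omega>. \<gamma> * cost_to_go (X\<^sub>p \<pi>) (A\<^sub>p \<pi>) 1 \<omega>))"
    unfolding dyn_risk0_eq using \<pi> by (rule INF_lower)
  also have "\<dots> \<le> \<sigma>\<^sub>0 (distr M borel (\<lambda>\<omega>. \<gamma> * v (X\<^sub>p \<pi> 1 \<omega>)))"
    by (rule initial_risk_mono[OF r1(2,1,4,3)])
      (use upper in \<open>auto elim!: eventually_mono intro: mult_left_mono[OF _ \<gamma>0]\<close>)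
  also have "\<dots> = \<sigma>\<^sub>0 (distr M borel (\<lambda>\<omega>. \<gamma> * v (X 1 \<omega>)))" unfolding r1(5) r2(5) ..
  also have "\<dots> \<le> \<sigma>\<^sub>0 (distr M borel (\<lambda>\<omega>. \<gamma> * cost_to_go X A 1 \<omega>))"
    by (rule initial_risk_mono[OF r2(1,2,3,4)])
      (use lower[OF XA] in \<open>auto elim!: eventually_mono intro: mult_left_mono[OF _ \<gamma>0]\<close>)
  finally show ?thesis unfolding dyn_risk0_eq .
qed

end

theorem proposition4p3:
  fixes M :: "'w measure" and F G :: "nat \<Rightarrow> 'w measure"
    and \<sigma>\<^sub>0 :: "real measure \<Rightarrow> ereal"
    and \<sigma> :: "nat \<Rightarrow> 'x::polish_space \<Rightarrow> real measure \<Rightarrow> ereal"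
    and \<A> :: "nat \<Rightarrow> 'x \<Rightarrow> 'a::polish_space set"
    and P :: "nat \<Rightarrow> 'x \<Rightarrow> 'a \<Rightarrow> 'x measure"
    and \<xi> :: "'x measure"
    and \<Psi> :: "((nat \<Rightarrow> 'w \<Rightarrow> 'x) \<times> (nat \<Rightarrow> 'w \<Rightarrow> 'a)) set"
    and X\<^sub>p :: "(nat \<Rightarrow> 'x \<Rightarrow> 'a measure) \<Rightarrow> nat \<Rightarrow> 'w \<Rightarrow> 'x"
    and A\<^sub>p :: "(nat \<Rightarrow> 'x \<Rightarrow> 'a measure) \<Rightarrow> nat \<Rightarrow> 'w \<Rightarrow> 'a"
    and C :: "nat \<Rightarrow> 'x \<times> 'a \<times> 'x \<Rightarrow> real"
    and \<gamma> b :: real and T :: nat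
    and X :: "nat \<Rightarrow> 'w \<Rightarrow> 'x" and A :: "nat \<Rightarrow> 'w \<Rightarrow> 'a"
  assumes setting: "risk_averse_mdp M F G \<sigma>\<^sub>0 \<sigma> \<A> P \<xi> \<Psi> X\<^sub>p A\<^sub>p C"
    and \<gamma>: "\<gamma> \<in> {0..1}" and T: "T \<ge> 1" and b: "b > 0"
    and kernel_weakly_continuous: "\<And>t x\<^sub>n x a\<^sub>n a (f :: 'x \<Rightarrow> real). t \<ge> 1 \<Longrightarrow>
          x\<^sub>n \<longlonglongrightarrow> x \<Longrightarrow> a\<^sub>n \<longlonglongrightarrow> a \<Longrightarrow> continuous_on UNIV f \<Longrightarrow> bounded (range f) \<Longrightarrow>
          (\<lambda>n. \<integral>y. f y \<partial>P t (x\<^sub>n n) (a\<^sub>n n)) \<longlonglongrightarrow> (\<integral>y. f y \<partial>P t x a)"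
    and actions_compact: "\<And>t. t \<ge> 1 \<Longrightarrow> compact (\<Union>x. \<A> t x)"
    and actions_uhc: "\<And>t. t \<ge> 1 \<Longrightarrow> upper_hemicontinuous (\<A> t)"
    and risk_lsc: "\<And>t K \<mu>\<^sub>n \<mu> x\<^sub>n x. t \<ge> 1 \<Longrightarrow> compact K \<Longrightarrow>
          (\<And>n. \<mu>\<^sub>n n \<in> probs_on K) \<Longrightarrow> \<mu> \<in> probs_on K \<Longrightarrow>
          limitin weak_topology \<mu>\<^sub>n \<mu> sequentially \<Longrightarrow> x\<^sub>n \<longlonglongrightarrow> x \<Longrightarrow>
          \<sigma> t x \<mu> \<le> liminf (\<lambda>n. \<sigma> t (x\<^sub>n n) (\<mu>\<^sub>n n))"
    and cost_lsc: "\<And>t. t \<ge> 1 \<Longrightarrow> lower_semicontinuous (C t)"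
    and cost_bounded: "\<And>t z. t \<ge> 1 \<Longrightarrow> \<bar>C t z\<bar> \<le> b"
    and XA: "(X, A) \<in> \<Psi>"
  shows "(INF \<pi> \<in> markov_policies \<A>.
            dyn_risk0 M F G \<sigma>\<^sub>0 \<sigma> \<gamma> T (X\<^sub>p \<pi>) (cost_process C (X\<^sub>p \<pi>) (A\<^sub>p \<pi>)))
         \<le> dyn_risk0 M F G \<sigma>\<^sub>0 \<sigma> \<gamma> T X (cost_process C X A)"
proof -
  interpret lower_semicontinuous_mdp M F G \<sigma>\<^sub>0 \<sigma> \<A> P \<xi> \<Psi> X\<^sub>p A\<^sub>p C \<gamma> b T
    by (rule lower_semicontinuous_mdp.intro[OF setting lower_semicontinuous_mdp_axioms.intro[OF \<gamma> T b
      kernel_weakly_continuous actions_compact actions_uhc risk_lsc cost_lsc cost_bounded]])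
  show ?thesis by (rule markov_policies_suffice[OF XA])
qed

end
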